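(* Let $V:\mathbb{Z}\to\mathbb{R}$ be bounded and let $H$ be the operator on $\ell^2(\mathbb{Z})$ given by $[H\psi](n)=\psi(n+1)+\psi(n-1)+V(n)\psi(n)$. Let $K\ge 4$ be such that $\sigma(H)\subseteq[-K+1,K-1]$. Suppose that for some $C\in(0,\infty)$ and $\alpha\in(0,1)$ we have, as $T\to\infty$, $$\int_{-K}^{K}\Big(\max_{3\le n\le CT^\alpha}\big\|\Phi(n,E+\tfrac{i}{T})\big\|^2\Big)^{-1}dE=O(T^{-m})$$ and $$\int_{-K}^{K}\Big(\max_{3\le -n\le CT^\alpha}\big\|\Phi(n,E+\tfrac{i}{T})\big\|^2\Big)^{-1}dE=O(T^{-m})$$ for every $m\ge 1$. Then $\alpha_u^+\le\alpha$. In particular, $\beta^+_{\delta_1}(p)\le\alpha$ for every $p>0$.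
   Context: For $z\in\mathbb{C}$ and $m\in\mathbb{Z}$ let $T(m,z)=\begin{pmatrix} z-V(m) & -1\\ 1 & 0\end{pmatrix}$, and define transfer matrices $\Phi(n,z)=T(n,z)\cdots T(1,z)$ for $n\ge1$, $\Phi(0,z)=\mathrm{Id}$, and $\Phi(n,z)=[T(n+1,z)]^{-1}\cdots[T(0,z)]^{-1}$ for $n\le -1$; thus $(u(n+1),u(n))^T=\Phi(n,z)(u(1),u(0))^T$ for every solution of $u(n+1)+u(n-1)+V(n)u(n)=zu(n)$. $\|\cdot\|$ is the operator norm of a $2\times 2$ matrix. Let $\delta_n$ be the standard basis vectors of $\ell^2(\mathbb{Z})$. For $T>0$ set $a(n,T)=\frac{2}{T}\int_0^\infty e^{-2t/T}|\langle e^{-itH}\delta_1,\delta_n\rangle|^2dt$, $\langle|X|^p_{\delta_1}\rangle(T)=\sum_n|n|^pa(n,T)$, and $P(N,T)=\sum_{|n|>N}a(n,T)$. For $\alpha'\in[0,\infty]$ define $S^+(\alpha')=-\limsup_{T\to\infty}\frac{\log P(T^{\alpha'}-2,T)}{\log T}$, and $\alpha_u^+=\sup\{\alpha'\ge0: S^+(\alpha')<\infty\}$. The upper transport exponent is $\beta^+_{\delta_1}(p)=\limsup_{T\to\infty}\frac{\log\langle|X|^p_{\delta_1}\rangle(T)}{p\log T}$ for $p>0$. *)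

theory Defs
  imports "HOL-Analysis.Analysis"
begin

definition Tm :: "(int \<Rightarrow> real) \<Rightarrow> int \<Rightarrow> complex \<Rightarrow> complex^2^2" where
  "Tm V m z = vector [vector [z - complex_of_real (V m), -1], vector [1, 0]]"

fun Phi_pos :: "(int \<Rightarrow> real) \<Rightarrow> nat \<Rightarrow> complex \<Rightarrow> complex^2^2" where
  "Phi_pos V 0 z = mat 1"
| "Phi_pos V (Suc k) z = Tm V (int k + 1) z ** Phi_pos V k z"

fun Phi_neg :: "(int \<Rightarrow> real) \<Rightarrow> nat \<Rightarrow> complex \<Rightarrow> complex^2^2" where
  "Phi_neg V 0 z = mat 1"
| "Phi_neg V (Suc k) z = matrix_inv (Tm V (- int k) z) ** Phi_neg V k z"

definition Phi :: "(int \<Rightarrow> real) \<Rightarrow> int \<Rightarrow> complex \<Rightarrow> complex^2^2" where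
  "Phi V n z = (if n \<ge> 0 then Phi_pos V (nat n) z else Phi_neg V (nat (- n)) z)"

definition mnorm :: "complex^2^2 \<Rightarrow> real" where
  "mnorm A = onorm (\<lambda>x. A *v x)"

definition Hop :: "(int \<Rightarrow> real) \<Rightarrow> (int \<Rightarrow> complex) \<Rightarrow> int \<Rightarrow> complex" where
  "Hop V \<psi> n = \<psi> (n + 1) + \<psi> (n - 1) + complex_of_real (V n) * \<psi> n"

definition ell2 :: "(int \<Rightarrow> complex) set" where
  "ell2 = {\<psi>. (\<lambda>n. (cmod (\<psi> n))\<^sup>2) summable_on UNIV}"

(* spectrum of H on l^2(Z): z such that H - z is not a bijection of l^2(Z)
   (bounded inverse is then automatic by the open mapping theorem) *)
definition spec :: "(int \<Rightarrow> real) \<Rightarrow> complex set" where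
  "spec V = {z. \<not> bij_betw (\<lambda>\<psi> n. Hop V \<psi> n - z * \<psi> n) ell2 ell2}"

definition delta :: "int \<Rightarrow> int \<Rightarrow> complex" where
  "delta j n = (if n = j then 1 else 0)"

(* <e^{-itH} delta_1, delta_n>, with e^{-itH} the exponential series of the bounded operator H *)
definition evo :: "(int \<Rightarrow> real) \<Rightarrow> real \<Rightarrow> int \<Rightarrow> complex" where
  "evo V t n = (\<Sum>k. ((- \<i> * complex_of_real t) ^ k / of_nat (fact k)) * ((Hop V ^^ k) (delta 1) n))"

definition aa :: "(int \<Rightarrow> real) \<Rightarrow> int \<Rightarrow> real \<Rightarrow> real" where
  "aa V n T = (2 / T) * (\<integral>t\<in>{0..}. exp (- 2 * t / T) * (cmod (evo V t n))\<^sup>2 \<partial>lborel)"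

definition Pout :: "(int \<Rightarrow> real) \<Rightarrow> real \<Rightarrow> real \<Rightarrow> real" where
  "Pout V N T = infsum (\<lambda>n. aa V n T) {n. real_of_int \<bar>n\<bar> > N}"

definition Splus :: "(int \<Rightarrow> real) \<Rightarrow> real \<Rightarrow> ereal" where
  "Splus V \<alpha>' = - Limsup at_top (\<lambda>T. ereal (ln (Pout V (T powr \<alpha>' - 2) T) / ln T))"

definition alpha_u_plus :: "(int \<Rightarrow> real) \<Rightarrow> ereal" where
  "alpha_u_plus V = Sup (ereal ` {\<alpha>'. \<alpha>' \<ge> 0 \<and> Splus V \<alpha>' < \<infinity>})"

definition moment :: "(int \<Rightarrow> real) \<Rightarrow> real \<Rightarrow> real \<Rightarrow> ennreal" where
  "moment V p T = infsum (\<lambda>n. ennreal (\<bar>real_of_int n\<bar> powr p * aa V n T)) UNIV"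

definition beta_plus :: "(int \<Rightarrow> real) \<Rightarrow> real \<Rightarrow> ereal" where
  "beta_plus V p = Limsup at_top (\<lambda>T. if moment V p T = top then \<infinity>
        else ereal (ln (enn2real (moment V p T)) / (p * ln T)))"

end

theory Submission
  imports Defs "HOL-Probability.Probability" "HOL-Real_Asymp.Real_Asymp"
begin

text \<open>
  By Plancherel, \<open>a(n,T)\<close> is \<open>1 / (\<pi> T)\<close> times the integral over real \<open>E\<close> of \<open>\<bar>u n\<bar>\<^sup>2\<close>, where \<open>u\<close> is the resolvent of
  \<open>H\<close> at \<open>z = E + \<i> / T\<close> applied to \<open>\<delta>\<^sub>1\<close>; up to a phase, \<open>u\<close> is the Laplace transform of the evolution.

  For \<open>\<bar>E\<bar> \<le> K\<close> let \<open>\<phi>\<close> be a solution of the difference equation with \<open>\<phi> 0 = 0\<close> or \<open>\<phi> 1 = 0\<close>. The sequence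
  \<open>\<phi> (min n k) * u (max n k)\<close> is a multiple of a column of the Green function of a half-line operator, whose norm is
  at most \<open>T\<close> by self-adjointness. Hence \<open>\<bar>\<phi> k\<bar>\<^sup>2 * (\<Sum>n\<ge>k. \<bar>u n\<bar>\<^sup>2)\<close> is at most polynomial in \<open>T\<close>. The columns of the
  transfer matrix are such solutions, so the tail of \<open>u\<close> is at most a power of \<open>T\<close> divided by the square of the norm
  of any transfer matrix on the way.

  For \<open>\<bar>E\<bar> \<ge> K\<close> a Combes-Thomas estimate gives exponential decay of \<open>u\<close>. It needs the bound \<open>K - 1\<close> on the numerical
  range of \<open>H\<close>: its supremum and infimum are approximate eigenvalues, hence lie in the spectrum.

  So the outside probabilities \<open>P(T powr \<alpha>' - 2, T)\<close> decay faster than any power of \<open>T\<close> when \<open>\<alpha>' > \<alpha>\<close>. They are positive,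
  so the convention \<open>ln 0 = 0\<close> does no harm. A ballistic bound on the moments then yields the claim on
  \<open>\<beta>\<^sup>+\<close>.
\<close>

section \<open>The real inner product on square-summable sequences\<close>

text \<open>The spectrum is defined through bijectivity on \<open>ell2\<close>, so the spectral
  hypothesis says no more than that certain maps \<open>H - x\<close> are onto; the first task is to
  turn this into a bound on quadratic forms. The real part \<open>ip\<close> of the Hermitian
  product is enough for that, since the form of a symmetric operator is real.

  Large transfer matrices mean that some solution grows, whereas \<open>u\<close> has to be shown
  small. The link is the Wronskian: the source of the column
  \<open>\<phi> (min n k) * u (max n k)\<close> does not depend on \<open>k\<close>, so a large
  \<open>\<phi> k\<close> forces a small tail of \<open>u\<close> beyond \<open>k\<close>.

  The weight \<open>exp (- 2 * t / T)\<close> is the square of the damping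
  \<open>exp (- t / T)\<close>; hence the imaginary part \<open>1 / T\<close>. The tail estimate
  loses \<open>T ^ 4\<close>, and the prefactor \<open>1 / (pi * T)\<close> returns one power. Such
  losses are harmless because the transfer integrals decay faster than every power. The energies
  outside \<open>[-K, K]\<close> form an unbounded set, so there the bound must be integrable in the
  energy as well as small in the distance.\<close>

definition ip :: "(int \<Rightarrow> complex) \<Rightarrow> (int \<Rightarrow> complex) \<Rightarrow> real" where
  "ip f g = (\<Sum>\<^sub>\<infinity>n. f n \<bullet> g n)"

lemma ell2_iff: "f \<in> ell2 \<longleftrightarrow> (\<lambda>n. (cmod (f n))\<^sup>2) summable_on UNIV"
  by (simp add: ell2_def)

lemma ell2_comparison:
  assumes "(\<lambda>n. g n) summable_on (UNIV :: int set)" "\<And>n. (cmod (f n))\<^sup>2 \<le> g n"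
  shows "f \<in> ell2"
  unfolding ell2_iff using assms by (intro summable_on_comparison_test[OF assms(1)]) auto

lemma norm_add_square_le:
  fixes a b :: "'a::real_inner"
  shows "(norm (a + b))\<^sup>2 \<le> 2 * (norm a)\<^sup>2 + 2 * (norm b)\<^sup>2"
  using zero_le_power2[of "norm (a - b)"]
  by (simp add: power2_norm_eq_inner inner_add_left inner_add_right inner_diff_left inner_diff_right inner_commute)

lemma ell2_add: "f \<in> ell2 \<Longrightarrow> g \<in> ell2 \<Longrightarrow> (\<lambda>n. f n + g n) \<in> ell2"
  by (rule ell2_comparison[where g = "\<lambda>n. 2 * (cmod (f n))\<^sup>2 + 2 * (cmod (g n))\<^sup>2"])
     (auto simp: ell2_iff intro!: summable_on_add summable_on_cmult_right norm_add_square_le)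

lemma ell2_mult_bounded:
  assumes "f \<in> ell2" "\<And>n. cmod (c n) \<le> B"
  shows "(\<lambda>n. c n * f n) \<in> ell2"
proof (rule ell2_comparison[where g = "\<lambda>n. B\<^sup>2 * (cmod (f n))\<^sup>2"])
  show "(\<lambda>n. B\<^sup>2 * (cmod (f n))\<^sup>2) summable_on UNIV"
    using assms(1) by (auto simp: ell2_iff intro!: summable_on_cmult_right)
  show "(cmod (c n * f n))\<^sup>2 \<le> B\<^sup>2 * (cmod (f n))\<^sup>2" for n
    using assms(2)[of n] by (auto simp: norm_mult power_mult_distrib intro!: mult_right_mono power_mono)
qed

lemma ell2_mult: "f \<in> ell2 \<Longrightarrow> (\<lambda>n. c * f n) \<in> ell2"
  by (rule ell2_mult_bounded[where B = "cmod c"]) auto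

lemma ell2_diff: "f \<in> ell2 \<Longrightarrow> g \<in> ell2 \<Longrightarrow> (\<lambda>n. f n - g n) \<in> ell2"
  using ell2_add[of f "\<lambda>n. (-1) * g n"] ell2_mult[of g "-1"] by simp

lemma bij_int_shift: "bij_betw (\<lambda>n::int. n + j) UNIV UNIV"
  by (rule bij_betwI[where g = "\<lambda>n. n - j"]) auto

lemma ell2_shift: "f \<in> ell2 \<Longrightarrow> (\<lambda>n. f (n + j)) \<in> ell2"
  using summable_on_reindex_bij_betw[OF bij_int_shift[of j], of "\<lambda>n. (cmod (f n))\<^sup>2"]
  by (simp add: ell2_iff)

lemma ell2_delta: "delta j \<in> ell2"
proof -
  have "(\<lambda>n. (cmod (delta j n))\<^sup>2) summable_on UNIV"
    by (rule finite_nonzero_values_imp_summable_on)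
       (rule finite_subset[of _ "{j}"], auto simp: delta_def split: if_splits)
  thus ?thesis by (simp add: ell2_iff)
qed

lemma summable_inner:
  assumes "f \<in> ell2" "g \<in> ell2"
  shows "(\<lambda>n. f n \<bullet> g n) summable_on UNIV"
proof -
  have "(\<lambda>n. (cmod (f n))\<^sup>2 + (cmod (g n))\<^sup>2) summable_on UNIV"
    using assms by (auto simp: ell2_iff intro!: summable_on_add)
  moreover have "norm (f n \<bullet> g n) \<le> (cmod (f n))\<^sup>2 + (cmod (g n))\<^sup>2" for n
  proof -
    have "norm (f n \<bullet> g n) \<le> cmod (f n) * cmod (g n)"
      by (simp add: Cauchy_Schwarz_ineq2)
    also have "\<dots> \<le> (cmod (f n))\<^sup>2 + (cmod (g n))\<^sup>2"
      using sum_squares_bound[of "cmod (f n)" "cmod (g n)"] mult_nonneg_nonneg[of "cmod (f n)" "cmod (g n)"] by (simp del: mult_nonneg_nonneg)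
    finally show ?thesis .
  qed
  ultimately have "(\<lambda>n. norm (f n \<bullet> g n)) summable_on UNIV"
    by (rule Infinite_Sum.abs_summable_on_comparison_test')
  thus ?thesis by (rule Infinite_Sum.abs_summable_summable)
qed

lemma ip_add_right: "f \<in> ell2 \<Longrightarrow> g \<in> ell2 \<Longrightarrow> h \<in> ell2 \<Longrightarrow> ip f (\<lambda>n. g n + h n) = ip f g + ip f h"
  unfolding ip_def by (simp add: inner_add_right infsum_add summable_inner)

lemma ip_commute: "ip f g = ip g f"
  by (simp add: ip_def inner_commute)

lemma ip_add_left: "f \<in> ell2 \<Longrightarrow> g \<in> ell2 \<Longrightarrow> h \<in> ell2 \<Longrightarrow> ip (\<lambda>n. g n + h n) f = ip g f + ip h f"
  by (simp add: ip_commute[of _ f] ip_add_right)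

lemma ip_scale_right: "ip f (\<lambda>n. of_real c * g n) = c * ip f g"
proof -
  have "f n \<bullet> (of_real c * g n) = c * (f n \<bullet> g n)" for n
    by (metis inner_scaleR_right scaleR_conv_of_real)
  thus ?thesis by (simp add: ip_def infsum_cmult_right')
qed

lemma ip_scale_left: "ip (\<lambda>n. of_real c * g n) f = c * ip g f"
  by (simp add: ip_commute[of _ f] ip_scale_right)

lemma ip_diff_right:
  assumes "f \<in> ell2" "g \<in> ell2" "h \<in> ell2"
  shows "ip f (\<lambda>n. g n - h n) = ip f g - ip f h"
  using ip_add_right[OF assms(1,2) ell2_mult[OF assms(3), of "-1"]] ip_scale_right[of f "-1" h] by simp

lemma ip_self: "ip f f = (\<Sum>\<^sub>\<infinity>n. (cmod (f n))\<^sup>2)"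
  by (simp add: ip_def power2_norm_eq_inner)

lemma ip_self_nonneg: "0 \<le> ip f f"
  by (simp add: ip_self infsum_nonneg)

lemma sum_le_ip_self: "f \<in> ell2 \<Longrightarrow> finite F \<Longrightarrow> (\<Sum>n\<in>F. (cmod (f n))\<^sup>2) \<le> ip f f"
  unfolding ip_self by (rule finite_sum_le_infsum) (auto simp: ell2_iff)

lemma cmod_square_le_ip_self: "f \<in> ell2 \<Longrightarrow> (cmod (f n))\<^sup>2 \<le> ip f f"
  using sum_le_ip_self[of f "{n}"] by simp

lemma
  assumes "\<And>F. finite F \<Longrightarrow> (\<Sum>n\<in>F. (cmod (f n))\<^sup>2) \<le> B"
  shows ell2_of_finite_sums: "f \<in> ell2" and ip_self_le_of_finite_sums: "ip f f \<le> B"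
proof -
  show *: "f \<in> ell2"
    unfolding ell2_iff by (rule nonneg_bdd_above_summable_on) (auto simp: bdd_above_def intro!: exI[of _ B] assms)
  show "ip f f \<le> B"
    unfolding ip_self using * assms by (intro infsum_le_finite_sums) (auto simp: ell2_iff)
qed

text \<open>Expand the square norm of \<open>s * f + c * g\<close> for \<open>c = 1\<close> and
  \<open>c = -1\<close>, then divide by \<open>s\<close>. With \<open>s\<close> free this does the
  work of Cauchy-Schwarz without square roots.\<close>

lemma ip_young:
  assumes "f \<in> ell2" "g \<in> ell2" "s > 0"
  shows "2 * \<bar>ip f g\<bar> \<le> s * ip f f + ip g g / s"
proof -
  have *: "0 \<le> s * ip f f + 2 * c * ip f g + ip g g / s" if "c\<^sup>2 = 1" for c :: real
  proof -
    have e: "0 \<le> ip (\<lambda>n. of_real s * f n + of_real c * g n) (\<lambda>n. of_real s * f n + of_real c * g n)"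
      by (rule ip_self_nonneg)
    have "ip (\<lambda>n. of_real s * f n + of_real c * g n) (\<lambda>n. of_real s * f n + of_real c * g n)
       = s * s * ip f f + 2 * s * c * ip f g + c * c * ip g g"
      using assms by (simp add: ip_add_left ip_add_right ell2_add ell2_mult ip_scale_left ip_scale_right
          ip_commute[of g f] algebra_simps)
    also have "\<dots> = s * (s * ip f f + 2 * c * ip f g + ip g g / s)"
      using that \<open>s > 0\<close> by (simp add: field_simps power2_eq_square)
    finally show ?thesis using e \<open>s > 0\<close> by (simp add: zero_le_mult_iff)
  qed
  from *[of 1] *[of "-1"] show ?thesis by (simp add: abs_if)
qed

lemma ip_shift: "ip (\<lambda>n. f (n + 1)) g = ip f (\<lambda>n. g (n - 1))"
  unfolding ip_def
  using infsum_reindex_bij_betw[OF bij_int_shift[of 1], of "\<lambda>n. f n \<bullet> g (n - 1)"] by simp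

section \<open>The operator and its quadratic form\<close>

locale bounded_potential =
  fixes V :: "int \<Rightarrow> real" and B :: real
  assumes V_bound: "\<bar>V n\<bar> \<le> B"
begin

lemma B_nonneg: "0 \<le> B"
  using V_bound[of 0] by linarith

lemma V_ell2: "f \<in> ell2 \<Longrightarrow> (\<lambda>n. complex_of_real (V n) * f n) \<in> ell2"
  by (rule ell2_mult_bounded[where B = B]) (auto simp: V_bound)

lemma Hop_ell2: "f \<in> ell2 \<Longrightarrow> Hop V f \<in> ell2"
  using ell2_add[OF ell2_add[OF ell2_shift[of f 1] ell2_shift[of f "-1"]] V_ell2[of f]]
  by (simp add: Hop_def[abs_def])

lemma Hop_expand:
  assumes "f \<in> ell2" "g \<in> ell2"
  shows "ip f (Hop V g) = ip f (\<lambda>n. g (n + 1)) + ip f (\<lambda>n. g (n - 1)) + ip f (\<lambda>n. complex_of_real (V n) * g n)"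
  using assms ell2_shift[of g 1] ell2_shift[of g "-1"]
  by (simp add: Hop_def[abs_def] ip_add_right ell2_add V_ell2)

lemma Hop_symmetric:
  assumes "f \<in> ell2" "g \<in> ell2"
  shows "ip f (Hop V g) = ip (Hop V f) g"
proof -
  have "ip f (\<lambda>n. complex_of_real (V n) * g n) = ip g (\<lambda>n. complex_of_real (V n) * f n)"
    unfolding ip_def by (intro infsum_cong) (simp add: inner_complex_def algebra_simps)
  moreover have "ip f (\<lambda>n. g (n + 1)) = ip g (\<lambda>n. f (n - 1))"
    using ip_shift[of g f] by (simp add: ip_commute)
  moreover have "ip f (\<lambda>n. g (n - 1)) = ip g (\<lambda>n. f (n + 1))"
    using ip_shift[of f g] by (simp add: ip_commute)
  ultimately show ?thesis
    using assms by (simp add: Hop_expand ip_commute[of "Hop V f"])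
qed

lemma ip_shift_self: "ip (\<lambda>n. f (n + j)) (\<lambda>n. f (n + j)) = ip f f"
  using infsum_reindex_bij_betw[OF bij_int_shift[of j], of "\<lambda>n. f n \<bullet> f n"] by (simp add: ip_def)

text \<open>Each shift contributes at most 1 and the potential at most \<open>B\<close>. This crude
  bound ensures that the numerical range has a finite supremum; the sharp bound comes from the
  spectrum.\<close>

lemma ip_Hop_le:
  assumes "f \<in> ell2"
  shows "\<bar>ip f (Hop V f)\<bar> \<le> (2 + B) * ip f f"
proof -
  have "2 * \<bar>ip f (\<lambda>n. f (n + 1))\<bar> \<le> 2 * ip f f"
    using ip_young[OF assms ell2_shift[OF assms, of 1], of 1] ip_shift_self[of f 1] by simp
  moreover have "2 * \<bar>ip f (\<lambda>n. f (n - 1))\<bar> \<le> 2 * ip f f"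
    using ip_young[OF assms ell2_shift[OF assms, of "-1"], of 1] ip_shift_self[of f "-1"] by simp
  moreover have "\<bar>ip f (\<lambda>n. complex_of_real (V n) * f n)\<bar> \<le> B * ip f f"
  proof -
    have eq: "f n \<bullet> (complex_of_real (V n) * f n) = V n * (cmod (f n))\<^sup>2" for n
      by (metis inner_scaleR_right power2_norm_eq_inner scaleR_conv_of_real)
    have s: "(\<lambda>n. V n * (cmod (f n))\<^sup>2) summable_on UNIV"
      using summable_inner[OF assms V_ell2[OF assms]] by (simp add: eq)
    have s2: "(\<lambda>n. (cmod (f n))\<^sup>2) summable_on UNIV" using assms by (simp add: ell2_iff)
    have "(\<Sum>\<^sub>\<infinity>n. V n * (cmod (f n))\<^sup>2) \<le> (\<Sum>\<^sub>\<infinity>n. B * (cmod (f n))\<^sup>2)"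
      using s s2 V_bound by (intro infsum_mono summable_on_cmult_right) (auto intro!: mult_right_mono simp: abs_le_iff)
    moreover have "(\<Sum>\<^sub>\<infinity>n. - B * (cmod (f n))\<^sup>2) \<le> (\<Sum>\<^sub>\<infinity>n. V n * (cmod (f n))\<^sup>2)"
    proof (intro infsum_mono summable_on_cmult_right s s2)
      fix n show "- B * (cmod (f n))\<^sup>2 \<le> V n * (cmod (f n))\<^sup>2"
        using V_bound[of n] by (intro mult_right_mono) auto
    qed
    ultimately show ?thesis
      unfolding ip_self by (simp add: ip_def eq infsum_cmult_right' abs_le_iff infsum_uminus) 
  qed
  ultimately show ?thesis using Hop_expand[OF assms assms] by (simp add: algebra_simps)
qed

end

text \<open>The gliding hump argument behind the uniform boundedness principle: a symmetric operator
  with approximate null vectors \<open>f j\<close> misses the vector \<open>\<Sum>j. \<plusminus> 3\<^sup>-\<^sup>j f j\<close>, for suitable signs.\<close>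

lemma symmetric_approx_null_not_surj:
  assumes f: "\<And>j. f j \<in> ell2" "\<And>j. ip (f j) (f j) = 1"
    and L: "\<And>g. g \<in> ell2 \<Longrightarrow> L g \<in> ell2"
      "\<And>g h. g \<in> ell2 \<Longrightarrow> h \<in> ell2 \<Longrightarrow> ip g (L h) = ip (L g) h"
    and null: "\<And>j. ip (L (f j)) (L (f j)) \<le> (1/81) ^ j"
  shows "\<exists>x\<in>ell2. \<forall>y\<in>ell2. L y \<noteq> x"
proof -
  \<comment> \<open>The sign makes the new summand add to the component of \<open>y\<close> along
    \<open>f n\<close> instead of cancelling it.\<close>
  define step where "step = (\<lambda>n (y :: int \<Rightarrow> complex).
    (\<lambda>m. (if ip (f n) y \<ge> 0 then (1/3) ^ n else - ((1/3) ^ n)) * f n m))"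
  define X where "X = rec_nat (\<lambda>_. 0) (\<lambda>n y m. y m + step n y m)"
  have X0: "X 0 = (\<lambda>_. 0)" and XS: "X (Suc n) = (\<lambda>m. X n m + step n (X n) m)" for n
    by (simp_all add: X_def)
  have step_eq: "step n y = (\<lambda>m. of_real (if ip (f n) y \<ge> 0 then (1/3) ^ n else - ((1/3) ^ n)) * f n m)" for n y
    by (auto simp: step_def)
  have step_ell2: "step n y \<in> ell2" for n y
    unfolding step_eq by (rule ell2_mult[OF f(1)])
  have X_ell2: "X n \<in> ell2" for n
  proof (induction n)
    case 0 show ?case using ell2_mult[OF ell2_delta, of 0] by (simp add: X0)
  next
    case (Suc n) thus ?case unfolding XS by (intro ell2_add step_ell2)
  qed
  have hump: "\<bar>ip (f n) (X (Suc n))\<bar> \<ge> (1/3) ^ n" for n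
  proof -
    have "ip (f n) (X (Suc n)) = ip (f n) (X n) + (if ip (f n) (X n) \<ge> 0 then (1/3) ^ n else - ((1/3) ^ n))"
      unfolding XS using ip_add_right[OF f(1) X_ell2 step_ell2, of n n n "X n"]
        ip_scale_right[of "f n" _ "f n"] f(2)[of n] by (simp add: step_eq)
    thus ?thesis by (auto split: if_splits)
  qed
  have step_norm: "cmod (step n y m) = (1/3) ^ n * cmod (f n m)" for n y m
    by (auto simp: step_def norm_mult norm_power norm_divide)
  have f_le: "cmod (f n m) \<le> 1" for n m
    using cmod_square_le_ip_self[OF f(1), of n m] f(2)[of n] by (simp add: power_le_one_iff abs_square_le_1)
  have X_sum: "X (n + k) m = X n m + (\<Sum>j<k. step (n + j) (X (n + j)) m)" for n k m
    by (induction k) (simp_all add: XS)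
  have summ: "summable (\<lambda>j. step (n + j) (X (n + j)) m)" for n m
  proof (rule summable_comparison_test')
    show "summable (\<lambda>j. (1/3 :: real) ^ j)" by (simp add: summable_geometric)
    show "norm (step (n + j) (X (n + j)) m) \<le> (1/3) ^ j" if "j \<ge> 0" for j
    proof -
      have "(1/3 :: real) ^ (n + j) * cmod (f (n + j) m) \<le> (1/3) ^ (n + j) * 1"
        by (intro mult_left_mono f_le) auto
      also have "\<dots> \<le> (1/3) ^ j" by (simp add: power_decreasing)
      finally show ?thesis by (simp add: step_norm)
    qed
  qed
  define x where "x = (\<lambda>m. \<Sum>j. step j (X j) m)"
  have lim: "(\<lambda>k. X (n + k) m) \<longlonglongrightarrow> x m" for n m
  proof -
    have "(\<lambda>k. X k m) \<longlonglongrightarrow> x m"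
      using summable_LIMSEQ[OF summ[of 0 m]] X_sum[of 0 _ m] by (simp add: x_def X0)
    thus ?thesis using LIMSEQ_ignore_initial_segment[of "\<lambda>k. X k m" "x m" n] by (simp add: add.commute)
  qed
  have part: "L2_set (\<lambda>m. cmod (X (n + k) m - X n m)) F \<le> (3/2) * (1/3) ^ n" if "finite F" for n k F
  proof -
    have "L2_set (\<lambda>m. cmod (X (n + k) m - X n m)) F \<le> (\<Sum>j<k. (1/3) ^ (n + j))"
    proof (induction k)
      case 0 thus ?case by (simp add: L2_set_def)
    next
      case (Suc k)
      have "L2_set (\<lambda>m. cmod (X (n + Suc k) m - X n m)) F
          \<le> L2_set (\<lambda>m. cmod (X (n + k) m - X n m) + cmod (step (n + k) (X (n + k)) m)) F"
        by (rule L2_set_mono) (auto simp: XS intro!: order_trans[OF _ norm_triangle_ineq] simp: algebra_simps)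
      also have "\<dots> \<le> L2_set (\<lambda>m. cmod (X (n + k) m - X n m)) F + L2_set (\<lambda>m. cmod (step (n + k) (X (n + k)) m)) F"
        by (rule L2_set_triangle_ineq)
      also have "L2_set (\<lambda>m. cmod (step (n + k) (X (n + k)) m)) F \<le> (1/3) ^ (n + k)"
      proof -
        have "L2_set (\<lambda>m. cmod (f (n + k) m)) F \<le> 1"
          using sum_le_ip_self[OF f(1) that, of "n + k"] f(2)[of "n + k"] by (simp add: L2_set_def)
        thus ?thesis
          unfolding step_norm by (subst L2_set_right_distrib[symmetric]) (auto intro: mult_left_le)
      qed
      finally show ?case using Suc by simp
    qed
    also have "(\<Sum>j<k. (1/3 :: real) ^ (n + j)) = (1/3) ^ n * (\<Sum>j<k. (1/3) ^ j)"
      by (simp add: power_add sum_distrib_left)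
    also have "\<dots> \<le> (1/3) ^ n * (3/2)"
    proof (rule mult_left_mono)
      have "(\<Sum>j<k. (1/3 :: real) ^ j) \<le> (\<Sum>j. (1/3) ^ j)"
        by (rule sum_le_suminf) (auto simp: summable_geometric)
      thus "(\<Sum>j<k. (1/3 :: real) ^ j) \<le> 3/2" by (simp add: suminf_geometric)
    qed auto
    finally show ?thesis by (simp add: mult.commute)
  qed
  have tail: "(\<Sum>m\<in>F. (cmod (x m - X n m))\<^sup>2) \<le> (9/4) * (1/9) ^ n" if "finite F" for n F
  proof -
    have "(\<lambda>k. L2_set (\<lambda>m. cmod (X (n + k) m - X n m)) F) \<longlonglongrightarrow> L2_set (\<lambda>m. cmod (x m - X n m)) F"
      unfolding L2_set_def by (intro tendsto_intros lim)
    hence "L2_set (\<lambda>m. cmod (x m - X n m)) F \<le> (3/2) * (1/3) ^ n"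
      by (rule LIMSEQ_le_const2) (use part[OF that] in blast)
    hence "(L2_set (\<lambda>m. cmod (x m - X n m)) F)\<^sup>2 \<le> ((3/2) * (1/3) ^ n)\<^sup>2"
      by (intro power_mono) (auto simp: L2_set_nonneg)
    also have "((3/2 :: real) * (1/3) ^ n)\<^sup>2 = (9/4) * (1/9) ^ n"
      by (simp add: power_mult_distrib power2_eq_square power_mult[symmetric] power_divide) (simp add: power_mult_distrib[symmetric])
    finally show ?thesis by (simp add: L2_set_def sum_nonneg)
  qed
  note d_ell2 = ell2_of_finite_sums[OF tail] and d_le = ip_self_le_of_finite_sums[OF tail]
  have x_ell2: "x \<in> ell2" using d_ell2[of 0] by (simp add: X0)
  \<comment> \<open>All later summands together have norm at most
    \<open>(3/2) * (1/3) ^ (n + 1) = (1/3) ^ n / 2\<close>, half of the hump created at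
    \<open>n\<close>. The ratio \<open>1/3\<close> is small enough for this.\<close>
  have low: "\<bar>ip (f n) x\<bar> \<ge> (1/3) ^ n / 2" for n
  proof -
    have "ip (f n) x = ip (f n) (X (Suc n)) + ip (f n) (\<lambda>m. x m - X (Suc n) m)"
      using ip_add_right[OF f(1) X_ell2 d_ell2, of n "Suc n" "Suc n"] by simp
    moreover have "2 * \<bar>ip (f n) (\<lambda>m. x m - X (Suc n) m)\<bar> \<le> (1/3) ^ n"
    proof -
      \<comment> \<open>The optimal parameter for \<open>ip_young\<close>: the norm bound of the
        tail, as \<open>f n\<close> has norm 1.\<close>
      let ?s = "(1/3 :: real) ^ n / 2"
      have "2 * \<bar>ip (f n) (\<lambda>m. x m - X (Suc n) m)\<bar> \<le> ?s * 1 + ((9/4) * (1/9) ^ Suc n) / ?s"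
      proof -
        have "2 * \<bar>ip (f n) (\<lambda>m. x m - X (Suc n) m)\<bar>
            \<le> ?s * 1 + ip (\<lambda>m. x m - X (Suc n) m) (\<lambda>m. x m - X (Suc n) m) / ?s"
          using ip_young[OF f(1) d_ell2, of ?s n "Suc n"] f(2)[of n] by simp
        also have "\<dots> \<le> ?s * 1 + ((9/4) * (1/9) ^ Suc n) / ?s"
          by (intro add_left_mono divide_right_mono d_le) auto
        finally show ?thesis .
      qed
      also have "((9/4) * (1/9) ^ Suc n) / ?s = (1/3 :: real) ^ n / 2"
      proof -
        have "(1/9 :: real) ^ n = (1/3) ^ n * (1/3) ^ n" by (simp add: power_mult_distrib[symmetric])
        thus ?thesis by (simp add: field_simps)
      qed
      finally show ?thesis by simp
    qed
    ultimately show ?thesis using hump[of n] by linarith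
  qed
  have "L y \<noteq> x" if y: "y \<in> ell2" for y
  proof
    assume Ly: "L y = x"
    \<comment> \<open>By symmetry \<open>L\<close> moves to \<open>f n\<close>, where it leaves a
      pairing of order \<open>9 ^ (-n)\<close>. The hump is of order \<open>3 ^ (-n)\<close>, so no
      fixed \<open>y\<close> can produce it for all \<open>n\<close>.\<close>
    have "3 ^ n \<le> 1 + ip y y" for n
    proof -
      have "(1/3) ^ n \<le> 2 * \<bar>ip (f n) x\<bar>" using low[of n] by simp
      also have "ip (f n) x = ip (L (f n)) y" using L(2)[OF f(1) y, of n] Ly by simp
      also have "2 * \<bar>ip (L (f n)) y\<bar> \<le> 9 ^ n * ip (L (f n)) (L (f n)) + ip y y / 9 ^ n"
        by (rule ip_young) (auto intro: L f y)
      also have "\<dots> \<le> 9 ^ n * (1/81) ^ n + ip y y / 9 ^ n"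
        by (intro add_right_mono mult_left_mono null) auto
      also have "\<dots> = (1 + ip y y) * (1/9) ^ n"
        by (simp add: power_mult_distrib[symmetric] field_simps)
      finally have "(1/3) ^ n * 9 ^ n \<le> (1 + ip y y) * (1/9) ^ n * 9 ^ n" by (rule mult_right_mono) simp
      thus ?thesis by (simp add: power_mult_distrib[symmetric] mult.assoc)
    qed
    moreover obtain n where "1 + ip y y < 3 ^ n" using real_arch_pow[of 3 "1 + ip y y"] by auto
    ultimately show False by (meson not_le)
  qed
  thus ?thesis using x_ell2 by blast
qed

section \<open>From the spectrum to the numerical range\<close>

context bounded_potential begin

text \<open>The sign \<open>s\<close> treats both ends of the numerical range at once. If the
  supremum \<open>M\<close> exceeded \<open>M0\<close>, then \<open>L = H - s * M\<close> would be
  onto. But the form \<open>Q\<close> of \<open>M - s * H\<close> is nonnegative, and unit vectors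
  with small \<open>Q\<close> are almost annihilated by \<open>L\<close>, so that the gliding hump
  excludes surjectivity.\<close>

lemma numerical_range_bound:
  assumes s: "s = 1 \<or> s = (-1 :: real)"
    and spec: "\<And>x. x > M0 \<Longrightarrow> complex_of_real (s * x) \<notin> spec V"
    and f: "f \<in> ell2"
  shows "s * ip f (Hop V f) \<le> M0 * ip f f"
proof -
  define S where "S = {s * ip g (Hop V g) |g. g \<in> ell2 \<and> ip g g = 1}"
  define M where "M = Sup S"
  have ss: "s * s = 1" using s by auto
  have le: "s * ip g (Hop V g) \<le> 2 + B" if "g \<in> ell2" "ip g g = 1" for g
    using ip_Hop_le[OF that(1)] that(2) s by auto
  have bdd: "bdd_above S" unfolding bdd_above_def S_def using le by blast
  have "ip (delta 0) (delta 0) = 1"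
  proof -
    have "ip (delta 0) (delta 0) = (\<Sum>\<^sub>\<infinity>n\<in>{0}. delta 0 n \<bullet> delta 0 n)"
      unfolding ip_def by (rule infsum_cong_neutral) (auto simp: delta_def)
    thus ?thesis by (simp add: delta_def)
  qed
  hence ne: "S \<noteq> {}" unfolding S_def using ell2_delta by blast
  have up: "s * ip g (Hop V g) \<le> M * ip g g" if g: "g \<in> ell2" for g
  proof (cases "ip g g = 0")
    case True
    have "\<bar>ip g (Hop V g)\<bar> \<le> 0" using ip_Hop_le[OF g] True by simp
    thus ?thesis using True by simp
  next
    case False
    define c where "c = 1 / sqrt (ip g g)"
    have c: "c * c * ip g g = 1" using False ip_self_nonneg[of g] by (simp add: c_def)
    have Hc: "Hop V (\<lambda>n. of_real c * g n) = (\<lambda>n. of_real c * Hop V g n)"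
      by (auto simp: Hop_def algebra_simps)
    have "s * ip (\<lambda>n. of_real c * g n) (Hop V (\<lambda>n. of_real c * g n)) \<le> M"
      unfolding M_def by (rule cSup_upper[OF _ bdd])
        (use g c in \<open>auto simp: S_def ip_scale_left ip_scale_right mult.assoc intro!: exI[of _ "\<lambda>n. of_real c * g n"] ell2_mult\<close>)
    hence "c * c * (s * ip g (Hop V g)) \<le> c * c * (M * ip g g)"
      unfolding Hc ip_scale_left ip_scale_right using c by (simp add: algebra_simps)
    moreover have "c * c > 0" using c by (smt (verit) mult_eq_0_iff zero_le_square)
    ultimately show ?thesis by (simp only: mult_le_cancel_left_pos)
  qed
  have "M \<le> M0"
  proof (rule ccontr)
    assume "\<not> M \<le> M0"
    hence ns: "complex_of_real (s * M) \<notin> spec V" by (intro spec) simp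
    define L where "L = (\<lambda>\<psi> n. Hop V \<psi> n - complex_of_real (s * M) * \<psi> n)"
    have surj: "L ` ell2 = ell2" using ns by (simp add: spec_def L_def bij_betw_def)
    have L_ell2: "L g \<in> ell2" if "g \<in> ell2" for g
      unfolding L_def by (intro ell2_diff ell2_mult Hop_ell2 that)
    have ipL: "ip g (L h) = ip g (Hop V h) - s * M * ip g h" if "g \<in> ell2" "h \<in> ell2" for g h
      unfolding L_def using that by (simp add: ip_diff_right ip_scale_right Hop_ell2 ell2_mult del: of_real_mult)
    have sym: "ip g (L h) = ip (L g) h" if "g \<in> ell2" "h \<in> ell2" for g h
      using ipL[OF that] ipL[OF that(2,1)] Hop_symmetric[OF that] ip_commute[of g h] 
        ip_commute[of "Hop V g" h] ip_commute[of "L g" h] by simp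
    define Q where "Q = (\<lambda>g. - s * ip g (L g))"
    have Q_eq: "Q g = M * ip g g - s * ip g (Hop V g)" if "g \<in> ell2" for g
    proof -
      have "Q g = (s * s) * M * ip g g - s * ip g (Hop V g)"
        by (simp add: Q_def ipL[OF that that] algebra_simps)
      thus ?thesis by (simp add: ss)
    qed
    define \<beta> where "\<beta> = \<bar>M\<bar> + 2 + B"
    have \<beta>: "\<beta> > 0" using B_nonneg by (simp add: \<beta>_def)
    have Q_le: "Q g \<le> \<beta> * ip g g" if "g \<in> ell2" for g
    proof -
      have "M * ip g g \<le> \<bar>M\<bar> * ip g g" by (rule mult_right_mono) (auto intro: ip_self_nonneg)
      moreover have "- s * ip g (Hop V g) \<le> (2 + B) * ip g g" using ip_Hop_le[OF that] s by auto
      ultimately show ?thesis by (simp add: Q_eq[OF that] \<beta>_def algebra_simps)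
    qed
    \<comment> \<open>The Cauchy-Schwarz inequality of the nonnegative form \<open>Q\<close>,
      obtained by testing it at \<open>g\<close> displaced along \<open>L g\<close>. The step size
      \<open>1 / \<beta>\<close> minimises the resulting quadratic polynomial once
      \<open>Q (L g)\<close> is replaced by its upper bound.\<close>
    have L_bound: "ip (L g) (L g) \<le> \<beta> * Q g" if g: "g \<in> ell2" for g
    proof -
      define c where "c = 1 / \<beta>"
      let ?h = "\<lambda>n. g n + of_real (s * c) * L g n"
      have h: "?h \<in> ell2" using g by (intro ell2_add ell2_mult L_ell2)
      have Lh: "L ?h = (\<lambda>n. L g n + of_real (s * c) * L (L g) n)"
        by (auto simp: L_def Hop_def algebra_simps)
      have "Q ?h = Q g - 2 * c * (s * s) * ip (L g) (L g) + c * c * (s * s) * Q (L g)"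
      proof -
        have "ip ?h (L ?h) = ip g (L g) + (s * c) * ip g (L (L g)) + ((s * c) * ip (L g) (L g)
            + (s * c) * ((s * c) * ip (L g) (L (L g))))"
          unfolding Lh using g
          by (simp add: ip_add_left ip_add_right ip_scale_left ip_scale_right L_ell2 ell2_add ell2_mult del: of_real_mult)
             (simp add: algebra_simps)
        thus ?thesis using sym[OF g L_ell2[OF g]] unfolding Q_def by (simp add: algebra_simps)
      qed
      hence "0 \<le> Q g - 2 * c * ip (L g) (L g) + c * c * Q (L g)"
        using up[OF h] Q_eq[OF h] ss by simp
      also have "c * c * Q (L g) \<le> c * c * (\<beta> * ip (L g) (L g))"
        by (intro mult_left_mono Q_le L_ell2 g) auto
      also have "c * c * (\<beta> * ip (L g) (L g)) = c * ip (L g) (L g)"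
        using \<beta> by (simp add: c_def field_simps)
      finally have "c * ip (L g) (L g) \<le> Q g" by simp
      thus ?thesis using \<beta> by (simp add: c_def field_simps)
    qed
    have "\<exists>g. g \<in> ell2 \<and> ip g g = 1 \<and> ip (L g) (L g) \<le> (1/81) ^ j" for j :: nat
    proof -
      \<comment> \<open>The division by \<open>\<beta>\<close> compensates the factor in
        \<open>L_bound\<close>.\<close>
      have "M - (1/81) ^ j / \<beta> < Sup S" using \<beta> by (simp add: M_def)
      then obtain g where g: "g \<in> ell2" "ip g g = 1" "M - (1/81) ^ j / \<beta> < s * ip g (Hop V g)"
        using less_cSup_iff[OF ne bdd] unfolding S_def by auto
      have "\<beta> * Q g \<le> \<beta> * ((1/81) ^ j / \<beta>)"
        using g \<beta> by (intro mult_left_mono) (auto simp: Q_eq)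
      thus ?thesis using g L_bound[OF g(1)] \<beta> by (intro exI[of _ g]) auto
    qed
    then obtain F where F: "\<And>j. F j \<in> ell2 \<and> ip (F j) (F j) = 1 \<and> ip (L (F j)) (L (F j)) \<le> (1/81) ^ j"
      by metis
    have "\<exists>x\<in>ell2. \<forall>y\<in>ell2. L y \<noteq> x"
      by (rule symmetric_approx_null_not_surj[where f = F]) (use F L_ell2 sym in blast)+
    thus False using surj by (metis imageE)
  qed
  hence "M * ip f f \<le> M0 * ip f f" by (rule mult_right_mono[OF _ ip_self_nonneg])
  thus ?thesis using up[OF f] by linarith
qed

end

section \<open>Time evolution\<close>

context bounded_potential begin

lemma Hop_norm_le: "cmod (Hop V f n) \<le> cmod (f (n + 1)) + cmod (f (n - 1)) + B * cmod (f n)"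
proof -
  have "cmod (Hop V f n) \<le> cmod (f (n + 1)) + cmod (f (n - 1)) + cmod (complex_of_real (V n) * f n)"
    unfolding Hop_def by (meson add_mono norm_triangle_ineq order_refl order_trans)
  also have "cmod (complex_of_real (V n) * f n) \<le> B * cmod (f n)"
    using V_bound[of n] by (simp add: norm_mult mult_right_mono)
  finally show ?thesis by simp
qed

text \<open>In the norm with weight \<open>R ^ \<bar>n - 1\<bar>\<close> a step to a neighbour costs
  at most a factor \<open>R\<close>. Since \<open>R\<close> is free, the evolution decays in space
  at any exponential rate, at the price of a constant growing with time.\<close>

lemma Hop_pow_bound:
  assumes R: "R \<ge> 1"
  shows "cmod ((Hop V ^^ k) (delta 1) n) \<le> ((2 + B) * R) ^ k / R ^ nat \<bar>n - 1\<bar>"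
proof (induction k arbitrary: n)
  case 0
  show ?case using R by (auto simp: delta_def)
next
  case (Suc k)
  let ?f = "(Hop V ^^ k) (delta 1)" and ?A = "((2 + B) * R) ^ k"
  have A: "?A \<ge> 0" using R B_nonneg by simp
  have near: "cmod (?f m) \<le> ?A * (R / R ^ nat \<bar>n - 1\<bar>)" if "\<bar>m - n\<bar> \<le> 1" for m
  proof -
    have "R ^ nat \<bar>n - 1\<bar> \<le> R ^ Suc (nat \<bar>m - 1\<bar>)"
      using R that by (intro power_increasing) auto
    hence "1 / R ^ nat \<bar>m - 1\<bar> \<le> R / R ^ nat \<bar>n - 1\<bar>"
      using R by (simp add: field_simps)
    hence "?A * (1 / R ^ nat \<bar>m - 1\<bar>) \<le> ?A * (R / R ^ nat \<bar>n - 1\<bar>)"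
      using A by (rule mult_left_mono)
    thus ?thesis using Suc.IH[of m] by simp
  qed
  have "cmod ((Hop V ^^ Suc k) (delta 1) n) \<le> cmod (?f (n + 1)) + cmod (?f (n - 1)) + B * cmod (?f n)"
    by (simp add: Hop_norm_le)
  also have "\<dots> \<le> (1 + 1 + B) * (?A * (R / R ^ nat \<bar>n - 1\<bar>))"
    unfolding distrib_right[of "1 + 1" B] distrib_right[of 1 1] mult_1
    by (intro add_mono mult_left_mono near B_nonneg) auto
  also have "\<dots> = ((2 + B) * R) ^ Suc k / R ^ nat \<bar>n - 1\<bar>" by simp
  finally show ?case .
qed

text \<open>The evolution as an entire function of \<open>w = - \<i> * t\<close>, which gives access
  to the term-by-term differentiation of power series.\<close>

definition evo_series :: "int \<Rightarrow> complex \<Rightarrow> complex" where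
  "evo_series n w = (\<Sum>k. (Hop V ^^ k) (delta 1) n / fact k * w ^ k)"

lemma evo_eq_series: "evo V t n = evo_series n (- \<i> * of_real t)"
  unfolding evo_def evo_series_def by (simp add: field_simps)

lemma evo_term_le:
  assumes "R \<ge> 1"
  shows "cmod ((Hop V ^^ k) (delta 1) n / fact k * w ^ k)
     \<le> 1 / R ^ nat \<bar>n - 1\<bar> * (((2 + B) * R * cmod w) ^ k / fact k)"
proof -
  have "cmod ((Hop V ^^ k) (delta 1) n / fact k * w ^ k)
      = cmod ((Hop V ^^ k) (delta 1) n) * (cmod w ^ k / fact k)"
    by (simp add: norm_mult norm_divide norm_power)
  also have "\<dots> \<le> ((2 + B) * R) ^ k / R ^ nat \<bar>n - 1\<bar> * (cmod w ^ k / fact k)"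
    by (intro mult_right_mono Hop_pow_bound assms) auto
  also have "\<dots> = 1 / R ^ nat \<bar>n - 1\<bar> * (((2 + B) * R * cmod w) ^ k / fact k)"
    by (simp add: power_mult_distrib)
  finally show ?thesis .
qed

lemma exp_sums_fact: "(\<lambda>k. x ^ k / fact k) sums exp (x::real)"
  using exp_converges[of x] by (simp add: divide_inverse mult.commute)

lemma evo_summable: "summable (\<lambda>k. (Hop V ^^ k) (delta 1) n / fact k * w ^ k)"
proof (rule summable_comparison_test'[of _ 0])
  show "summable (\<lambda>k. 1 / 1 ^ nat \<bar>n - 1\<bar> * (((2 + B) * 1 * cmod w) ^ k / fact k))"
    by (intro summable_mult sums_summable[OF exp_sums_fact])
qed (use evo_term_le[of 1] in auto)

lemma evo_decay:
  assumes "R \<ge> 1"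
  shows "cmod (evo V t n) \<le> exp ((2 + B) * R * \<bar>t\<bar>) / R ^ nat \<bar>n - 1\<bar>"
proof -
  have s: "(\<lambda>k. 1 / R ^ nat \<bar>n - 1\<bar> * (((2 + B) * R * \<bar>t\<bar>) ^ k / fact k)) sums
      (1 / R ^ nat \<bar>n - 1\<bar> * exp ((2 + B) * R * \<bar>t\<bar>))"
    by (intro sums_mult exp_sums_fact)
  have "cmod (evo V t n) \<le> (\<Sum>k. 1 / R ^ nat \<bar>n - 1\<bar> * (((2 + B) * R * \<bar>t\<bar>) ^ k / fact k))"
    unfolding evo_eq_series evo_series_def
    by (rule norm_suminf_le[OF _ sums_summable[OF s]])
       (use evo_term_le[OF assms, of _ n "- \<i> * of_real t"] in \<open>simp add: norm_mult\<close>)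
  thus ?thesis using sums_unique[OF s] by simp
qed

lemma evo_series_deriv:
  "(evo_series n has_field_derivative Hop V (\<lambda>m. evo_series m w) n) (at w)"
proof -
  let ?c = "\<lambda>n k. (Hop V ^^ k) (delta 1) n / fact k :: complex"
  have "diffs (?c n) k * w ^ k = ?c (n + 1) k * w ^ k + ?c (n - 1) k * w ^ k + of_real (V n) * (?c n k * w ^ k)" for k
  proof -
    have "diffs (?c n) k = Hop V ((Hop V ^^ k) (delta 1)) n / fact k"
      by (simp add: diffs_def field_simps del: of_nat_Suc)
    thus ?thesis by (simp add: Hop_def add_divide_distrib distrib_right)
  qed
  moreover have "(\<lambda>k. ?c m k * w ^ k) sums evo_series m w" for m
    unfolding evo_series_def by (rule summable_sums[OF evo_summable])
  ultimately have "(\<lambda>k. diffs (?c n) k * w ^ k) sums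
      (evo_series (n + 1) w + evo_series (n - 1) w + of_real (V n) * evo_series n w)"
    by (simp only:) (intro sums_add sums_mult)
  hence "(\<Sum>k. diffs (?c n) k * w ^ k) = Hop V (\<lambda>m. evo_series m w) n"
    unfolding Hop_def[of V "\<lambda>m. evo_series m w"] by (rule sums_unique[symmetric])
  thus ?thesis
    using termdiffs_strong_converges_everywhere[OF evo_summable, of n w]
    by (simp add: evo_series_def[abs_def])
qed

lemma evo_has_derivative:
  "((\<lambda>t. evo V t n) has_vector_derivative - \<i> * Hop V (evo V t) n) (at t)"
proof -
  have "((\<lambda>t. - \<i> * complex_of_real t) has_vector_derivative - \<i>) (at t)"
    by (auto intro!: derivative_eq_intros)
  from field_vector_diff_chain_at[OF this evo_series_deriv]
  show ?thesis by (simp add: o_def evo_eq_series[abs_def])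
qed

lemma continuous_on_evo: "continuous_on S (\<lambda>t. evo V t n)"
  using evo_has_derivative by (meson continuous_at_imp_continuous_on has_vector_derivative_continuous)

lemma evo_0: "evo V 0 n = delta 1 n"
proof -
  have "evo_series n 0 = (Hop V ^^ 0) (delta 1) n / fact 0"
    unfolding evo_series_def by (rule powser_zero)
  thus ?thesis by (simp add: evo_eq_series)
qed

text \<open>The probability current across the bond between \<open>n\<close> and
  \<open>n + 1\<close>, positive when it flows towards \<open>n\<close>. The potential does not
  contribute, being real.\<close>

definition current :: "real \<Rightarrow> int \<Rightarrow> real" where
  "current t n = 2 * Im (cnj (evo V t n) * evo V t (n + 1))"

lemma evo_square_deriv:
  "((\<lambda>t. (cmod (evo V t n))\<^sup>2) has_real_derivative current t n - current t (n - 1)) (at t)"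
proof -
  have "((\<lambda>t. evo V t n \<bullet> evo V t n) has_vector_derivative
      evo V t n \<bullet> (- \<i> * Hop V (evo V t) n) + (- \<i> * Hop V (evo V t) n) \<bullet> evo V t n) (at t)"
    by (rule bounded_bilinear.has_vector_derivative[OF bounded_bilinear_inner evo_has_derivative evo_has_derivative])
  also have "evo V t n \<bullet> (- \<i> * Hop V (evo V t) n) + (- \<i> * Hop V (evo V t) n) \<bullet> evo V t n
      = current t n - current t (n - 1)"
    by (simp add: current_def Hop_def inner_complex_def algebra_simps)
  finally show ?thesis
    by (simp add: has_real_derivative_iff_has_vector_derivative power2_norm_eq_inner)
qed

lemma current_le: "\<bar>current t n\<bar> \<le> 2 * cmod (evo V t n) * cmod (evo V t (n + 1))"
  using abs_Im_le_cmod[of "cnj (evo V t n) * evo V t (n + 1)"]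
  by (simp add: current_def norm_mult abs_mult)

lemma current_le_squares: "\<bar>current t n\<bar> \<le> (cmod (evo V t n))\<^sup>2 + (cmod (evo V t (n + 1)))\<^sup>2"
  using current_le[of t n] sum_squares_bound[of "cmod (evo V t n)" "cmod (evo V t (n + 1))"] by linarith

end

section \<open>A ballistic bound for the evolution\<close>

lemma sum_by_parts_symmetric:
  fixes c J :: "int \<Rightarrow> real"
  shows "(\<Sum>n\<in>{- int L..int L}. c n * (J n - J (n - 1)))
     = (\<Sum>n\<in>{- int L..<int L}. (c n - c (n + 1)) * J n) + c (int L) * J (int L) - c (- int L) * J (- int L - 1)"
proof (induction L)
  case 0 thus ?case by (simp add: algebra_simps)
next
  case (Suc L)
  have "{- int (Suc L)..int (Suc L)} = insert (int L + 1) (insert (- int L - 1) {- int L..int L})" by auto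
  moreover have "{- int (Suc L)..<int (Suc L)} = insert (int L) (insert (- int L - 1) {- int L..<int L})" by auto
  ultimately have
    "(\<Sum>n\<in>{- int (Suc L)..int (Suc L)}. c n * (J n - J (n - 1)))
      = c (int L + 1) * (J (int L + 1) - J (int L)) + (c (- int L - 1) * (J (- int L - 1) - J (- int L - 1 - 1))
        + (\<Sum>n\<in>{- int L..int L}. c n * (J n - J (n - 1))))"
    "(\<Sum>n\<in>{- int (Suc L)..<int (Suc L)}. (c n - c (n + 1)) * J n)
      = (c (int L) - c (int L + 1)) * J (int L) + ((c (- int L - 1) - c (- int L)) * J (- int L - 1)
        + (\<Sum>n\<in>{- int L..<int L}. (c n - c (n + 1)) * J n))"
    by simp_all
  moreover have "int (Suc L) = int L + 1" "- int (Suc L) = - int L - 1" "- int (Suc L) - 1 = - int L - 1 - 1" by auto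
  ultimately show ?case unfolding Suc by (simp only: left_diff_distrib right_diff_distrib)
qed

text \<open>The current of a bond is bounded by the squares at its two ends, and each square has to
  be paired with the weight of its own site; hence the two versions.\<close>

lemma power_abs_diff_le:
  fixes r :: real
  assumes "r \<ge> 1"
  shows "\<bar>r ^ nat \<bar>n\<bar> - r ^ nat \<bar>n + 1\<bar>\<bar> \<le> (r - 1) * r ^ nat \<bar>n\<bar>"
    and "\<bar>r ^ nat \<bar>n\<bar> - r ^ nat \<bar>n + 1\<bar>\<bar> \<le> (r - 1) * r ^ nat \<bar>n + 1\<bar>"
proof -
  have *: "r ^ Suc k - r ^ k = (r - 1) * r ^ k" "(r - 1) * r ^ k \<le> (r - 1) * r ^ Suc k" "r ^ k \<le> r ^ Suc k" for k
  proof -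
    show inc: "r ^ k \<le> r ^ Suc k" using assms by (intro power_increasing) auto
    show "(r - 1) * r ^ k \<le> (r - 1) * r ^ Suc k" using assms inc by (intro mult_left_mono) auto
    show "r ^ Suc k - r ^ k = (r - 1) * r ^ k" by (simp add: algebra_simps)
  qed
  have aux: "\<bar>r ^ a - r ^ b\<bar> \<le> (r - 1) * r ^ a \<and> \<bar>r ^ a - r ^ b\<bar> \<le> (r - 1) * r ^ b"
    if "b = Suc a \<or> a = Suc b" for a b
    using that
  proof
    assume eq: "b = Suc a"
    show ?thesis unfolding eq using *[of a] by (intro conjI abs_leI) linarith+
  next
    assume eq: "a = Suc b"
    show ?thesis unfolding eq using *[of b] by (intro conjI abs_leI) linarith+
  qed
  have "nat \<bar>n + 1\<bar> = Suc (nat \<bar>n\<bar>) \<or> nat \<bar>n\<bar> = Suc (nat \<bar>n + 1\<bar>)" by linarith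
  from aux[OF this] show "\<bar>r ^ nat \<bar>n\<bar> - r ^ nat \<bar>n + 1\<bar>\<bar> \<le> (r - 1) * r ^ nat \<bar>n\<bar>"
    "\<bar>r ^ nat \<bar>n\<bar> - r ^ nat \<bar>n + 1\<bar>\<bar> \<le> (r - 1) * r ^ nat \<bar>n + 1\<bar>"
    by blast+
qed

context bounded_potential begin

text \<open>For \<open>r = 1\<close> this is the unitarity of the evolution; for \<open>r > 1\<close> it is a ballistic upper bound.\<close>

lemma weighted_evolution_bound:
  assumes r: "r \<ge> 1" and t1: "t1 \<ge> 0" and F: "finite F"
  shows "(\<Sum>n\<in>F. r ^ nat \<bar>n\<bar> * (cmod (evo V t1 n))\<^sup>2) \<le> r * exp (2 * (r - 1) * t1)"
proof -
  define c where "c = (\<lambda>n::int. r ^ nat \<bar>n\<bar>)"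
  define \<kappa> where "\<kappa> = 2 * (r - 1)"
  \<comment> \<open>Decay at the rate \<open>2 * r\<close> beats the weight \<open>r ^ L\<close> at
    the ends of the window and leaves the factor \<open>1 / 2 ^ L\<close> in
    \<open>b\<close>.\<close>
  define D where "D = exp ((2 + B) * (2 * r) * t1)"
  define S where "S = (\<lambda>L t. \<Sum>n\<in>{- int L..int L}. c n * (cmod (evo V t n))\<^sup>2)"
  define b where "b = (\<lambda>L::nat. 4 * D\<^sup>2 / 2 ^ L)"
  have c_pos: "c n > 0" for n using r by (simp add: c_def)
  have Sderiv: "(S L has_real_derivative (\<Sum>n\<in>{- int L..int L}. c n * (current t n - current t (n - 1)))) (at t)" for L t
    unfolding S_def by (intro DERIV_sum DERIV_cmult evo_square_deriv)
  have decay: "cmod (evo V t n) \<le> D / (2 * r) ^ nat \<bar>n - 1\<bar>" if "0 \<le> t" "t \<le> t1" for t n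
  proof -
    have "cmod (evo V t n) \<le> exp ((2 + B) * (2 * r) * \<bar>t\<bar>) / (2 * r) ^ nat \<bar>n - 1\<bar>"
      using r by (intro evo_decay) auto
    also have "\<dots> \<le> D / (2 * r) ^ nat \<bar>n - 1\<bar>"
      unfolding D_def using that r B_nonneg by (intro divide_right_mono) (auto intro!: mult_left_mono)
    finally show ?thesis .
  qed
  have D1: "cmod (evo V t n) \<le> D" if "0 \<le> t" "t \<le> t1" for t n
  proof (rule order_trans[OF decay[OF that]])
    have "D / (2 * r) ^ nat \<bar>n - 1\<bar> \<le> D / 1"
      using r by (intro divide_left_mono one_le_power) (auto simp: D_def)
    thus "D / (2 * r) ^ nat \<bar>n - 1\<bar> \<le> D" by simp
  qed
  have DL: "cmod (evo V t n) \<le> D / (2 * r) ^ L" if "0 \<le> t" "t \<le> t1" "int L \<le> \<bar>n - 1\<bar>" for t n L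
  proof (rule order_trans[OF decay[OF that(1,2)]])
    show "D / (2 * r) ^ nat \<bar>n - 1\<bar> \<le> D / (2 * r) ^ L"
      using r that(3) by (intro divide_left_mono power_increasing) (auto simp: D_def)
  qed
  have D_nonneg: "D \<ge> 0" by (simp add: D_def)
  have boundary: "c (int L) * current t (int L) - c (- int L) * current t (- int L - 1) \<le> b L"
    if t: "0 \<le> t" "t \<le> t1" for t L
  proof -
    have "\<bar>current t (int L)\<bar> \<le> 2 * cmod (evo V t (int L)) * cmod (evo V t (int L + 1))" by (rule current_le)
    also have "\<dots> \<le> 2 * D * (D / (2 * r) ^ L)" by (intro mult_mono D1 DL t) (use D_nonneg in auto)
    finally have 1: "\<bar>current t (int L)\<bar> \<le> 2 * D * (D / (2 * r) ^ L)" .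
    have "\<bar>current t (- int L - 1)\<bar> \<le> 2 * cmod (evo V t (- int L - 1)) * cmod (evo V t (- int L))"
      using current_le[of t "- int L - 1"] by simp
    also have "\<dots> \<le> 2 * (D / (2 * r) ^ L) * D" by (intro mult_mono D1 DL t) (use D_nonneg r in auto)
    finally have 2: "\<bar>current t (- int L - 1)\<bar> \<le> 2 * D * (D / (2 * r) ^ L)" by simp
    have "c (int L) * current t (int L) - c (- int L) * current t (- int L - 1)
        = r ^ L * (current t (int L) - current t (- int L - 1))" by (simp add: c_def algebra_simps)
    also have "\<dots> \<le> r ^ L * (4 * D * (D / (2 * r) ^ L))"
      using 1 2 r by (intro mult_left_mono) auto
    also have "\<dots> = b L" using r by (simp add: b_def power_mult_distrib power2_eq_square)
    finally show ?thesis .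
  qed
  have bond: "(c n - c (n + 1)) * current t n
      \<le> (r - 1) * (c n * (cmod (evo V t n))\<^sup>2) + (r - 1) * (c (n + 1) * (cmod (evo V t (n + 1)))\<^sup>2)" for t n
  proof -
    have "(c n - c (n + 1)) * current t n \<le> \<bar>c n - c (n + 1)\<bar> * \<bar>current t n\<bar>"
      by (metis abs_ge_self abs_mult)
    also have "\<dots> \<le> \<bar>c n - c (n + 1)\<bar> * (cmod (evo V t n))\<^sup>2 + \<bar>c n - c (n + 1)\<bar> * (cmod (evo V t (n + 1)))\<^sup>2"
      unfolding distrib_left[symmetric] by (intro mult_left_mono current_le_squares) auto
    also have "\<dots> \<le> ((r - 1) * c n) * (cmod (evo V t n))\<^sup>2 + ((r - 1) * c (n + 1)) * (cmod (evo V t (n + 1)))\<^sup>2"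
      unfolding c_def by (intro add_mono mult_right_mono power_abs_diff_le r) auto
    finally show ?thesis by (simp add: mult.assoc)
  qed
  have deriv_le: "(\<Sum>n\<in>{- int L..int L}. c n * (current t n - current t (n - 1))) \<le> \<kappa> * S L t + b L"
    if "0 \<le> t" "t \<le> t1" for t L
  proof -
    have "(\<Sum>n\<in>{- int L..<int L}. (c n - c (n + 1)) * current t n)
        \<le> (\<Sum>n\<in>{- int L..<int L}. (r - 1) * (c n * (cmod (evo V t n))\<^sup>2))
          + (\<Sum>n\<in>{- int L..<int L}. (r - 1) * (c (n + 1) * (cmod (evo V t (n + 1)))\<^sup>2))"
      unfolding sum.distrib[symmetric] by (intro sum_mono bond)
    also have "(\<Sum>n\<in>{- int L..<int L}. (r - 1) * (c n * (cmod (evo V t n))\<^sup>2)) \<le> (r - 1) * S L t"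
      unfolding S_def sum_distrib_left using r less_imp_le[OF c_pos] by (intro sum_mono2) auto
    also have "(\<Sum>n\<in>{- int L..<int L}. (r - 1) * (c (n + 1) * (cmod (evo V t (n + 1)))\<^sup>2))
        = (\<Sum>n\<in>{- int L + 1..int L}. (r - 1) * (c n * (cmod (evo V t n))\<^sup>2))"
      by (rule sum.reindex_bij_witness[of _ "\<lambda>n. n - 1" "\<lambda>n. n + 1"]) auto
    also have "\<dots> \<le> (r - 1) * S L t"
      unfolding S_def sum_distrib_left using r less_imp_le[OF c_pos] by (intro sum_mono2) auto
    finally show ?thesis
      unfolding sum_by_parts_symmetric using boundary[OF that, of L] by (simp add: \<kappa>_def algebra_simps)
  qed
  have b_nonneg: "b L \<ge> 0" for L by (simp add: b_def)
  have SL: "S L t1 \<le> exp (\<kappa> * t1) * (r + b L * t1)" if L: "L \<ge> 1" for L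
  proof -
    \<comment> \<open>Gronwall's argument for the truncated sum. The boundary contribution is
      absorbed by \<open>b L * t\<close>, because
      \<open>exp (- \<kappa> * t) \<le> 1\<close>.\<close>
    define g where "g = (\<lambda>t. exp (- \<kappa> * t) * S L t - b L * t)"
    have "g t1 \<le> g 0"
    proof (rule DERIV_nonpos_imp_nonincreasing[OF t1])
      fix t assume t: "0 \<le> t" "t \<le> t1"
      let ?S' = "\<Sum>n\<in>{- int L..int L}. c n * (current t n - current t (n - 1))"
      have "(g has_real_derivative exp (- \<kappa> * t) * (?S' - \<kappa> * S L t) - b L) (at t)"
        unfolding g_def by (rule derivative_eq_intros Sderiv refl)+ (simp add: algebra_simps)
      moreover have "exp (- \<kappa> * t) * (?S' - \<kappa> * S L t) - b L \<le> 0"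
      proof -
        have "exp (- \<kappa> * t) * (?S' - \<kappa> * S L t) \<le> exp (- \<kappa> * t) * b L"
          using deriv_le[OF t, of L] by (intro mult_left_mono) auto
        also have "\<dots> \<le> 1 * b L" using t r b_nonneg by (intro mult_right_mono) (auto simp: \<kappa>_def mult_nonpos_nonneg)
        finally show ?thesis by simp
      qed
      ultimately show "\<exists>y. (g has_real_derivative y) (at t) \<and> y \<le> 0" by blast
    qed
    \<comment> \<open>The evolution starts at site \<open>1\<close>, which has weight
      \<open>r\<close> and lies in the window as \<open>L \<ge> 1\<close>.\<close>
    also have "g 0 = r"
    proof -
      have "S L 0 = (\<Sum>n\<in>{1}. c n * (cmod (evo V 0 n))\<^sup>2)"
        unfolding S_def by (rule sum.mono_neutral_right) (use L in \<open>auto simp: evo_0 delta_def\<close>)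
      thus ?thesis by (simp add: g_def c_def evo_0 delta_def)
    qed
    finally have "exp (\<kappa> * t1) * (exp (- \<kappa> * t1) * S L t1) \<le> exp (\<kappa> * t1) * (r + b L * t1)"
      by (intro mult_left_mono) (auto simp: g_def)
    moreover have "exp (\<kappa> * t1) * (exp (- \<kappa> * t1) * S L t1) = S L t1"
      by (simp add: exp_minus)
    ultimately show ?thesis by (simp only:)
  qed
  have "(\<lambda>L. exp (\<kappa> * t1) * (r + b L * t1)) \<longlonglongrightarrow> exp (\<kappa> * t1) * (r + 0 * t1)"
  proof -
    have "(\<lambda>L. 4 * D\<^sup>2 * (1/2) ^ L) \<longlonglongrightarrow> 4 * D\<^sup>2 * 0"
      by (intro tendsto_intros LIMSEQ_power_zero) auto
    hence "b \<longlonglongrightarrow> 0" by (simp add: b_def power_divide)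
    thus ?thesis by (intro tendsto_intros)
  qed
  moreover obtain L0 :: nat where L0: "F \<subseteq> {- int L0..int L0}"
  proof -
    have "F \<subseteq> {- int (nat (\<Sum>n\<in>F. \<bar>n\<bar>))..int (nat (\<Sum>n\<in>F. \<bar>n\<bar>))}"
    proof
      fix n assume "n \<in> F"
      hence "\<bar>n\<bar> \<le> (\<Sum>n\<in>F. \<bar>n\<bar>)" using F by (intro member_le_sum) auto
      thus "n \<in> {- int (nat (\<Sum>n\<in>F. \<bar>n\<bar>))..int (nat (\<Sum>n\<in>F. \<bar>n\<bar>))}" by auto
    qed
    thus ?thesis by (rule that)
  qed
  have "(\<Sum>n\<in>F. c n * (cmod (evo V t1 n))\<^sup>2) \<le> exp (\<kappa> * t1) * (r + b L * t1)" if "L \<ge> max L0 1" for L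
  proof -
    have "(\<Sum>n\<in>F. c n * (cmod (evo V t1 n))\<^sup>2) \<le> S L t1"
      unfolding S_def using L0 that less_imp_le[OF c_pos] by (intro sum_mono2) auto
    thus ?thesis using SL[of L] that by linarith
  qed
  ultimately have "(\<Sum>n\<in>F. c n * (cmod (evo V t1 n))\<^sup>2) \<le> exp (\<kappa> * t1) * (r + 0 * t1)"
    using LIMSEQ_le_const[of "\<lambda>L. exp (\<kappa> * t1) * (r + b L * t1)"] by blast
  thus ?thesis by (simp add: c_def \<kappa>_def mult.commute)
qed

lemma evo_norm_le:
  assumes "t \<ge> 0"
  shows "cmod (evo V t n) \<le> 1"
  using weighted_evolution_bound[of 1 t "{n}"] assms by (simp add: power_le_one_iff abs_square_le_1)

end

section \<open>A Plancherel inequality\<close>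

lemma integrable_product_complex:
  fixes f g :: "real \<Rightarrow> complex"
  assumes f: "integrable lborel f" and g: "integrable lborel g"
  shows "integrable (lborel \<Otimes>\<^sub>M lborel) (\<lambda>(s, t). f s * g t)"
proof (rule lborel_pair.Fubini_integrable)
  have [measurable]: "f \<in> borel_measurable borel" "g \<in> borel_measurable borel"
    using f g borel_measurable_integrable by auto
  show "(\<lambda>(s, t). f s * g t) \<in> borel_measurable (lborel \<Otimes>\<^sub>M lborel)" by measurable
  show "integrable lborel (\<lambda>s. \<integral>t. norm (case (s, t) of (s, t) \<Rightarrow> f s * g t) \<partial>lborel)"
    using f by (simp add: norm_mult integrable_mult_left)
  show "AE s in lborel. integrable lborel (\<lambda>t. case (s, t) of (s, t) \<Rightarrow> f s * g t)"
    using g by simp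
qed

lemma cmod_square_fourier:
  fixes G :: "real \<Rightarrow> complex"
  assumes G: "integrable lborel G"
  defines "Gh \<equiv> (\<lambda>x. \<integral>t. iexp (x * t) * G t \<partial>lborel)"
  shows "complex_of_real ((cmod (Gh x))\<^sup>2) = (\<integral>p. iexp (x * (fst p - snd p)) * (G (fst p) * cnj (G (snd p))) \<partial>(lborel \<Otimes>\<^sub>M lborel))"
proof -
  have [measurable]: "G \<in> borel_measurable borel" using G borel_measurable_integrable by auto
  have i1: "integrable lborel (\<lambda>t. iexp (x * t) * G t)"
    by (rule Bochner_Integration.integrable_bound[OF G]) (auto simp: norm_mult)
  have i2: "integrable lborel (\<lambda>t. cnj (iexp (x * t) * G t))" using integrable_cnj[OF i1] .
  have "complex_of_real ((cmod (Gh x))\<^sup>2) = Gh x * cnj (Gh x)" by (rule complex_norm_square)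
  also have "\<dots> = (\<integral>s. (\<integral>t. (iexp (x * s) * G s) * cnj (iexp (x * t) * G t) \<partial>lborel) \<partial>lborel)"
    unfolding Gh_def using Bochner_Integration.integral_cnj[of lborel "\<lambda>t. iexp (x * t) * G t"]
    by (simp only: integral_mult_right_zero integral_mult_left_zero)
  also have "\<dots> = (\<integral>p. (case p of (s, t) \<Rightarrow> (iexp (x * s) * G s) * cnj (iexp (x * t) * G t)) \<partial>(lborel \<Otimes>\<^sub>M lborel))"
    using lborel_pair.integral_fst'[OF integrable_product_complex[OF i1 i2]] by simp
  also have "\<dots> = (\<integral>p. iexp (x * (fst p - snd p)) * (G (fst p) * cnj (G (snd p))) \<partial>(lborel \<Otimes>\<^sub>M lborel))"
    by (intro Bochner_Integration.integral_cong refl)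
       (auto simp: case_prod_beta exp_cnj right_diff_distrib exp_diff exp_minus field_simps)
  finally show ?thesis .
qed

text \<open>Gaussian regularisation: averaging \<open>\<bar>Gh\<bar>\<^sup>2\<close> against a wide Gaussian gives the correlation of \<open>G\<close> with its
  convolution by a narrow one.\<close>

lemma gaussian_average_fourier:
  fixes G :: "real \<Rightarrow> complex" and \<sigma> :: real
  assumes G: "integrable lborel G" and \<sigma>: "\<sigma> > 0"
  defines "Gh \<equiv> (\<lambda>x. \<integral>t. iexp (x * t) * G t \<partial>lborel)"
  shows "complex_of_real (\<integral>x. (cmod (Gh (x / \<sigma>)))\<^sup>2 \<partial>std_normal_distribution)
     = of_real (\<sigma> * sqrt (2 * pi)) * (\<integral>t. cnj (G t) * (\<integral>y. std_normal_density y *\<^sub>R G (t + \<sigma> * y) \<partial>lborel) \<partial>lborel)"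
proof -
  let ?N = std_normal_distribution and ?P = "lborel \<Otimes>\<^sub>M lborel :: (real \<times> real) measure"
  interpret N: prob_space ?N by (rule prob_space_normal_density) simp
  interpret P: sigma_finite_measure ?P by (rule sigma_finite_pair_measure[OF lborel.sigma_finite_measure_axioms lborel.sigma_finite_measure_axioms])
  interpret NP: pair_sigma_finite ?N ?P ..
  have Gm[measurable]: "G \<in> borel_measurable borel" using G borel_measurable_integrable by auto
  have cG: "integrable lborel (\<lambda>t. cnj (G t))" using integrable_cnj[OF G] .
  define h where "h = (\<lambda>p. G (fst p) * cnj (G (snd p)))"
  have h: "integrable ?P h"
    using integrable_product_complex[OF G cG] unfolding h_def case_prod_unfold .
  have hm[measurable]: "h \<in> borel_measurable ?P" using h by (rule borel_measurable_integrable)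
  define f where "f = (\<lambda>x p. iexp (x / \<sigma> * (fst p - snd p)) * h p)"
  have nf: "cmod (f x p) = cmod (h p)" for x p by (simp add: f_def norm_mult)
  have fint: "integrable (?N \<Otimes>\<^sub>M ?P) (case_prod f)"
  proof (rule NP.Fubini_integrable)
    show "case_prod f \<in> borel_measurable (?N \<Otimes>\<^sub>M ?P)"
      unfolding f_def by measurable
    show "integrable ?N (\<lambda>x. \<integral>p. norm (case (x, p) of (x, p) \<Rightarrow> f x p) \<partial>?P)"
      by (simp add: nf)
    show "AE x in ?N. integrable ?P (\<lambda>p. case (x, p) of (x, p) \<Rightarrow> f x p)"
    proof (intro AE_I2)
      fix x
      have "(\<lambda>p. f x p) \<in> borel_measurable ?P" unfolding f_def by measurable
      thus "integrable ?P (\<lambda>p. case (x, p) of (x, p) \<Rightarrow> f x p)"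
        by (simp, intro Bochner_Integration.integrable_bound[OF h]) (auto simp: nf)
    qed
  qed
  have "complex_of_real (\<integral>x. (cmod (Gh (x / \<sigma>)))\<^sup>2 \<partial>?N) = (\<integral>x. complex_of_real ((cmod (Gh (x / \<sigma>)))\<^sup>2) \<partial>?N)"
    by (rule integral_complex_of_real[symmetric])
  also have "\<dots> = (\<integral>x. (\<integral>p. f x p \<partial>?P) \<partial>?N)"
    unfolding Gh_def cmod_square_fourier[OF G] f_def h_def ..
  also have "\<dots> = (\<integral>p. (\<integral>x. f x p \<partial>?N) \<partial>?P)"
    by (rule NP.Fubini_integral[OF fint, symmetric])
  \<comment> \<open>The integral over \<open>x\<close> is the characteristic function of the normal
    law at \<open>(s - t) / \<sigma>\<close>, for \<open>p = (s, t)\<close>.\<close>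
  also have "\<dots> = (\<integral>p. of_real (exp (- ((fst p - snd p) / \<sigma>)\<^sup>2 / 2)) * h p \<partial>?P)"
  proof (intro Bochner_Integration.integral_cong refl)
    fix p
    have "(\<integral>x. f x p \<partial>?N) = char ?N ((fst p - snd p) / \<sigma>) * h p"
      unfolding f_def char_def by (simp add: field_simps)
    thus "(\<integral>x. f x p \<partial>?N) = of_real (exp (- ((fst p - snd p) / \<sigma>)\<^sup>2 / 2)) * h p"
      by (simp only: char_std_normal_distribution)
  qed
  also have "\<dots> = (\<integral>t. (\<integral>s. of_real (exp (- ((s - t) / \<sigma>)\<^sup>2 / 2)) * h (s, t) \<partial>lborel) \<partial>lborel)"
  proof -
    have m: "(\<lambda>p. complex_of_real (exp (- ((fst p - snd p) / \<sigma>)\<^sup>2 / 2)) * h p) \<in> borel_measurable ?P"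
      by measurable
    have "integrable ?P (\<lambda>p. complex_of_real (exp (- ((fst p - snd p) / \<sigma>)\<^sup>2 / 2)) * h p)"
      by (rule Bochner_Integration.integrable_bound[OF h m]) (auto simp: norm_mult intro!: mult_left_le_one_le)
    hence "integrable ?P (\<lambda>(s, t). complex_of_real (exp (- ((s - t) / \<sigma>)\<^sup>2 / 2)) * h (s, t))"
      unfolding case_prod_unfold by simp
    from lborel_pair.integral_snd[OF this] show ?thesis unfolding case_prod_unfold by simp
  qed
  also have "\<dots> = (\<integral>t. of_real (\<sigma> * sqrt (2 * pi)) * (cnj (G t) * (\<integral>y. std_normal_density y *\<^sub>R G (t + \<sigma> * y) \<partial>lborel)) \<partial>lborel)"
  proof (intro Bochner_Integration.integral_cong refl)
    fix t
    have "(\<integral>s. of_real (exp (- ((s - t) / \<sigma>)\<^sup>2 / 2)) * h (s, t) \<partial>lborel)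
       = \<bar>\<sigma>\<bar> *\<^sub>R (\<integral>y. of_real (exp (- ((t + \<sigma> * y - t) / \<sigma>)\<^sup>2 / 2)) * h (t + \<sigma> * y, t) \<partial>lborel)"
      using \<sigma> by (intro lborel_integral_real_affine) auto
    also have "(\<lambda>y. complex_of_real (exp (- ((t + \<sigma> * y - t) / \<sigma>)\<^sup>2 / 2)) * h (t + \<sigma> * y, t))
       = (\<lambda>y. (of_real (sqrt (2 * pi)) * cnj (G t)) * (std_normal_density y *\<^sub>R G (t + \<sigma> * y)))"
      using \<sigma> by (auto simp: h_def std_normal_density_def scaleR_conv_of_real)
    also have "(\<integral>y. (of_real (sqrt (2 * pi)) * cnj (G t)) * (std_normal_density y *\<^sub>R G (t + \<sigma> * y)) \<partial>lborel)
        = (of_real (sqrt (2 * pi)) * cnj (G t)) * (\<integral>y. std_normal_density y *\<^sub>R G (t + \<sigma> * y) \<partial>lborel)"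
      by (rule integral_mult_right_zero)
    finally show "(\<integral>s. of_real (exp (- ((s - t) / \<sigma>)\<^sup>2 / 2)) * h (s, t) \<partial>lborel)
       = of_real (\<sigma> * sqrt (2 * pi)) * (cnj (G t) * (\<integral>y. std_normal_density y *\<^sub>R G (t + \<sigma> * y) \<partial>lborel))"
      using \<sigma> by (simp add: scaleR_conv_of_real)
  qed
  also have "\<dots> = of_real (\<sigma> * sqrt (2 * pi)) * (\<integral>t. cnj (G t) * (\<integral>y. std_normal_density y *\<^sub>R G (t + \<sigma> * y) \<partial>lborel) \<partial>lborel)"
    by (rule integral_mult_right_zero)
  finally show ?thesis .
qed

text \<open>The occupation numbers are to be bounded above by energy integrals, so this direction is
  the relevant one. It lets the Gaussian density be replaced by its maximum
  \<open>1 / sqrt (2 * pi)\<close>, and an infinite right-hand side does no harm. The point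
  \<open>t = 0\<close> is excepted because the damped evolution jumps there.\<close>

lemma plancherel_le:
  fixes G :: "real \<Rightarrow> complex"
  assumes G: "integrable lborel G" and b: "\<And>t. cmod (G t) \<le> 1" and c: "\<And>t. t \<noteq> 0 \<Longrightarrow> isCont G t"
  shows "ennreal (2 * pi * (\<integral>t. (cmod (G t))\<^sup>2 \<partial>lborel))
     \<le> (\<integral>\<^sup>+x. ennreal ((cmod (\<integral>t. iexp (x * t) * G t \<partial>lborel))\<^sup>2) \<partial>lborel)"
proof -
  let ?N = std_normal_distribution
  interpret N: prob_space ?N by (rule prob_space_normal_density) simp
  have Gm[measurable]: "G \<in> borel_measurable borel" using G borel_measurable_integrable by auto
  have [measurable]: "(\<lambda>t. cnj (G t)) \<in> borel_measurable borel"
    using borel_measurable_integrable[OF integrable_cnj[OF G]] by simp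
  define Gh where "Gh = (\<lambda>x. \<integral>t. iexp (x * t) * G t \<partial>lborel)"
  have Ghm[measurable]: "Gh \<in> borel_measurable borel"
    unfolding Gh_def by (rule lborel.borel_measurable_lebesgue_integral) measurable
  define R where "R = (\<integral>\<^sup>+x. ennreal ((cmod (Gh x))\<^sup>2) \<partial>lborel)"
  define \<sigma> where "\<sigma> = (\<lambda>k::nat. 1 / real (Suc k))"
  have \<sigma>: "\<sigma> k > 0" for k by (simp add: \<sigma>_def)
  have \<sigma>lim: "\<sigma> \<longlonglongrightarrow> 0" unfolding \<sigma>_def by (rule LIMSEQ_Suc[OF lim_1_over_n])
  define \<Psi> where "\<Psi> = (\<lambda>k t. \<integral>y. std_normal_density y *\<^sub>R G (t + \<sigma> k * y) \<partial>lborel)"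
  have di: "integrable lborel std_normal_density" by (rule integrable_normal_density) simp
  have d1: "(\<integral>y. std_normal_density y \<partial>lborel) = 1" by (rule integral_normal_density) simp
  have \<Psi>m[measurable]: "\<Psi> k \<in> borel_measurable borel" for k
    unfolding \<Psi>_def by (rule lborel.borel_measurable_lebesgue_integral) measurable
  have bd: "norm (std_normal_density y *\<^sub>R G s) \<le> std_normal_density y" for y s
    using b[of s] by (simp add: normal_density_nonneg mult_left_le)
  have \<Psi>b: "cmod (\<Psi> k t) \<le> 1" for k t
  proof -
    have "cmod (\<Psi> k t) \<le> (\<integral>y. norm (std_normal_density y *\<^sub>R G (t + \<sigma> k * y)) \<partial>lborel)"
      unfolding \<Psi>_def by (rule integral_norm_bound)
    also have "\<dots> \<le> (\<integral>y. std_normal_density y \<partial>lborel)"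
      by (rule integral_mono_AE', rule di) (use bd in \<open>auto simp: normal_density_nonneg\<close>)
    finally show ?thesis by (simp add: d1)
  qed
  have \<Psi>lim: "(\<lambda>k. \<Psi> k t) \<longlonglongrightarrow> G t" if "t \<noteq> 0" for t
  proof -
    have "(\<lambda>k. \<Psi> k t) \<longlonglongrightarrow> (\<integral>y. std_normal_density y *\<^sub>R G t \<partial>lborel)"
      unfolding \<Psi>_def
    proof (rule integral_dominated_convergence[where w = std_normal_density])
      show "AE y in lborel. (\<lambda>k. std_normal_density y *\<^sub>R G (t + \<sigma> k * y)) \<longlonglongrightarrow> std_normal_density y *\<^sub>R G t"
      proof (intro AE_I2 tendsto_scaleR tendsto_const)
        fix y
        have "(\<lambda>k. t + \<sigma> k * y) \<longlonglongrightarrow> t + 0 * y" by (intro tendsto_intros \<sigma>lim)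
        thus "(\<lambda>k. G (t + \<sigma> k * y)) \<longlonglongrightarrow> G t"
          using isCont_tendsto_compose[OF c[OF that]] by simp
      qed
    qed (use bd di in auto)
    thus ?thesis by (simp add: d1)
  qed
  define I where "I = (\<lambda>k. \<integral>t. cnj (G t) * \<Psi> k t \<partial>lborel)"
  have Ilim: "I \<longlonglongrightarrow> (\<integral>t. cnj (G t) * G t \<partial>lborel)"
    unfolding I_def
  proof (rule integral_dominated_convergence[where w = "\<lambda>t. cmod (G t)"])
    have "AE t in lborel. t \<noteq> (0::real)" by (rule AE_lborel_singleton)
    thus "AE t in lborel. (\<lambda>k. cnj (G t) * \<Psi> k t) \<longlonglongrightarrow> cnj (G t) * G t"
      by eventually_elim (intro tendsto_intros \<Psi>lim)
    show "AE t in lborel. norm (cnj (G t) * \<Psi> k t) \<le> cmod (G t)" for k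
      using \<Psi>b by (auto simp: norm_mult mult_left_le)
  qed (use G in auto)
  have "(\<integral>t. cnj (G t) * G t \<partial>lborel) = complex_of_real (\<integral>t. (cmod (G t))\<^sup>2 \<partial>lborel)"
    unfolding integral_complex_of_real[symmetric] by (intro Bochner_Integration.integral_cong refl) (simp only: complex_norm_square mult.commute)
  with Ilim have Relim: "(\<lambda>k. Re (I k)) \<longlonglongrightarrow> (\<integral>t. (cmod (G t))\<^sup>2 \<partial>lborel)"
    using tendsto_Re[OF Ilim] by simp
  have le: "ennreal (2 * pi * Re (I k)) \<le> R" for k
  proof -
    let ?s = "\<sigma> k"
    let ?A = "\<integral>x. (cmod (Gh (x / ?s)))\<^sup>2 \<partial>?N"
    have "complex_of_real ?A = of_real (?s * sqrt (2 * pi)) * I k"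
      unfolding Gh_def I_def \<Psi>_def by (rule gaussian_average_fourier[OF G \<sigma>])
    hence "Re (complex_of_real ?A) = Re (of_real (?s * sqrt (2 * pi)) * I k)" by (rule arg_cong)
    hence A: "?A = ?s * sqrt (2 * pi) * Re (I k)" by simp
    have Ghb: "cmod (Gh x) \<le> (\<integral>t. cmod (G t) \<partial>lborel)" for x
      unfolding Gh_def using integral_norm_bound[of lborel "\<lambda>t. iexp (x * t) * G t"] by (simp add: norm_mult)
    have Ai: "integrable ?N (\<lambda>x. (cmod (Gh (x / ?s)))\<^sup>2)"
      by (rule N.integrable_const_bound[where B = "(\<integral>t. cmod (G t) \<partial>lborel)\<^sup>2"]) (auto intro!: power_mono Ghb)
    have "ennreal ?A = (\<integral>\<^sup>+x. ennreal ((cmod (Gh (x / ?s)))\<^sup>2) \<partial>?N)"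
      by (rule nn_integral_eq_integral[symmetric]) (use Ai in auto)
    also have "\<dots> = (\<integral>\<^sup>+x. ennreal (std_normal_density x) * ennreal ((cmod (Gh (x / ?s)))\<^sup>2) \<partial>lborel)"
      by (rule nn_integral_density) auto
    also have "\<dots> \<le> (\<integral>\<^sup>+x. ennreal (1 / sqrt (2 * pi)) * ennreal ((cmod (Gh (x / ?s)))\<^sup>2) \<partial>lborel)"
      by (intro nn_integral_mono mult_right_mono ennreal_leI) (auto simp: std_normal_density_def divide_right_mono)
    also have "\<dots> = ennreal (1 / sqrt (2 * pi)) * (\<integral>\<^sup>+x. ennreal ((cmod (Gh (x / ?s)))\<^sup>2) \<partial>lborel)"
      by (rule nn_integral_cmult) auto
    also have "(\<integral>\<^sup>+x. ennreal ((cmod (Gh (x / ?s)))\<^sup>2) \<partial>lborel) = ennreal ?s * R"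
    proof -
      have "R = ennreal \<bar>1 / ?s\<bar> * (\<integral>\<^sup>+x. ennreal ((cmod (Gh (0 + 1 / ?s * x)))\<^sup>2) \<partial>lborel)"
        unfolding R_def using \<sigma>[of k] by (intro nn_integral_real_affine) auto
      hence "ennreal ?s * R = (ennreal ?s * ennreal (1 / ?s)) * (\<integral>\<^sup>+x. ennreal ((cmod (Gh (x / ?s)))\<^sup>2) \<partial>lborel)"
        using \<sigma>[of k] by (simp add: mult.assoc)
      also have "ennreal ?s * ennreal (1 / ?s) = 1"
        using \<sigma>[of k] by (subst ennreal_mult[symmetric]) auto
      finally show ?thesis by simp
    qed
    finally have "ennreal ?A \<le> ennreal (1 / sqrt (2 * pi)) * (ennreal ?s * R)" .
    hence "ennreal (sqrt (2 * pi) / ?s) * ennreal ?A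
       \<le> ennreal (sqrt (2 * pi) / ?s) * (ennreal (1 / sqrt (2 * pi)) * (ennreal ?s * R))"
      by (rule mult_left_mono) simp
    also have "\<dots> = (ennreal (sqrt (2 * pi) / ?s) * ennreal (1 / sqrt (2 * pi)) * ennreal ?s) * R"
      by (simp only: mult.assoc)
    also have "ennreal (sqrt (2 * pi) / ?s) * ennreal (1 / sqrt (2 * pi)) * ennreal ?s = 1"
      using \<sigma>[of k] by (simp add: ennreal_mult[symmetric])
    also have "ennreal (sqrt (2 * pi) / ?s) * ennreal ?A = ennreal (2 * pi * Re (I k))"
    proof -
      have "ennreal (sqrt (2 * pi) / ?s) * ennreal ?A = ennreal (sqrt (2 * pi) / ?s * ?A)"
        using \<sigma>[of k] by (intro ennreal_mult[symmetric]) auto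
      also have "sqrt (2 * pi) / ?s * ?A = (sqrt (2 * pi) * sqrt (2 * pi)) * Re (I k)"
        unfolding A using \<sigma>[of k] by (simp add: field_simps)
      finally show ?thesis by simp
    qed
    finally show ?thesis by simp
  qed
  have "(\<lambda>k. ennreal (2 * pi * Re (I k))) \<longlonglongrightarrow> ennreal (2 * pi * (\<integral>t. (cmod (G t))\<^sup>2 \<partial>lborel))"
    by (intro tendsto_ennrealI tendsto_intros Relim)
  from LIMSEQ_le_const2[OF this] le show ?thesis unfolding R_def Gh_def by blast
qed

section \<open>Half-line Green functions and transfer matrices\<close>

text \<open>The coefficient \<open>a n\<close> sits at index \<open>n + 1\<close>. The same
  recursion serves both directions: index \<open>j\<close> means site \<open>j\<close> with
  \<open>a j = V (j + 1)\<close> to the right, and site \<open>1 - j\<close> with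
  \<open>a j = V (- j)\<close> to the left.\<close>

fun recsol :: "(nat \<Rightarrow> real) \<Rightarrow> complex \<Rightarrow> complex \<Rightarrow> complex \<Rightarrow> nat \<Rightarrow> complex" where
  "recsol a z s0 s1 0 = s0"
| "recsol a z s0 s1 (Suc 0) = s1"
| "recsol a z s0 s1 (Suc (Suc n)) = (z - of_real (a n)) * recsol a z s0 s1 (Suc n) - recsol a z s0 s1 n"

lemma wronskian_const:
  fixes x \<phi> :: "nat \<Rightarrow> complex"
  assumes "\<And>n. x (Suc (Suc n)) = (z - of_real (a n)) * x (Suc n) - x n"
    and "\<And>n. \<phi> (Suc (Suc n)) = (z - of_real (a n)) * \<phi> (Suc n) - \<phi> n"
  shows "\<phi> n * x (Suc n) - \<phi> (Suc n) * x n = \<phi> 0 * x 1 - \<phi> 1 * x 0"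
proof (induction n)
  case (Suc n)
  thus ?case by (simp add: assms algebra_simps)
qed simp

text \<open>The sequence \<open>w n = \<phi> (min n k) * x (max n k)\<close> is a multiple of the \<open>k\<close>-th column of the Green
  function of a half-line Schroedinger operator, whose norm is at most \<open>1 / Im z\<close>.\<close>

lemma half_line_green_bound:
  fixes x \<phi> :: "nat \<Rightarrow> complex"
  assumes z: "Im z > 0"
    and x: "\<And>n. x (Suc (Suc n)) = (z - of_real (a n)) * x (Suc n) - x n"
    and \<phi>: "\<And>n. \<phi> (Suc (Suc n)) = (z - of_real (a n)) * \<phi> (Suc n) - \<phi> n" "\<phi> 0 = 0"
    and sx: "summable (\<lambda>n. (cmod (x n))\<^sup>2)"
  shows "(cmod (\<phi> k))\<^sup>2 * (\<Sum>n. (cmod (x (n + k)))\<^sup>2) \<le> (cmod (\<phi> 1 * x 0))\<^sup>2 / (Im z)\<^sup>2"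
proof (cases k)
  case 0
  thus ?thesis using \<phi> by simp
next
  case (Suc k')
  \<comment> \<open>This is the source of the column \<open>w\<close> at index \<open>k\<close>. As
    a Wronskian it is independent of \<open>k\<close>, so the final bound does not contain the
    possibly huge values of \<open>\<phi>\<close>.\<close>
  define c where "c = \<phi> k * x (Suc k) - \<phi> (Suc k) * x k"
  have c: "c = - (\<phi> 1 * x 0)" unfolding c_def using wronskian_const[of x z a \<phi> k, OF x \<phi>(1)] \<phi>(2) by simp
  define w where "w = (\<lambda>n. if n \<le> k then \<phi> n * x k else \<phi> k * x n)"
  have w0: "w 0 = 0" by (simp add: w_def \<phi>)
  have w_late: "w (n + k) = \<phi> k * x (n + k)" for n by (auto simp: w_def)
  have eq: "w (Suc (Suc n)) + w n = (z - of_real (a n)) * w (Suc n) + (if Suc n = k then c else 0)" for n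
  proof -
    consider "Suc n < k" | "Suc n = k" | "Suc n > k" by linarith
    thus ?thesis
    proof cases
      case 1 thus ?thesis by (simp add: w_def \<phi> algebra_simps)
    next
      case 2 thus ?thesis by (auto simp: w_def c_def \<phi>(1) algebra_simps)
    next
      case 3 thus ?thesis by (cases "n = k") (auto simp: w_def x algebra_simps)
    qed
  qed
  \<comment> \<open>A discrete current. For real \<open>z\<close> it would be conserved away from
    the source; here it grows by \<open>Im z * (cmod (w n)) ^ 2\<close> per site. It vanishes at
    \<open>0\<close> since \<open>w 0 = 0\<close>, and at infinity since \<open>w\<close> is square
    summable, so the source has to balance the whole sum.\<close>
  define J where "J = (\<lambda>n. (\<i> * w n) \<bullet> w (Suc n))"
  have JS: "J (Suc n) - J n = Im z * (cmod (w (Suc n)))\<^sup>2 + (if Suc n = k then (\<i> * w k) \<bullet> c else 0)" for n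
  proof -
    have "J (Suc n) - J n = (\<i> * w (Suc n)) \<bullet> (w (Suc (Suc n)) + w n)"
      by (simp add: J_def inner_complex_def algebra_simps)
    also have "\<dots> = Im z * (cmod (w (Suc n)))\<^sup>2 + (if Suc n = k then (\<i> * w k) \<bullet> c else 0)"
      unfolding eq cmod_power2 by (auto simp: inner_complex_def algebra_simps power2_eq_square)
    finally show ?thesis .
  qed
  have J_sum: "J M = Im z * (\<Sum>n<M. (cmod (w (Suc n)))\<^sup>2) + (if k \<le> M then (\<i> * w k) \<bullet> c else 0)" for M
  proof (induction M)
    case 0 thus ?case using Suc by (simp add: J_def w0)
  next
    case (Suc M) thus ?case using JS[of M] by (auto simp: algebra_simps)
  qed
  have sw: "summable (\<lambda>n. (cmod (w n))\<^sup>2)"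
  proof (subst summable_iff_shift[of _ k, symmetric])
    show "summable (\<lambda>n. (cmod (w (n + k)))\<^sup>2)"
      unfolding w_late norm_mult power_mult_distrib
      by (intro summable_mult summable_ignore_initial_segment[OF sx])
  qed
  define S where "S = (\<Sum>n. (cmod (w (Suc n)))\<^sup>2)"
  have sw': "summable (\<lambda>n. (cmod (w (Suc n)))\<^sup>2)" using sw by (subst summable_Suc_iff)
  have w_lim: "w \<longlonglongrightarrow> 0"
  proof -
    have "(\<lambda>n. sqrt ((cmod (w n))\<^sup>2)) \<longlonglongrightarrow> sqrt 0"
      by (intro tendsto_real_sqrt summable_LIMSEQ_zero[OF sw])
    thus ?thesis by (simp add: tendsto_norm_zero_iff)
  qed
  have J_lim: "J \<longlonglongrightarrow> 0"
  proof -
    have "J \<longlonglongrightarrow> (\<i> * 0) \<bullet> 0" unfolding J_def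
      by (intro tendsto_intros w_lim LIMSEQ_Suc)
    thus ?thesis by simp
  qed
  have S_le: "Im z * S \<le> cmod (w k) * cmod c"
  proof -
    have "(\<lambda>M. Im z * (\<Sum>n<M. (cmod (w (Suc n)))\<^sup>2) + (\<i> * w k) \<bullet> c) \<longlonglongrightarrow> Im z * S + (\<i> * w k) \<bullet> c"
      unfolding S_def by (intro tendsto_intros summable_LIMSEQ sw')
    moreover have "\<forall>\<^sub>F M in sequentially. Im z * (\<Sum>n<M. (cmod (w (Suc n)))\<^sup>2) + (\<i> * w k) \<bullet> c = J M"
      using eventually_ge_at_top[of k] by eventually_elim (simp add: J_sum)
    ultimately have "J \<longlonglongrightarrow> Im z * S + (\<i> * w k) \<bullet> c" by (rule Lim_transform_eventually)
    hence "Im z * S + (\<i> * w k) \<bullet> c = 0" using J_lim LIMSEQ_unique by blast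
    moreover have "\<bar>(\<i> * w k) \<bullet> c\<bar> \<le> cmod (\<i> * w k) * cmod c" by (rule Cauchy_Schwarz_ineq2)
    ultimately show ?thesis by (simp add: norm_mult)
  qed
  have shift: "S = (\<Sum>n. (cmod (w (n + k)))\<^sup>2) + (\<Sum>n<k'. (cmod (w (Suc n)))\<^sup>2)"
    unfolding S_def using suminf_split_initial_segment[OF sw', of k'] Suc by simp
  have tail: "(\<Sum>n. (cmod (w (n + k)))\<^sup>2) = (cmod (\<phi> k))\<^sup>2 * (\<Sum>n. (cmod (x (n + k)))\<^sup>2)"
    unfolding w_late norm_mult power_mult_distrib
    by (rule suminf_mult[OF summable_ignore_initial_segment[OF sx]])
  have tail_le: "(\<Sum>n. (cmod (w (n + k)))\<^sup>2) \<le> S" unfolding shift by (simp add: sum_nonneg)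
  \<comment> \<open>Index \<open>k\<close> is at least 1 and so belongs to the sum \<open>S\<close>;
    this turns \<open>S_le\<close> into a bound on \<open>S\<close> alone.\<close>
  have wk: "(cmod (w k))\<^sup>2 \<le> S"
    using sum_le_suminf[OF sw', of "{k'}"] Suc by (simp add: S_def)
  have S0: "0 \<le> S" unfolding S_def by (intro suminf_nonneg sw') auto
  have "(Im z)\<^sup>2 * S \<le> (cmod c)\<^sup>2"
  proof (cases "S = 0")
    case False
    hence pos: "S > 0" using S0 by simp
    have "(Im z * S)\<^sup>2 \<le> (cmod (w k) * cmod c)\<^sup>2"
      using S_le z S0 by (intro power_mono) auto
    also have "\<dots> \<le> S * (cmod c)\<^sup>2"
      unfolding power_mult_distrib by (intro mult_right_mono wk) auto
    finally have "((Im z)\<^sup>2 * S) * S \<le> (cmod c)\<^sup>2 * S" by (simp add: power2_eq_square algebra_simps)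
    thus ?thesis using pos by (rule mult_right_le_imp_le)
  qed auto
  hence "S \<le> (cmod c)\<^sup>2 / (Im z)\<^sup>2" using z by (simp add: field_simps)
  thus ?thesis using tail_le unfolding tail c by simp
qed

text \<open>The squared Hilbert-Schmidt norm of the transfer matrix over \<open>k\<close> sites; its
  columns are built from the solutions with initial values \<open>(0, 1)\<close> and
  \<open>(1, 0)\<close>.\<close>

definition transfer_weight :: "(nat \<Rightarrow> real) \<Rightarrow> complex \<Rightarrow> nat \<Rightarrow> real" where
  "transfer_weight a z k = (cmod (recsol a z 0 1 k))\<^sup>2 + (cmod (recsol a z 0 1 (Suc k)))\<^sup>2
      + (cmod (recsol a z 1 0 k))\<^sup>2 + (cmod (recsol a z 1 0 (Suc k)))\<^sup>2"

text \<open>The solution \<open>?p\<close> vanishes at index 0 and fits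
  \<open>half_line_green_bound\<close> directly. The solution \<open>?q\<close> vanishes at index 1,
  so the half line is shortened by one site; its source is then \<open>x 1\<close> up to sign, since
  \<open>?q 2 = - 1\<close>. Entries at both \<open>k\<close> and \<open>Suc k\<close> occur, which
  explains the factor 2 and the tail starting at \<open>Suc k\<close>.\<close>

lemma transfer_tail_bound:
  fixes x :: "nat \<Rightarrow> complex"
  assumes z: "Im z > 0"
    and x: "\<And>n. x (Suc (Suc n)) = (z - of_real (a n)) * x (Suc n) - x n"
    and sx: "summable (\<lambda>n. (cmod (x n))\<^sup>2)"
    and k: "k \<ge> 1"
  shows "transfer_weight a z k * (\<Sum>n. (cmod (x (n + Suc k)))\<^sup>2) \<le> 2 * ((cmod (x 0))\<^sup>2 + (cmod (x 1))\<^sup>2) / (Im z)\<^sup>2"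
proof -
  let ?p = "recsol a z 0 1" and ?q = "recsol a z 1 0"
  let ?S = "\<lambda>k. \<Sum>n. (cmod (x (n + k)))\<^sup>2"
  have S_mono: "?S (Suc k) \<le> ?S k" for k
  proof -
    have "summable (\<lambda>n. (cmod (x (n + k)))\<^sup>2)" by (rule summable_ignore_initial_segment[OF sx])
    from suminf_split_initial_segment[OF this, of 1] show ?thesis by simp
  qed
  have p: "(cmod (?p k))\<^sup>2 * ?S k \<le> (cmod (x 0))\<^sup>2 / (Im z)\<^sup>2" for k
    using half_line_green_bound[of z x a ?p k] z x sx by simp
  have q: "(cmod (?q k))\<^sup>2 * ?S k \<le> (cmod (x 1))\<^sup>2 / (Im z)\<^sup>2" if k1: "k \<ge> 1" for k
  proof -
    obtain j where j: "k = Suc j" using k1 by (cases k) auto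
    have "(cmod (?q (Suc j)))\<^sup>2 * (\<Sum>n. (cmod (x (Suc (n + j))))\<^sup>2) \<le> (cmod (?q (Suc 1) * x (Suc 0)))\<^sup>2 / (Im z)\<^sup>2"
      by (rule half_line_green_bound[where a = "\<lambda>n. a (Suc n)" and x = "\<lambda>n. x (Suc n)" and \<phi> = "\<lambda>n. ?q (Suc n)"])
         (use z x summable_Suc_iff[THEN iffD2, OF sx] in auto)
    thus ?thesis by (simp add: j)
  qed
  have "(cmod (?p k))\<^sup>2 * ?S (Suc k) \<le> (cmod (x 0))\<^sup>2 / (Im z)\<^sup>2"
    by (rule order_trans[OF mult_left_mono[OF S_mono] p]) auto
  moreover have "(cmod (?q k))\<^sup>2 * ?S (Suc k) \<le> (cmod (x 1))\<^sup>2 / (Im z)\<^sup>2"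
    by (rule order_trans[OF mult_left_mono[OF S_mono] q[OF k]]) auto
  moreover have "transfer_weight a z k * ?S (Suc k) = (cmod (?p k))\<^sup>2 * ?S (Suc k) + (cmod (?p (Suc k)))\<^sup>2 * ?S (Suc k)
      + (cmod (?q k))\<^sup>2 * ?S (Suc k) + (cmod (?q (Suc k)))\<^sup>2 * ?S (Suc k)"
    unfolding transfer_weight_def distrib_right ..
  moreover have "2 * ((cmod (x 0))\<^sup>2 + (cmod (x 1))\<^sup>2) / (Im z)\<^sup>2
      = 2 * ((cmod (x 0))\<^sup>2 / (Im z)\<^sup>2) + 2 * ((cmod (x 1))\<^sup>2 / (Im z)\<^sup>2)"
    unfolding distrib_left add_divide_distrib by simp
  ultimately show ?thesis
    using p[of "Suc k"] q[of "Suc k"] k by linarith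
qed

text \<open>The Wronskian of the two fundamental solutions is nonzero, so neither vanishes at two
  consecutive indices.\<close>

lemma transfer_weight_pos: "transfer_weight a z k > 0"
proof -
  have "recsol a z 0 1 k \<noteq> 0 \<or> recsol a z 0 1 (Suc k) \<noteq> 0"
  proof (rule ccontr)
    assume "\<not> ?thesis"
    thus False
      using wronskian_const[of "recsol a z 1 0" z a "recsol a z 0 1" k, OF recsol.simps(3) recsol.simps(3)] by simp
  qed
  hence "0 < (cmod (recsol a z 0 1 k))\<^sup>2 + (cmod (recsol a z 0 1 (Suc k)))\<^sup>2"
    unfolding sum_power2_gt_zero_iff by simp
  thus ?thesis unfolding transfer_weight_def
    using zero_le_power2[of "cmod (recsol a z 1 0 k)"] zero_le_power2[of "cmod (recsol a z 1 0 (Suc k))"] by linarith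
qed

section \<open>Operator norm and Hilbert-Schmidt norm of transfer matrices\<close>

lemma matrix_vector_mult_norm_le:
  fixes A :: "complex^2^2"
  shows "norm (A *v x) \<le> norm A * norm x"
proof -
  have "cmod ((A *v x) $ i) \<le> norm (A $ i) * norm x" for i
  proof -
    have "cmod ((A *v x) $ i) \<le> (\<Sum>j\<in>UNIV. \<bar>cmod (A $ i $ j)\<bar> * \<bar>cmod (x $ j)\<bar>)"
      unfolding matrix_vector_mult_def by (simp add: norm_mult[symmetric] sum_norm_le)
    also have "\<dots> \<le> norm (A $ i) * norm x"
      unfolding norm_vec_def by (rule L2_set_mult_ineq)
    finally show ?thesis .
  qed
  hence "norm (A *v x) \<le> L2_set (\<lambda>i. norm (A $ i) * norm x) UNIV"
    unfolding norm_vec_def[of "A *v x"] by (intro L2_set_mono) auto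
  also have "\<dots> = norm A * norm x"
    unfolding norm_vec_def[of A] by (simp add: L2_set_left_distrib)
  finally show ?thesis .
qed

lemma matrix_vector_mult_bounded_linear: "bounded_linear (\<lambda>x. (A :: complex^2^2) *v x)"
proof (rule bounded_linear_intro[where K = "norm A"])
  show "A *v (r *\<^sub>R x) = r *\<^sub>R (A *v x)" for r and x :: "complex^2"
    by (simp add: matrix_vector_mult_def vec_eq_iff scaleR_sum_right)
  show "norm (A *v x) \<le> norm x * norm A" for x
    using matrix_vector_mult_norm_le[of A x] by (simp add: mult.commute)
qed (rule matrix_vector_right_distrib)

lemma mnorm_le_norm: "mnorm A \<le> norm A"
  unfolding mnorm_def by (rule onorm_bound) (auto intro: matrix_vector_mult_norm_le)

lemma mnorm_nonneg: "0 \<le> mnorm A"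
  unfolding mnorm_def by (rule onorm_pos_le[OF matrix_vector_mult_bounded_linear])

lemma mnorm_triangle: "mnorm (A + B) \<le> mnorm A + mnorm B"
  unfolding mnorm_def matrix_vector_mult_add_rdistrib
  by (rule onorm_triangle[OF matrix_vector_mult_bounded_linear matrix_vector_mult_bounded_linear])

lemma mnorm_pos:
  assumes "A \<noteq> 0"
  shows "mnorm A > 0"
proof -
  have "mnorm A \<noteq> 0"
  proof
    assume "mnorm A = 0"
    hence "\<forall>x. A *v x = 0"
      unfolding mnorm_def using onorm_eq_0[OF matrix_vector_mult_bounded_linear] by blast
    hence "A = 0" by (metis matrix_eq matrix_vector_mult_0)
    thus False using assms by simp
  qed
  thus ?thesis using mnorm_nonneg[of A] by simp
qed

lemma continuous_on_mnorm: "continuous_on S mnorm"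
proof (rule continuous_onI)
  fix A :: "complex^2^2" and e :: real
  assume "e > 0"
  have "dist (mnorm A') (mnorm A) \<le> dist A' A" for A'
    using mnorm_triangle[of A "A' - A"] mnorm_triangle[of A' "A - A'"] mnorm_le_norm[of "A' - A"]
      mnorm_le_norm[of "A - A'"] by (simp add: dist_real_def dist_norm norm_minus_commute abs_le_iff)
  thus "\<exists>d>0. \<forall>x'\<in>S. dist x' A < d \<longrightarrow> dist (mnorm x') (mnorm A) \<le> e"
    using \<open>e > 0\<close> by (meson le_less_trans less_le)
qed

lemma Phi_pos_eq:
  fixes V z defines "a \<equiv> (\<lambda>j. V (int j + 1))"
  shows "Phi_pos V k z = vector [vector [recsol a z 0 1 (Suc k), recsol a z 1 0 (Suc k)],
      vector [recsol a z 0 1 k, recsol a z 1 0 k]]"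
proof (induction k)
  case 0
  show ?case by (simp add: vec_eq_iff forall_2 mat_def)
next
  case (Suc k)
  show ?case unfolding Phi_pos.simps Suc Tm_def
    by (simp add: vec_eq_iff forall_2 matrix_matrix_mult_def sum_2 a_def)
qed

lemma matrix_inv_Tm: "matrix_inv (Tm V m z) = vector [vector [0, 1], vector [-1, z - of_real (V m)]]"
proof -
  let ?B = "vector [vector [0, 1], vector [-1, z - of_real (V m)]] :: complex^2^2"
  have *: "Tm V m z ** ?B = mat 1" "?B ** Tm V m z = mat 1"
    by (simp_all add: vec_eq_iff forall_2 matrix_matrix_mult_def sum_2 mat_def Tm_def)
  hence "invertible (Tm V m z)" unfolding invertible_def by blast
  hence "matrix_inv (Tm V m z) ** Tm V m z = mat 1"
    unfolding matrix_inv_def invertible_def by (rule someI2_ex) blast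
  hence "(matrix_inv (Tm V m z) ** Tm V m z) ** ?B = ?B" by (simp only: matrix_mul_lid)
  thus ?thesis unfolding matrix_mul_assoc[symmetric] *(1) by (simp only: matrix_mul_rid)
qed

text \<open>Running to the left, the sites \<open>1\<close> and \<open>0\<close> get the indices
  \<open>0\<close> and \<open>1\<close>. Compared with \<open>Phi_pos_eq\<close>, both rows and
  columns are therefore swapped.\<close>

lemma Phi_neg_eq:
  fixes V z defines "a \<equiv> (\<lambda>j. V (- int j))"
  shows "Phi_neg V k z = vector [vector [recsol a z 1 0 k, recsol a z 0 1 k],
      vector [recsol a z 1 0 (Suc k), recsol a z 0 1 (Suc k)]]"
proof (induction k)
  case 0
  show ?case by (simp add: vec_eq_iff forall_2 mat_def)
next
  case (Suc k)
  show ?case unfolding Phi_neg.simps Suc matrix_inv_Tm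
    by (simp add: vec_eq_iff forall_2 matrix_matrix_mult_def sum_2 a_def)
qed

lemma norm_2x2: "(norm (A :: complex^2^2))\<^sup>2 = (cmod (A$1$1))\<^sup>2 + (cmod (A$1$2))\<^sup>2 + (cmod (A$2$1))\<^sup>2 + (cmod (A$2$2))\<^sup>2"
  unfolding norm_vec_def L2_set_def by (simp add: sum_2 sum_nonneg)

lemma
  fixes V z k defines "a \<equiv> (\<lambda>j. V (int j + 1))"
  shows mnorm_Phi_pos_le: "(mnorm (Phi_pos V k z))\<^sup>2 \<le> transfer_weight a z k"
    and mnorm_Phi_pos_pos: "mnorm (Phi_pos V k z) > 0"
proof -
  have n: "(norm (Phi_pos V k z))\<^sup>2 = transfer_weight a z k"
    unfolding norm_2x2 Phi_pos_eq transfer_weight_def a_def by (simp only: vector_2 ac_simps)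
  show "(mnorm (Phi_pos V k z))\<^sup>2 \<le> transfer_weight a z k"
    unfolding n[symmetric] by (intro power_mono mnorm_le_norm mnorm_nonneg)
  show "mnorm (Phi_pos V k z) > 0"
    using n transfer_weight_pos[of a z k] by (intro mnorm_pos) auto
qed

lemma
  fixes V z k defines "a \<equiv> (\<lambda>j. V (- int j))"
  shows mnorm_Phi_neg_le: "(mnorm (Phi_neg V k z))\<^sup>2 \<le> transfer_weight a z k"
    and mnorm_Phi_neg_pos: "mnorm (Phi_neg V k z) > 0"
proof -
  have n: "(norm (Phi_neg V k z))\<^sup>2 = transfer_weight a z k"
    unfolding norm_2x2 Phi_neg_eq transfer_weight_def a_def by (simp only: vector_2 ac_simps)
  show "(mnorm (Phi_neg V k z))\<^sup>2 \<le> transfer_weight a z k"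
    unfolding n[symmetric] by (intro power_mono mnorm_le_norm mnorm_nonneg)
  show "mnorm (Phi_neg V k z) > 0"
    using n transfer_weight_pos[of a z k] by (intro mnorm_pos) auto
qed

lemma mnorm_Phi_gt_0: "mnorm (Phi V n z) > 0"
  by (simp add: Phi_def mnorm_Phi_pos_pos mnorm_Phi_neg_pos)

lemma continuous_on_recsol:
  "continuous_on S f \<Longrightarrow> continuous_on S (\<lambda>E. recsol a (f E) s0 s1 k)"
proof (induction k rule: induct_nat_012)
  case (ge2 n)
  thus ?case by (auto intro!: continuous_intros)
qed auto

lemma continuous_on_Phi:
  assumes "continuous_on S f"
  shows "continuous_on S (\<lambda>E. Phi V n (f E))"
proof -
  note c = continuous_on_recsol[OF assms]
  have "\<forall>i j. continuous_on S (\<lambda>E. Phi V n (f E) $ i $ j)"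
  proof (cases "n \<ge> 0")
    case True
    thus ?thesis by (simp add: Phi_def Phi_pos_eq forall_2 c del: recsol.simps)
  next
    case False
    thus ?thesis by (simp add: Phi_def Phi_neg_eq forall_2 c del: recsol.simps)
  qed
  hence "continuous_on S (\<lambda>E. \<chi> i j. Phi V n (f E) $ i $ j)"
    by (intro continuous_on_vec_lambda) auto
  thus ?thesis by simp
qed

section \<open>The Laplace transform of the evolution\<close>

lemma
  assumes "\<epsilon> > 0"
  shows integrable_exp_half_line: "integrable lborel (\<lambda>t. indicator {0<..} t * exp (- \<epsilon> * t) :: real)"
    and integral_exp_half_line: "(\<integral>t. indicator {0<..} t * exp (- \<epsilon> * t) \<partial>lborel) = 1 / \<epsilon>"
proof -
  have e: "einterval 0 \<infinity> = {0<..}" by (auto simp: einterval_def zero_ereal_def)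
  show "integrable lborel (\<lambda>t. indicator {0<..} t * exp (- \<epsilon> * t) :: real)"
    using integrable_I0i_exp_mscale[OF assms] by (simp add: set_integrable_def e mult.commute)
  show "(\<integral>t. indicator {0<..} t * exp (- \<epsilon> * t) \<partial>lborel) = 1 / \<epsilon>"
    using LBINT_I0i_exp_mscale[OF assms]
    by (simp add: interval_lebesgue_integral_def set_lebesgue_integral_def e mult.commute)
qed

context bounded_potential begin

text \<open>Extended by zero to negative times, so that the Laplace transform becomes a Fourier
  transform on the whole line. With \<open>\<epsilon> = 1 / T\<close> its squared modulus is the
  integrand of \<open>aa\<close>.\<close>

definition damped :: "real \<Rightarrow> int \<Rightarrow> real \<Rightarrow> complex" where
  "damped \<epsilon> n t = indicator {0<..} t *\<^sub>R (exp (- \<epsilon> * t) *\<^sub>R evo V t n)"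

definition laplace_evo :: "real \<Rightarrow> real \<Rightarrow> int \<Rightarrow> complex" where
  "laplace_evo \<epsilon> x n = (\<integral>t. iexp (x * t) * damped \<epsilon> n t \<partial>lborel)"

lemma evo_measurable [measurable]: "(\<lambda>t. evo V t n) \<in> borel_measurable borel"
  by (rule borel_measurable_continuous_onI[OF continuous_on_evo])

lemma damped_measurable [measurable]: "damped \<epsilon> n \<in> borel_measurable borel"
  unfolding damped_def by measurable

lemma damped_le: "cmod (damped \<epsilon> n t) \<le> indicator {0<..} t * exp (- \<epsilon> * t)"
  using evo_norm_le[of t n] by (auto simp: damped_def indicator_def)

lemma damped_le_1:
  assumes "\<epsilon> > 0"
  shows "cmod (damped \<epsilon> n t) \<le> 1"
  using order_trans[OF damped_le[of \<epsilon> n t], of 1] assms by (auto simp: indicator_def)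

lemma damped_integrable: "\<epsilon> > 0 \<Longrightarrow> integrable lborel (damped \<epsilon> n)"
  by (rule Bochner_Integration.integrable_bound[OF integrable_exp_half_line])
     (auto intro!: AE_I2 order_trans[OF damped_le])

lemma iexp_damped_integrable: "\<epsilon> > 0 \<Longrightarrow> integrable lborel (\<lambda>t. iexp (x * t) * damped \<epsilon> n t)"
  by (rule Bochner_Integration.integrable_bound[OF damped_integrable]) (auto simp: norm_mult)

lemma isCont_damped:
  assumes "t \<noteq> 0"
  shows "isCont (damped \<epsilon> n) t"
proof (cases "t > 0")
  case True
  have "isCont (\<lambda>t. exp (- \<epsilon> * t) *\<^sub>R evo V t n) t"
    by (intro continuous_intros has_vector_derivative_continuous[OF evo_has_derivative])
  moreover have "\<forall>\<^sub>F s in nhds t. damped \<epsilon> n s = exp (- \<epsilon> * s) *\<^sub>R evo V s n"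
    using eventually_nhds_in_open[of "{0<..}" t] True by (auto elim!: eventually_mono simp: damped_def)
  ultimately show ?thesis by (subst isCont_cong)
next
  case False
  hence "\<forall>\<^sub>F s in nhds t. damped \<epsilon> n s = 0"
    using eventually_nhds_in_open[of "{..<0}" t] assms by (auto elim!: eventually_mono simp: damped_def)
  thus ?thesis using isCont_cong[of "damped \<epsilon> n" "\<lambda>_. 0" t] by simp
qed

lemma laplace_evo_measurable [measurable]: "(\<lambda>x. laplace_evo \<epsilon> x n) \<in> borel_measurable borel"
  unfolding laplace_evo_def by (rule lborel.borel_measurable_lebesgue_integral) measurable

text \<open>By duality: pair the transform with its own restriction to \<open>F\<close> and take the
  pairing under the time integral. Cauchy-Schwarz at each time, where the evolution has norm at most
  1, gives \<open>S \<le> sqrt S / \<epsilon>\<close>.\<close>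

lemma sum_laplace_evo_le:
  assumes \<epsilon>: "\<epsilon> > 0" and F: "finite F"
  shows "(\<Sum>n\<in>F. (cmod (laplace_evo \<epsilon> x n))\<^sup>2) \<le> 1 / \<epsilon>\<^sup>2"
proof -
  let ?u = "laplace_evo \<epsilon> x"
  define S where "S = (\<Sum>n\<in>F. (cmod (?u n))\<^sup>2)"
  have S0: "S \<ge> 0" by (simp add: S_def sum_nonneg)
  have "complex_of_real S = (\<Sum>n\<in>F. cnj (?u n) * ?u n)"
    by (simp only: S_def of_real_sum complex_norm_square mult.commute)
  also have "\<dots> = (\<integral>t. (\<Sum>n\<in>F. cnj (?u n) * (iexp (x * t) * damped \<epsilon> n t)) \<partial>lborel)"
  proof -
    have "c * ?u n = (\<integral>t. c * (iexp (x * t) * damped \<epsilon> n t) \<partial>lborel)" for c n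
      unfolding laplace_evo_def by (rule integral_mult_right_zero[symmetric])
    hence "(\<Sum>n\<in>F. cnj (?u n) * ?u n) = (\<Sum>n\<in>F. \<integral>t. cnj (?u n) * (iexp (x * t) * damped \<epsilon> n t) \<partial>lborel)"
      by (intro sum.cong refl)
    also have "\<dots> = (\<integral>t. (\<Sum>n\<in>F. cnj (?u n) * (iexp (x * t) * damped \<epsilon> n t)) \<partial>lborel)"
      by (rule Bochner_Integration.integral_sum[symmetric]) (intro integrable_mult_right iexp_damped_integrable \<epsilon>)
    finally show ?thesis .
  qed
  finally have "S = cmod (\<integral>t. (\<Sum>n\<in>F. cnj (?u n) * (iexp (x * t) * damped \<epsilon> n t)) \<partial>lborel)"
    using S0 by (metis abs_of_nonneg norm_of_real)
  also have "\<dots> \<le> (\<integral>t. norm (\<Sum>n\<in>F. cnj (?u n) * (iexp (x * t) * damped \<epsilon> n t)) \<partial>lborel)"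
    by (rule integral_norm_bound)
  also have "\<dots> \<le> (\<integral>t. sqrt S * (indicator {0<..} t * exp (- \<epsilon> * t)) \<partial>lborel)"
  proof (rule integral_mono_AE')
    show "integrable lborel (\<lambda>t. sqrt S * (indicator {0<..} t * exp (- \<epsilon> * t)))"
      by (intro integrable_mult_right integrable_exp_half_line \<epsilon>)
    show "AE t in lborel. 0 \<le> sqrt S * (indicator {0<..} t * exp (- \<epsilon> * t))" using S0 by simp
    show "AE t in lborel. norm (\<Sum>n\<in>F. cnj (?u n) * (iexp (x * t) * damped \<epsilon> n t)) \<le> sqrt S * (indicator {0<..} t * exp (- \<epsilon> * t))"
    proof (rule AE_I2)
      fix t :: real
      have "norm (\<Sum>n\<in>F. cnj (?u n) * (iexp (x * t) * damped \<epsilon> n t)) \<le> (\<Sum>n\<in>F. \<bar>cmod (?u n)\<bar> * \<bar>cmod (damped \<epsilon> n t)\<bar>)"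
        by (rule sum_norm_le) (simp add: norm_mult)
      also have "\<dots> \<le> L2_set (\<lambda>n. cmod (?u n)) F * L2_set (\<lambda>n. cmod (damped \<epsilon> n t)) F"
        by (rule L2_set_mult_ineq)
      also have "L2_set (\<lambda>n. cmod (?u n)) F = sqrt S" by (simp add: L2_set_def S_def)
      also have "L2_set (\<lambda>n. cmod (damped \<epsilon> n t)) F \<le> indicator {0<..} t * exp (- \<epsilon> * t)"
      proof (cases "t > 0")
        case True
        have "L2_set (\<lambda>n. cmod (damped \<epsilon> n t)) F = exp (- \<epsilon> * t) * L2_set (\<lambda>n. cmod (evo V t n)) F"
          using True by (simp add: damped_def L2_set_right_distrib)
        also have "L2_set (\<lambda>n. cmod (evo V t n)) F \<le> 1"
          using weighted_evolution_bound[of 1 t F] True F by (simp add: L2_set_def)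
        finally show ?thesis using True by simp
      qed (simp add: damped_def L2_set_def)
      finally show "norm (\<Sum>n\<in>F. cnj (?u n) * (iexp (x * t) * damped \<epsilon> n t)) \<le> sqrt S * (indicator {0<..} t * exp (- \<epsilon> * t))"
        using S0 by (simp add: mult_left_mono)
    qed
  qed
  also have "\<dots> = sqrt S * (1 / \<epsilon>)" using integral_exp_half_line[OF \<epsilon>] by simp
  finally have "S \<le> sqrt S / \<epsilon>" by simp
  hence "sqrt S * sqrt S \<le> sqrt S * (1 / \<epsilon>)" using S0 by simp
  hence "sqrt S \<le> 1 / \<epsilon>"
    using \<epsilon> S0 mult_left_le_imp_le[of "sqrt S" "sqrt S" "1 / \<epsilon>"] by (cases "S = 0") auto
  hence "(sqrt S)\<^sup>2 \<le> (1 / \<epsilon>)\<^sup>2" using S0 by (intro power_mono) auto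
  thus ?thesis using S0 unfolding S_def by (simp add: power_divide)
qed

lemma laplace_evo_ell2: "\<epsilon> > 0 \<Longrightarrow> laplace_evo \<epsilon> x \<in> ell2"
  using ell2_of_finite_sums[OF sum_laplace_evo_le] .

lemma laplace_evo_le:
  assumes "\<epsilon> > 0"
  shows "cmod (laplace_evo \<epsilon> x n) \<le> 1 / \<epsilon>"
proof -
  have "(cmod (laplace_evo \<epsilon> x n))\<^sup>2 \<le> (1 / \<epsilon>)\<^sup>2"
    using sum_laplace_evo_le[OF assms, of "{n}" x] by (simp add: power_divide)
  thus ?thesis using assms by (simp add: abs_le_square_iff[symmetric])
qed

text \<open>The function \<open>exp (\<i> * z * t) * evo V t n\<close> goes from
  \<open>delta 1 n\<close> at time 0 to 0 at infinity. Integrating its derivative yields the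
  resolvent equation by the fundamental theorem of calculus, one site at a time.\<close>

lemma laplace_evo_resolvent:
  assumes \<epsilon>: "\<epsilon> > 0"
  shows "Hop V (laplace_evo \<epsilon> x) n - (of_real x + \<i> * of_real \<epsilon>) * laplace_evo \<epsilon> x n = - \<i> * delta 1 n"
proof -
  let ?u = "laplace_evo \<epsilon> x"
  define z where "z = complex_of_real x + \<i> * of_real \<epsilon>"
  define e where "e = (\<lambda>t::real. exp (\<i> * z * of_real t))"
  have e_eq: "e t = iexp (x * t) * exp (- \<epsilon> * t)" for t
    by (simp add: e_def z_def exp_add[symmetric] exp_of_real[symmetric] algebra_simps)
  have e_norm: "cmod (e t) = exp (- \<epsilon> * t)" for t
    by (simp add: e_eq norm_mult)
  have e_deriv: "(e has_vector_derivative (\<i> * z * e t)) (at t)" for t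
  proof -
    have "((\<lambda>t. \<i> * z * complex_of_real t) has_vector_derivative \<i> * z) (at t)"
      by (auto intro!: derivative_eq_intros)
    from field_vector_diff_chain_at[OF this DERIV_exp] show ?thesis by (simp add: e_def[abs_def] o_def)
  qed
  have e_damped: "indicator {0<..} t *\<^sub>R (e t * evo V t m) = iexp (x * t) * damped \<epsilon> m t" for t m
    by (simp add: e_eq damped_def scaleR_conv_of_real exp_of_real)
  define F where "F = (\<lambda>t. e t * evo V t n)"
  define f where "f = (\<lambda>t. e t * (- \<i> * Hop V (evo V t) n) + (\<i> * z * e t) * evo V t n)"
  have F: "(F has_vector_derivative f t) (at t)" for t
    unfolding F_def f_def by (intro has_vector_derivative_mult e_deriv evo_has_derivative)
  have evo_cont: "isCont (\<lambda>t. evo V t m) t" for m t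
    by (rule has_vector_derivative_continuous[OF evo_has_derivative])
  have e_cont: "isCont e t" for t
    by (rule has_vector_derivative_continuous[OF e_deriv])
  have f_cont: "isCont f t" for t
    unfolding f_def Hop_def by (intro continuous_intros evo_cont e_cont)
  have ei: "einterval 0 \<infinity> = {0<..}" by (auto simp: einterval_def zero_ereal_def)
  let ?D = "\<lambda>m t. iexp (x * t) * damped \<epsilon> m t"
  have f_eq: "indicator {0<..} t *\<^sub>R f t = - \<i> * (?D (n + 1) t + ?D (n - 1) t + of_real (V n) * ?D n t) + \<i> * z * ?D n t" for t
    unfolding e_damped[symmetric] f_def Hop_def by (simp add: indicator_def algebra_simps)
  have Di: "integrable lborel (?D m)" for m by (rule iexp_damped_integrable[OF \<epsilon>])
  have f_int: "set_integrable lborel (einterval 0 \<infinity>) f"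
    unfolding set_integrable_def ei f_eq
    by (intro Bochner_Integration.integrable_add integrable_mult_right Di)
  have "(LBINT t=0..\<infinity>. f t) = 0 - delta 1 n"
  proof (rule interval_integral_FTC_integrable[OF _ F f_cont f_int])
    show "((F \<circ> real_of_ereal) \<longlongrightarrow> delta 1 n) (at_right 0)"
    proof -
      have "isCont F 0" unfolding F_def by (intro continuous_intros evo_cont e_cont)
      hence "(F \<longlongrightarrow> F 0) (at_right 0)" by (simp add: isCont_def filterlim_at_split)
      moreover have "F 0 = delta 1 n" by (simp add: F_def e_def evo_0)
      ultimately show ?thesis
        by (simp add: zero_ereal_def ereal_tendsto_simps1)
    qed
    show "((F \<circ> real_of_ereal) \<longlongrightarrow> 0) (at_left \<infinity>)"
    proof -
      have "(F \<longlongrightarrow> 0) at_top"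
      proof (rule Lim_null_comparison)
        show "\<forall>\<^sub>F t in at_top. norm (F t) \<le> exp (- \<epsilon> * t)"
          using eventually_ge_at_top[of 0]
        proof eventually_elim
          case (elim t)
          thus ?case using evo_norm_le[of t n] by (simp add: F_def norm_mult e_norm mult_left_le)
        qed
        show "((\<lambda>t. exp (- \<epsilon> * t)) \<longlongrightarrow> 0) at_top"
          using \<epsilon> by real_asymp
      qed
      thus ?thesis by (simp add: ereal_tendsto_simps1)
    qed
  qed simp
  moreover have "(LBINT t=0..\<infinity>. f t) = - \<i> * Hop V ?u n + \<i> * z * ?u n"
  proof -
    have "(LBINT t=0..\<infinity>. f t) = (\<integral>t. - \<i> * (?D (n + 1) t + ?D (n - 1) t + of_real (V n) * ?D n t) + \<i> * z * ?D n t \<partial>lborel)"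
      unfolding interval_lebesgue_integral_def set_lebesgue_integral_def ei f_eq by simp
    also have "\<dots> = - \<i> * (?u (n + 1) + ?u (n - 1) + of_real (V n) * ?u n) + \<i> * z * ?u n"
      unfolding laplace_evo_def
      by (subst Bochner_Integration.integral_add
         | subst integral_mult_right_zero | intro Bochner_Integration.integrable_add integrable_mult_right Di refl)+
    finally show ?thesis by (simp add: Hop_def)
  qed
  ultimately have "\<i> * (Hop V ?u n - z * ?u n) = delta 1 n" by (simp add: algebra_simps)
  hence "\<i> * (Hop V ?u n - z * ?u n) = \<i> * (- \<i> * delta 1 n)" by simp
  hence "Hop V ?u n - z * ?u n = - \<i> * delta 1 n" by (simp only: mult_cancel_left) simp
  thus ?thesis by (simp add: z_def)
qed

end

section \<open>Decay of the resolvent\<close>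

text \<open>Neighbouring weights are equal or have ratio \<open>3/2\<close>. The cut-off at
  \<open>L\<close> keeps the weight bounded, so that weighted vectors are square summable
  beforehand; the estimates do not see \<open>L\<close>.\<close>

lemma min_power_ratio_le:
  fixes L :: nat
  defines "e \<equiv> (\<lambda>n::int. (3/2::real) ^ min (nat \<bar>n\<bar>) L)"
  shows "(e n - e (n + 1))\<^sup>2 \<le> 1/4 * (e n * e (n + 1))"
proof -
  let ?a = "min (nat \<bar>n\<bar>) L" and ?b = "min (nat \<bar>n + 1\<bar>) L"
  have aux: "((3/2::real) ^ a - (3/2) ^ b)\<^sup>2 \<le> 1/4 * ((3/2) ^ a * (3/2) ^ b)" if "b = Suc a \<or> a = Suc b \<or> a = b" for a b
    using that by (auto simp: power2_eq_square algebra_simps)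
  have "?b = Suc ?a \<or> ?a = Suc ?b \<or> ?a = ?b" by (auto simp: min_def)
  from aux[OF this] show ?thesis by (simp add: e_def)
qed

lemma sum_quotient_squares: "2 * ((a / c)\<^sup>2 + (1 / c)\<^sup>2) / c\<^sup>2 = 2 * (a\<^sup>2 + 1) / (c::real) ^ 4"
proof -
  have "(a / c)\<^sup>2 + (1 / c)\<^sup>2 = (a\<^sup>2 + 1) / c\<^sup>2" by (simp add: power_divide add_divide_distrib)
  moreover have "c ^ 4 = c\<^sup>2 * c\<^sup>2" by (simp add: power_add[symmetric])
  ultimately show ?thesis by simp
qed

context bounded_potential begin

text \<open>A Combes-Thomas estimate: conjugation with the exponential weight \<open>e\<close> perturbs the quadratic form of \<open>H\<close>
  by \<open>\<Sum>n. (e n - e (n + 1))\<^sup>2 * (u n \<bullet> u (n + 1))\<close> only.\<close>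

lemma combes_thomas:
  fixes L :: nat and x K \<epsilon> :: real
  assumes nr: "\<And>f. f \<in> ell2 \<Longrightarrow> \<bar>ip f (Hop V f)\<bar> \<le> (K - 1) * ip f f"
    and x: "\<bar>x\<bar> \<ge> K" and \<epsilon>: "\<epsilon> > 0"
  defines "u \<equiv> laplace_evo \<epsilon> x"
  defines "w \<equiv> (\<lambda>n. complex_of_real ((3/2) ^ min (nat \<bar>n\<bar>) L) * u n)"
  shows "w \<in> ell2" "ip w w \<le> 9 / 4 / (\<bar>x\<bar> - K + 1/2)\<^sup>2"
proof -
  define e where "e = (\<lambda>n::int. (3/2::real) ^ min (nat \<bar>n\<bar>) L)"
  have e_pos: "e n > 0" for n by (simp add: e_def)
  have e_le: "e n \<le> (3/2) ^ L" for n unfolding e_def by (rule power_increasing) auto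
  have w_eq: "w = (\<lambda>n. of_real (e n) * u n)" by (simp add: w_def e_def)
  have u: "u \<in> ell2" unfolding u_def by (rule laplace_evo_ell2[OF \<epsilon>])
  show w: "w \<in> ell2"
    unfolding w_eq by (rule ell2_mult_bounded[OF u, where B = "(3/2) ^ L"]) (use e_pos e_le in \<open>simp add: less_imp_le\<close>)
  \<comment> \<open>Carrying the weight twice, \<open>v\<close> satisfies
    \<open>ip v u = ip w w\<close>, and the potential terms of the forms
    \<open>ip v (Hop V u)\<close> and \<open>ip w (Hop V w)\<close> agree. Only the hopping terms
    differ.\<close>
  define v where "v = (\<lambda>n. of_real (e n) * w n)"
  have v: "v \<in> ell2"
    unfolding v_def by (rule ell2_mult_bounded[OF w, where B = "(3/2) ^ L"]) (use e_pos e_le in \<open>simp add: less_imp_le\<close>)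
  have sc: "(of_real c * a) \<bullet> b = c * (a \<bullet> b)" "a \<bullet> (of_real c * b) = c * (a \<bullet> b)" for c and a b :: complex
    by (simp_all add: inner_complex_def algebra_simps)
  define Q where "Q = ip w w"
  have Q0: "Q \<ge> 0" by (simp add: Q_def ip_self_nonneg)
  have vu: "ip v u = Q"
    unfolding Q_def ip_def v_def w_eq sc by (simp add: sc)
  have vVu: "ip v (\<lambda>n. of_real (V n) * u n) = ip w (\<lambda>n. of_real (V n) * w n)"
    unfolding ip_def v_def w_eq by (intro infsum_cong) (simp add: inner_complex_def algebra_simps)
  define c1 where "c1 = v 1 \<bullet> (- \<i>)"
  \<comment> \<open>The imaginary part of the energy drops out: \<open>v n\<close> is a real
    multiple of \<open>u n\<close>, hence orthogonal to \<open>\<i> * u n\<close> in the real inner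
    product. This makes the estimate uniform in \<open>\<epsilon>\<close>.\<close>
  have vH: "ip v (Hop V u) = x * Q + c1"
  proof -
    have "v n \<bullet> Hop V u n = x * (v n \<bullet> u n) + (if n = 1 then c1 else 0)" for n
    proof -
      have H: "Hop V u n = (of_real x + \<i> * of_real \<epsilon>) * u n - \<i> * delta 1 n"
        using laplace_evo_resolvent[OF \<epsilon>, of x n] unfolding u_def by (simp add: algebra_simps)
      have "v n \<bullet> Hop V u n = v n \<bullet> (of_real x * u n) + \<epsilon> * (v n \<bullet> (\<i> * u n)) + v n \<bullet> (- \<i> * delta 1 n)"
        unfolding H by (simp add: inner_complex_def algebra_simps)
      also have "v n \<bullet> (\<i> * u n) = 0"
        unfolding v_def w_eq sc by (simp add: inner_complex_def)
      also have "v n \<bullet> (- \<i> * delta 1 n) = (if n = 1 then c1 else 0)" by (auto simp: c1_def delta_def)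
      finally show ?thesis by (simp add: sc)
    qed
    hence "ip v (Hop V u) = (\<Sum>\<^sub>\<infinity>n. x * (v n \<bullet> u n) + (if n = 1 then c1 else 0))" by (simp add: ip_def)
    also have "\<dots> = (\<Sum>\<^sub>\<infinity>n. x * (v n \<bullet> u n)) + (\<Sum>\<^sub>\<infinity>n. if n = (1::int) then c1 else 0)"
      by (intro infsum_add summable_on_cmult_right summable_inner u v)
         (rule finite_nonzero_values_imp_summable_on, rule finite_subset[of _ "{1}"], auto split: if_splits)
    also have "(\<Sum>\<^sub>\<infinity>n. if n = (1::int) then c1 else 0) = (\<Sum>\<^sub>\<infinity>n\<in>{1::int}. c1)"
      by (rule infsum_cong_neutral) auto
    also have "(\<Sum>\<^sub>\<infinity>n. x * (v n \<bullet> u n)) = x * Q"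
      using vu by (simp add: ip_def infsum_cmult_right')
    finally show ?thesis by simp
  qed
  define t where "t = (\<lambda>n. 2 * (w n \<bullet> w (n + 1)) - v n \<bullet> u (n + 1) - v (n + 1) \<bullet> u n)"
  have sh: "(\<lambda>n. f (n + 1)) \<in> ell2" if "f \<in> ell2" for f using ell2_shift[OF that] .
  have sw: "(\<lambda>n. w n \<bullet> w (n + 1)) summable_on UNIV" by (rule summable_inner[OF w sh[OF w]])
  have s1: "(\<lambda>n. v n \<bullet> u (n + 1)) summable_on UNIV" by (rule summable_inner[OF v sh[OF u]])
  have s2: "(\<lambda>n. v (n + 1) \<bullet> u n) summable_on UNIV" by (rule summable_inner[OF sh[OF v] u])
  have diff: "(\<Sum>\<^sub>\<infinity>n. f n - g n) = (\<Sum>\<^sub>\<infinity>n. f n) - (\<Sum>\<^sub>\<infinity>n. g n)" "(\<lambda>n. f n - g n) summable_on UNIV"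
    if "f summable_on UNIV" "g summable_on UNIV" for f g :: "int \<Rightarrow> real"
    using infsum_add[of f UNIV "\<lambda>n. - g n"] summable_on_add[of f UNIV "\<lambda>n. - g n"] that
    by (simp_all add: infsum_uminus summable_on_uminus)
  have sw2: "(\<lambda>n. 2 * (w n \<bullet> w (n + 1))) summable_on UNIV" by (intro summable_on_cmult_right sw)
  have ts: "t summable_on UNIV" unfolding t_def by (intro diff sw2 s1 s2)
  have T: "(\<Sum>\<^sub>\<infinity>n. t n) = 2 * ip w (\<lambda>n. w (n + 1)) - ip v (\<lambda>n. u (n + 1)) - ip (\<lambda>n. v (n + 1)) u"
    unfolding t_def ip_def using sw2 s1 s2 by (simp add: diff infsum_cmult_right')
  have form: "ip w (Hop V w) = x * Q + c1 + (\<Sum>\<^sub>\<infinity>n. t n)"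
    using Hop_expand[OF w w] Hop_expand[OF v u] vH vVu T ip_shift[of w w] ip_shift[of v u]
      ip_commute[of "\<lambda>n. w (n + 1)" w] by simp
  define g where "g = (\<lambda>n. 1/8 * (cmod (w n))\<^sup>2 + 1/8 * (cmod (w (n + 1)))\<^sup>2)"
  have tg: "\<bar>t n\<bar> \<le> g n" for n
  proof -
    have "t n = - ((e n - e (n + 1))\<^sup>2 * (u n \<bullet> u (n + 1)))"
      unfolding t_def v_def w_eq sc inner_commute[of "u (n + 1)"] power2_eq_square by algebra
    hence "\<bar>t n\<bar> = (e n - e (n + 1))\<^sup>2 * \<bar>u n \<bullet> u (n + 1)\<bar>" by (simp add: abs_mult)
    also have "\<dots> \<le> (1/4 * (e n * e (n + 1))) * (cmod (u n) * cmod (u (n + 1)))"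
      unfolding e_def by (intro mult_mono min_power_ratio_le Cauchy_Schwarz_ineq2) auto
    also have "\<dots> = 1/4 * (cmod (w n) * cmod (w (n + 1)))"
      using e_pos[of n] e_pos[of "n + 1"] by (simp add: w_eq norm_mult)
    also have "\<dots> \<le> g n"
      using sum_squares_bound[of "cmod (w n)" "cmod (w (n + 1))"] by (simp add: g_def)
    finally show ?thesis .
  qed
  have gs: "(g has_sum Q / 4) UNIV"
  proof -
    have 1: "((\<lambda>n. (cmod (w n))\<^sup>2) has_sum Q) UNIV"
      using w by (simp add: Q_def ip_self ell2_iff)
    have 2: "((\<lambda>n. (cmod (w (n + 1)))\<^sup>2) has_sum Q) UNIV"
      using has_sum_reindex_bij_betw[OF bij_int_shift[of 1], of "\<lambda>n. (cmod (w n))\<^sup>2" Q] 1 by simp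
    have "(g has_sum 1/8 * Q + 1/8 * Q) UNIV"
      unfolding g_def by (intro has_sum_add has_sum_cmult_right 1 2)
    thus ?thesis by simp
  qed
  \<comment> \<open>The error must stay below the gap 1 between \<open>K - 1\<close> and
    \<open>\<bar>x\<bar>\<close>; the ratio \<open>3/2\<close> of the weights is chosen small enough
    for that.\<close>
  have T_le: "\<bar>\<Sum>\<^sub>\<infinity>n. t n\<bar> \<le> Q / 4"
  proof (rule abs_leI)
    show "(\<Sum>\<^sub>\<infinity>n. t n) \<le> Q / 4"
      using tg by (intro has_sum_mono[OF has_sum_infsum[OF ts] gs]) (simp add: abs_le_iff)
    have "((\<lambda>n. - t n) has_sum - (\<Sum>\<^sub>\<infinity>n. t n)) UNIV" using ts by (simp add: has_sum_uminus)
    from has_sum_mono[OF this gs] tg show "- (\<Sum>\<^sub>\<infinity>n. t n) \<le> Q / 4"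
      by (simp add: abs_le_iff)
  qed
  have c1_le: "\<bar>c1\<bar> \<le> 3/2 * sqrt Q"
  proof -
    have "\<bar>c1\<bar> \<le> cmod (v 1) * cmod (- \<i>)" unfolding c1_def by (rule Cauchy_Schwarz_ineq2)
    also have "\<dots> = e 1 * cmod (w 1)" using e_pos[of 1] by (simp add: v_def norm_mult)
    also have "\<dots> \<le> 3/2 * sqrt Q"
    proof (rule mult_mono)
      show "e 1 \<le> 3/2" unfolding e_def using power_increasing[of "min 1 L" 1 "3/2::real"] by simp
      show "cmod (w 1) \<le> sqrt Q"
        unfolding Q_def by (rule real_le_rsqrt[OF cmod_square_le_ip_self[OF w]])
    qed auto
    finally show ?thesis .
  qed
  have "\<bar>x\<bar> * Q \<le> (K - 1) * Q + 3/2 * sqrt Q + Q / 4"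
  proof -
    have "\<bar>x\<bar> * Q = \<bar>ip w (Hop V w) - c1 - (\<Sum>\<^sub>\<infinity>n. t n)\<bar>"
      using form Q0 by (simp add: abs_mult)
    also have "\<dots> \<le> \<bar>ip w (Hop V w)\<bar> + \<bar>c1\<bar> + \<bar>\<Sum>\<^sub>\<infinity>n. t n\<bar>" by linarith
    finally show ?thesis using nr[OF w] c1_le T_le by (simp add: Q_def)
  qed
  hence "(\<bar>x\<bar> - K + 3/4) * Q \<le> 3/2 * sqrt Q" by (simp add: algebra_simps)
  moreover have "(\<bar>x\<bar> - K + 1/2) * Q \<le> (\<bar>x\<bar> - K + 3/4) * Q" using Q0 by (intro mult_right_mono) auto
  ultimately have "(\<bar>x\<bar> - K + 1/2) * (sqrt Q * sqrt Q) \<le> 3/2 * sqrt Q"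
    using Q0 by simp
  hence "sqrt Q * ((\<bar>x\<bar> - K + 1/2) * sqrt Q) \<le> sqrt Q * (3/2)"
    by (simp only: ac_simps)
  hence le: "(\<bar>x\<bar> - K + 1/2) * sqrt Q \<le> 3/2"
  proof (cases "Q = 0")
    case False
    hence "sqrt Q > 0" using Q0 by simp
    thus ?thesis using \<open>sqrt Q * _ \<le> sqrt Q * (3/2)\<close> by (simp only: mult_le_cancel_left_pos)
  qed simp
  have "((\<bar>x\<bar> - K + 1/2) * sqrt Q)\<^sup>2 \<le> (3/2)\<^sup>2"
    using le x Q0 by (intro power_mono) auto
  hence "(\<bar>x\<bar> - K + 1/2)\<^sup>2 * Q \<le> 9/4" using Q0 by (simp add: power_mult_distrib power_divide)
  moreover have "(\<bar>x\<bar> - K + 1/2)\<^sup>2 > 0" using x by simp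
  ultimately show "ip w w \<le> 9 / 4 / (\<bar>x\<bar> - K + 1/2)\<^sup>2"
    unfolding Q_def[symmetric] by (simp only: pos_le_divide_eq mult.commute)
qed

text \<open>With the cut-off placed at \<open>N\<close>, the weight has the constant value
  \<open>(3/2) ^ N\<close> on \<open>F\<close>. The remaining factor is of order
  \<open>1 / x ^ 2\<close> for large \<open>x\<close> and so integrable over the energies.\<close>

lemma laplace_evo_tail_outside:
  assumes nr: "\<And>f. f \<in> ell2 \<Longrightarrow> \<bar>ip f (Hop V f)\<bar> \<le> (K - 1) * ip f f"
    and x: "\<bar>x\<bar> \<ge> K" and \<epsilon>: "\<epsilon> > 0" and F: "finite F" "\<And>n. n \<in> F \<Longrightarrow> N \<le> nat \<bar>n\<bar>"
  shows "(\<Sum>n\<in>F. (cmod (laplace_evo \<epsilon> x n))\<^sup>2) \<le> (4/9) ^ N * (9 / 4 / (\<bar>x\<bar> - K + 1/2)\<^sup>2)"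
proof -
  let ?u = "laplace_evo \<epsilon> x"
  define w where "w = (\<lambda>n. complex_of_real ((3/2) ^ min (nat \<bar>n\<bar>) N) * ?u n)"
  have "(\<Sum>n\<in>F. (cmod (?u n))\<^sup>2) = (\<Sum>n\<in>F. (4/9) ^ N * (cmod (w n))\<^sup>2)"
  proof (intro sum.cong refl)
    fix n assume "n \<in> F"
    hence "min (nat \<bar>n\<bar>) N = N" using F(2) by simp
    hence "cmod (w n) = (3/2) ^ N * cmod (?u n)" by (simp add: w_def norm_mult norm_power norm_divide)
    hence "(cmod (w n))\<^sup>2 = (9/4) ^ N * (cmod (?u n))\<^sup>2"
      by (simp add: power_mult_distrib power2_eq_square) (simp add: power_mult_distrib[symmetric])
    thus "(cmod (?u n))\<^sup>2 = (4/9) ^ N * (cmod (w n))\<^sup>2"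
      by (simp add: mult.assoc[symmetric] power_mult_distrib[symmetric])
  qed
  also have "\<dots> = (4/9) ^ N * (\<Sum>n\<in>F. (cmod (w n))\<^sup>2)" by (simp add: sum_distrib_left)
  also have "\<dots> \<le> (4/9) ^ N * (9 / 4 / (\<bar>x\<bar> - K + 1/2)\<^sup>2)"
    using combes_thomas[OF nr x \<epsilon>, of N] sum_le_ip_self[of w F] F(1) unfolding w_def
    by (intro mult_left_mono) auto
  finally show ?thesis .
qed

text \<open>Two of the four powers of \<open>1 / \<epsilon>\<close> come from the Green function,
  the other two from the values of the resolvent near the origin.\<close>

lemma right_tail_bound:
  fixes x \<epsilon> :: real
  defines "z \<equiv> complex_of_real x + \<i> * of_real \<epsilon>"
  assumes \<epsilon>: "\<epsilon> > 0" and k: "k \<ge> 1" and F: "finite F" "\<And>n. n \<in> F \<Longrightarrow> n > int k"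
  shows "(mnorm (Phi_pos V k z))\<^sup>2 * (\<Sum>n\<in>F. (cmod (laplace_evo \<epsilon> x n))\<^sup>2)
    \<le> 2 * ((cmod z + B + 1)\<^sup>2 + 1) / \<epsilon> ^ 4"
proof -
  let ?u = "laplace_evo \<epsilon> x" and ?a = "\<lambda>j. V (int j + 1)"
  have Imz: "Im z = \<epsilon>" by (simp add: z_def)
  \<comment> \<open>The resolvent has its source at site \<open>1\<close>, where the homogeneous
    recursion fails. Changing the value at \<open>0\<close> restores it there and leaves the sites
    to the right untouched.\<close>
  define X where "X = (\<lambda>j. if j = 0 then (z - of_real (V 1)) * ?u 1 - ?u 2 else ?u (int j))"
  have rec: "X (Suc (Suc n)) = (z - of_real (?a n)) * X (Suc n) - X n" for n
  proof (cases n)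
    case 0
    thus ?thesis by (simp add: X_def)
  next
    case (Suc m)
    have "Hop V ?u (int n + 1) = z * ?u (int n + 1)"
      using laplace_evo_resolvent[OF \<epsilon>, of x "int n + 1"] Suc by (simp add: delta_def z_def)
    thus ?thesis using Suc by (simp add: X_def Hop_def algebra_simps)
  qed
  have "summable (\<lambda>n. (cmod (?u (int n)))\<^sup>2)"
  proof -
    have "(\<lambda>n. (cmod (?u n))\<^sup>2) summable_on range int"
      using laplace_evo_ell2[OF \<epsilon>, of x] unfolding ell2_iff by (rule summable_on_subset_banach) auto
    hence "(\<lambda>n. (cmod (?u (int n)))\<^sup>2) summable_on UNIV"
      by (subst (asm) summable_on_reindex) (auto simp: o_def)
    thus ?thesis by (rule summable_on_imp_summable)
  qed
  hence sX: "summable (\<lambda>n. (cmod (X n))\<^sup>2)"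
    by (subst summable_Suc_iff[symmetric], subst (asm) summable_Suc_iff[symmetric]) (simp add: X_def)
  have "(\<Sum>n\<in>F. (cmod (?u n))\<^sup>2) = (\<Sum>m\<in>(\<lambda>n. nat n - Suc k) ` F. (cmod (X (m + Suc k)))\<^sup>2)"
    by (rule sum.reindex_bij_witness[of _ "\<lambda>m. int (m + Suc k)" "\<lambda>n. nat n - Suc k"])
       (use F(2) in \<open>force simp: X_def\<close>)+
  also have "\<dots> \<le> (\<Sum>m. (cmod (X (m + Suc k)))\<^sup>2)"
    using F(1) by (intro sum_le_suminf summable_ignore_initial_segment sX) auto
  finally have "(mnorm (Phi_pos V k z))\<^sup>2 * (\<Sum>n\<in>F. (cmod (?u n))\<^sup>2)
      \<le> transfer_weight ?a z k * (\<Sum>m. (cmod (X (m + Suc k)))\<^sup>2)"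
    by (intro mult_mono mnorm_Phi_pos_le) (auto intro: sum_nonneg less_imp_le[OF transfer_weight_pos])
  also have "\<dots> \<le> 2 * ((cmod (X 0))\<^sup>2 + (cmod (X 1))\<^sup>2) / (Im z)\<^sup>2"
    by (rule transfer_tail_bound[OF _ rec sX k]) (simp add: z_def \<epsilon>)
  also have "\<dots> \<le> 2 * (((cmod z + B + 1) / \<epsilon>)\<^sup>2 + (1 / \<epsilon>)\<^sup>2) / (Im z)\<^sup>2"
  proof -
    have "cmod (X 0) \<le> cmod (z - of_real (V 1)) * cmod (?u 1) + cmod (?u 2)"
      unfolding X_def by (simp add: order_trans[OF norm_triangle_ineq4] norm_mult)
    also have "\<dots> \<le> (cmod z + B) * (1 / \<epsilon>) + 1 / \<epsilon>"
    proof (intro add_mono mult_mono laplace_evo_le \<epsilon>)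
      show "cmod (z - of_real (V 1)) \<le> cmod z + B"
        using norm_triangle_ineq4[of z "complex_of_real (V 1)"] V_bound[of 1] by simp
    qed (use B_nonneg in auto)
    also have "\<dots> = (cmod z + B + 1) / \<epsilon>" by (simp add: add_divide_distrib)
    finally have "cmod (X 0) \<le> (cmod z + B + 1) / \<epsilon>" .
    moreover have "cmod (X 1) \<le> 1 / \<epsilon>" using laplace_evo_le[OF \<epsilon>] by (simp add: X_def)
    ultimately show ?thesis by (intro divide_right_mono mult_left_mono add_mono power_mono) auto
  qed
  also have "\<dots> = 2 * ((cmod z + B + 1)\<^sup>2 + 1) / \<epsilon> ^ 4"
    unfolding Imz by (rule sum_quotient_squares)
  finally show ?thesis .
qed

lemma left_tail_bound:
  fixes x \<epsilon> :: real
  defines "z \<equiv> complex_of_real x + \<i> * of_real \<epsilon>"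
  assumes \<epsilon>: "\<epsilon> > 0" and k: "k \<ge> 1" and F: "finite F" "\<And>n. n \<in> F \<Longrightarrow> n \<le> - int k"
  shows "(mnorm (Phi_neg V k z))\<^sup>2 * (\<Sum>n\<in>F. (cmod (laplace_evo \<epsilon> x n))\<^sup>2)
    \<le> 2 * ((cmod z + B + 1)\<^sup>2 + 1) / \<epsilon> ^ 4"
proof -
  let ?u = "laplace_evo \<epsilon> x" and ?a = "\<lambda>j. V (- int j)"
  have Imz: "Im z = \<epsilon>" by (simp add: z_def)
  \<comment> \<open>On this side no correction is made: the recursion is only used at sites
    \<open>- n \<le> 0\<close>, away from the source.\<close>
  define X where "X = (\<lambda>j. ?u (1 - int j))"
  have rec: "X (Suc (Suc n)) = (z - of_real (?a n)) * X (Suc n) - X n" for n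
  proof -
    have h: "?u (- int n + 1) + ?u (- int n - 1) + of_real (V (- int n)) * ?u (- int n) = z * ?u (- int n)"
      using laplace_evo_resolvent[OF \<epsilon>, of x "- int n"] by (simp add: delta_def z_def Hop_def)
    have "?u (- int n - 1) = (z - of_real (V (- int n))) * ?u (- int n) - ?u (- int n + 1)"
      unfolding left_diff_distrib h[symmetric] by simp
    moreover have "1 - int (Suc (Suc n)) = - int n - 1" "1 - int (Suc n) = - int n" "1 - int n = - int n + 1" by auto
    ultimately show ?thesis unfolding X_def by (simp only:)
  qed
  have sX: "summable (\<lambda>n. (cmod (X n))\<^sup>2)"
  proof -
    have "(\<lambda>n. (cmod (?u n))\<^sup>2) summable_on range (\<lambda>j. 1 - int j)"
      using laplace_evo_ell2[OF \<epsilon>, of x] unfolding ell2_iff by (rule summable_on_subset_banach) auto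
    hence "(\<lambda>n. (cmod (X n))\<^sup>2) summable_on UNIV"
      by (subst (asm) summable_on_reindex) (auto simp: o_def X_def inj_on_def)
    thus ?thesis by (rule summable_on_imp_summable)
  qed
  have "(\<Sum>n\<in>F. (cmod (?u n))\<^sup>2) = (\<Sum>m\<in>(\<lambda>n. nat (1 - n) - Suc k) ` F. (cmod (X (m + Suc k)))\<^sup>2)"
    by (rule sum.reindex_bij_witness[of _ "\<lambda>m. 1 - int (m + Suc k)" "\<lambda>n. nat (1 - n) - Suc k"])
       (use F(2) in \<open>force simp: X_def\<close>)+
  also have "\<dots> \<le> (\<Sum>m. (cmod (X (m + Suc k)))\<^sup>2)"
    using F(1) by (intro sum_le_suminf summable_ignore_initial_segment sX) auto
  finally have "(mnorm (Phi_neg V k z))\<^sup>2 * (\<Sum>n\<in>F. (cmod (?u n))\<^sup>2)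
      \<le> transfer_weight ?a z k * (\<Sum>m. (cmod (X (m + Suc k)))\<^sup>2)"
    by (intro mult_mono mnorm_Phi_neg_le) (auto intro: sum_nonneg less_imp_le[OF transfer_weight_pos])
  also have "\<dots> \<le> 2 * ((cmod (X 0))\<^sup>2 + (cmod (X 1))\<^sup>2) / (Im z)\<^sup>2"
    by (rule transfer_tail_bound[OF _ rec sX k]) (simp add: z_def \<epsilon>)
  also have "\<dots> \<le> 2 * (((cmod z + B + 1) / \<epsilon>)\<^sup>2 + (1 / \<epsilon>)\<^sup>2) / (Im z)\<^sup>2"
  proof -
    have "cmod (X 0) \<le> 1 / \<epsilon>" using laplace_evo_le[OF \<epsilon>] by (simp add: X_def)
    also have "1 / \<epsilon> \<le> (cmod z + B + 1) / \<epsilon>" using \<epsilon> B_nonneg by (intro divide_right_mono) auto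
    finally have "cmod (X 0) \<le> (cmod z + B + 1) / \<epsilon>" .
    moreover have "cmod (X 1) \<le> 1 / \<epsilon>" using laplace_evo_le[OF \<epsilon>] by (simp add: X_def)
    ultimately show ?thesis by (intro divide_right_mono mult_left_mono add_mono power_mono) auto
  qed
  also have "\<dots> = 2 * ((cmod z + B + 1)\<^sup>2 + 1) / \<epsilon> ^ 4"
    unfolding Imz by (rule sum_quotient_squares)
  finally show ?thesis .
qed

end

section \<open>Outside probabilities\<close>

context bounded_potential begin

lemma damped_square_integrable:
  assumes "\<epsilon> > 0"
  shows "integrable lborel (\<lambda>t. (cmod (damped \<epsilon> n t))\<^sup>2)"
proof (rule Bochner_Integration.integrable_bound[OF damped_integrable[OF assms, of n]])
  have "(cmod (damped \<epsilon> n t))\<^sup>2 \<le> cmod (damped \<epsilon> n t)" for t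
    using damped_le_1[OF assms, of n t] by (simp add: power2_eq_square mult_left_le)
  thus "AE t in lborel. norm ((cmod (damped \<epsilon> n t))\<^sup>2) \<le> norm (damped \<epsilon> n t)" by simp
qed measurable

lemma damped_square: "(cmod (damped \<epsilon> n t))\<^sup>2 = indicator {0<..} t * (exp (- 2 * \<epsilon> * t) * (cmod (evo V t n))\<^sup>2)"
  by (simp add: damped_def indicator_def power_mult_distrib exp_double[symmetric] mult_ac)

lemma aa_eq:
  assumes "T > 0"
  shows "aa V n T = 2 / T * (\<integral>t. (cmod (damped (1 / T) n t))\<^sup>2 \<partial>lborel)"
proof -
  have "(\<integral>t\<in>{0..}. exp (- 2 * t / T) * (cmod (evo V t n))\<^sup>2 \<partial>lborel) = (\<integral>t. (cmod (damped (1 / T) n t))\<^sup>2 \<partial>lborel)"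
    unfolding set_lebesgue_integral_def
  proof (rule integral_cong_AE)
    have "AE t in lborel. t \<noteq> (0::real)" by (rule AE_lborel_singleton)
    thus "AE t in lborel. indicator {0..} t *\<^sub>R (exp (- 2 * t / T) * (cmod (evo V t n))\<^sup>2) = (cmod (damped (1 / T) n t))\<^sup>2"
      by eventually_elim (auto simp: damped_square indicator_def)
  qed measurable
  thus ?thesis by (simp add: aa_def)
qed

lemma aa_nonneg: "T > 0 \<Longrightarrow> aa V n T \<ge> 0"
  by (simp add: aa_eq)

text \<open>The weight makes the evolution grow at the rate \<open>2 * (r - 1) = 1 / T\<close>, half
  of the damping rate \<open>2 / T\<close>; \<open>r\<close> is chosen so. The integral over time is
  then finite and of order \<open>T\<close>, which the prefactor \<open>2 / T\<close>
  cancels.\<close>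

lemma weighted_aa_sum_le:
  assumes T: "T > 0" and F: "finite F"
  defines "r \<equiv> 1 + 1 / (2 * T)"
  shows "(\<Sum>n\<in>F. r ^ nat \<bar>n\<bar> * aa V n T) \<le> 2 * r"
proof -
  define \<epsilon> where "\<epsilon> = 1 / T"
  have \<epsilon>: "\<epsilon> > 0" using T by (simp add: \<epsilon>_def)
  have r: "r \<ge> 1" "2 * (r - 1) = \<epsilon>" using T by (simp_all add: r_def \<epsilon>_def)
  have "(\<Sum>n\<in>F. r ^ nat \<bar>n\<bar> * aa V n T) = 2 / T * (\<Sum>n\<in>F. \<integral>t. r ^ nat \<bar>n\<bar> * (cmod (damped \<epsilon> n t))\<^sup>2 \<partial>lborel)"
    by (simp add: aa_eq[OF T] \<epsilon>_def sum_distrib_left mult_ac)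
  also have "(\<Sum>n\<in>F. \<integral>t. r ^ nat \<bar>n\<bar> * (cmod (damped \<epsilon> n t))\<^sup>2 \<partial>lborel)
      = (\<integral>t. (\<Sum>n\<in>F. r ^ nat \<bar>n\<bar> * (cmod (damped \<epsilon> n t))\<^sup>2) \<partial>lborel)"
    by (rule Bochner_Integration.integral_sum[symmetric]) (intro integrable_mult_right damped_square_integrable \<epsilon>)
  also have "\<dots> \<le> (\<integral>t. r * (indicator {0<..} t * exp (- \<epsilon> * t)) \<partial>lborel)"
  proof (rule integral_mono)
    show "integrable lborel (\<lambda>t. \<Sum>n\<in>F. r ^ nat \<bar>n\<bar> * (cmod (damped \<epsilon> n t))\<^sup>2)"
      by (intro Bochner_Integration.integrable_sum integrable_mult_right damped_square_integrable \<epsilon>)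
    show "integrable lborel (\<lambda>t. r * (indicator {0<..} t * exp (- \<epsilon> * t)))"
      by (intro integrable_mult_right integrable_exp_half_line \<epsilon>)
    fix t :: real
    show "(\<Sum>n\<in>F. r ^ nat \<bar>n\<bar> * (cmod (damped \<epsilon> n t))\<^sup>2) \<le> r * (indicator {0<..} t * exp (- \<epsilon> * t))"
    proof (cases "t > 0")
      case True
      have "(\<Sum>n\<in>F. r ^ nat \<bar>n\<bar> * (cmod (damped \<epsilon> n t))\<^sup>2) = exp (- 2 * \<epsilon> * t) * (\<Sum>n\<in>F. r ^ nat \<bar>n\<bar> * (cmod (evo V t n))\<^sup>2)"
        using True by (simp add: damped_square sum_distrib_left mult_ac)
      also have "\<dots> \<le> exp (- 2 * \<epsilon> * t) * (r * exp (\<epsilon> * t))"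
        using weighted_evolution_bound[OF r(1), of t F] True F r(2) by (intro mult_left_mono) auto
      also have "\<dots> = r * exp (- \<epsilon> * t)"
      proof -
        have "exp (- 2 * \<epsilon> * t) * exp (\<epsilon> * t) = exp (- \<epsilon> * t)" unfolding exp_add[symmetric] by simp
        thus ?thesis by (simp only: mult.left_commute)
      qed
      finally show ?thesis using True by simp
    qed (simp add: damped_def)
  qed
  also have "\<dots> = r * T" using integral_exp_half_line[OF \<epsilon>] by (simp add: \<epsilon>_def)
  finally show ?thesis using T by (simp add: divide_right_mono mult_left_mono)
qed

lemma aa_sum_le:
  assumes T: "T \<ge> 1" and F: "finite F"
  shows "(\<Sum>n\<in>F. aa V n T) \<le> 3"
proof -
  have "(\<Sum>n\<in>F. aa V n T) \<le> (\<Sum>n\<in>F. (1 + 1 / (2 * T)) ^ nat \<bar>n\<bar> * aa V n T)"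
  proof (intro sum_mono)
    fix n
    have "1 * aa V n T \<le> (1 + 1 / (2 * T)) ^ nat \<bar>n\<bar> * aa V n T"
      using T by (intro mult_right_mono one_le_power aa_nonneg) auto
    thus "aa V n T \<le> (1 + 1 / (2 * T)) ^ nat \<bar>n\<bar> * aa V n T" by simp
  qed
  also have "\<dots> \<le> 2 * (1 + 1 / (2 * T))" using T F by (intro weighted_aa_sum_le) auto
  also have "\<dots> \<le> 3" using T by (simp add: field_simps)
  finally show ?thesis .
qed

lemma aa_summable: "T \<ge> 1 \<Longrightarrow> (\<lambda>n. aa V n T) summable_on A"
  by (rule nonneg_bdd_above_summable_on)
     (auto simp: bdd_above_def intro!: aa_nonneg exI[of _ 3] aa_sum_le)

lemma Pout_le_of_finite_sums:
  assumes "T \<ge> 1" "\<And>F. finite F \<Longrightarrow> F \<subseteq> {n. real_of_int \<bar>n\<bar> > N} \<Longrightarrow> (\<Sum>n\<in>F. aa V n T) \<le> b"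
  shows "Pout V N T \<le> b"
  unfolding Pout_def using assms by (intro infsum_le_finite_sums aa_summable) auto

section \<open>Positivity of the outside probabilities\<close>

lemma evo_eq_0_of_aa_eq_0:
  assumes T: "T > 0" and aa: "aa V n T = 0" and t: "t > 0"
  shows "evo V t n = 0"
proof (rule ccontr)
  assume ne: "evo V t n \<noteq> 0"
  let ?f = "\<lambda>s. (cmod (damped (1 / T) n s))\<^sup>2"
  have "(\<integral>s. ?f s \<partial>lborel) = 0" using aa T by (simp add: aa_eq)
  hence "AE s in lborel. ?f s = 0"
    using integral_nonneg_eq_0_iff_AE[OF damped_square_integrable[of "1 / T" n]] T by simp
  moreover have "isCont ?f t" using t by (intro continuous_intros isCont_damped) auto
  moreover have "?f t > 0" using ne t by (simp add: damped_def)
  ultimately have "\<exists>d>0. \<forall>s. \<bar>s - t\<bar> < d \<longrightarrow> ?f s > 0"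
    by (metis (mono_tags, lifting) continuous_at_eps_delta dist_real_def abs_diff_less_iff diff_self)
  then obtain d where d: "d > 0" "\<And>s. \<bar>s - t\<bar> < d \<Longrightarrow> ?f s > 0" by blast
  have "AE s in lborel. s \<notin> {t<..<t + d}"
    using \<open>AE s in lborel. ?f s = 0\<close>
  proof eventually_elim
    case (elim s)
    thus ?case using d(2)[of s] by auto
  qed
  hence "emeasure lborel {t<..<t + d} = 0"
    using AE_iff_null_sets[of "{t<..<t + d}" lborel] by (auto simp: null_sets_def)
  thus False using d(1) by simp
qed

text \<open>If the evolution vanishes on two adjacent sites, the equation of motion forces it to vanish on the next one.\<close>

lemma aa_pos_beyond:
  assumes T: "T > 0"
  shows "\<exists>n>N. aa V n T > 0"
proof (rule ccontr)
  assume "\<not> ?thesis"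
  hence zero: "evo V t n = 0" if "n > N" "t > 0" for n t
    using evo_eq_0_of_aa_eq_0[OF T _ that(2), of n] aa_nonneg[OF T, of n] that(1)
    by (metis less_eq_real_def)
  \<comment> \<open>A walk to the left, starting at or beyond site \<open>1\<close> thanks to
    \<open>max N 0\<close>. After \<open>nat (max N 0)\<close> steps it reaches site
    \<open>1\<close>, where vanishing at all positive times contradicts continuity and the initial
    value 1.\<close>
  have "\<forall>t>0. evo V t (max N 0 + 1 - int k) = 0 \<and> evo V t (max N 0 + 2 - int k) = 0" for k
  proof (induction k)
    case 0
    show ?case using zero by simp
  next
    case (Suc k)
    let ?n = "max N 0 + 1 - int k"
    have "evo V t (?n - 1) = 0" if t: "t > 0" for t
    proof -
      have "((\<lambda>t. evo V t ?n) has_vector_derivative 0) (at t)"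
      proof (rule has_vector_derivative_transform_within_open[of "\<lambda>_. 0"])
        show "open {0::real<..}" "t \<in> {0<..}" using t by auto
        show "0 = evo V s ?n" if "s \<in> {0<..}" for s using Suc that by simp
      qed simp
      hence "- \<i> * Hop V (evo V t) ?n = 0"
        using evo_has_derivative vector_derivative_unique_at by blast
      thus ?thesis using Suc t by (simp add: Hop_def algebra_simps)
    qed
    thus ?case using Suc by (simp add: algebra_simps)
  qed
  from this[of "nat (max N 0)"] have v: "evo V t 1 = 0" if "t > 0" for t using that by simp
  have "((\<lambda>t. evo V t 1) \<longlongrightarrow> evo V 0 1) (at_right 0)"
    using has_vector_derivative_continuous[OF evo_has_derivative, of 0 1]
    by (simp add: isCont_def filterlim_at_split)
  moreover have "((\<lambda>t. evo V t 1) \<longlongrightarrow> 0) (at_right 0)"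
    by (rule tendsto_eventually) (use v in \<open>auto simp: eventually_at_right_field intro: exI[of _ 1]\<close>)
  ultimately have "evo V 0 1 = 0" using tendsto_unique trivial_limit_at_right_real by blast
  thus False by (simp add: evo_0 delta_def)
qed

lemma Pout_pos:
  assumes "T \<ge> 1"
  shows "Pout V N T > 0"
proof -
  obtain n where n: "n > \<bar>\<lceil>N\<rceil>\<bar>" "aa V n T > 0" using aa_pos_beyond[of T "\<bar>\<lceil>N\<rceil>\<bar>"] assms by auto
  have "real_of_int \<bar>n\<bar> > N" using n(1) by linarith
  hence "(\<Sum>n\<in>{n}. aa V n T) \<le> Pout V N T"
    unfolding Pout_def using assms by (intro finite_sum_le_infsum aa_summable) (auto intro: aa_nonneg)
  thus ?thesis using n(2) by simp
qed

text \<open>The prefactor is \<open>2 / T\<close> from the time average times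
  \<open>1 / (2 * pi)\<close> from \<open>plancherel_le\<close>.\<close>

lemma aa_sum_le_energy:
  assumes T: "T > 0" and F: "finite F"
  shows "ennreal (\<Sum>n\<in>F. aa V n T)
     \<le> ennreal (1 / (pi * T)) * (\<integral>\<^sup>+x. ennreal (\<Sum>n\<in>F. (cmod (laplace_evo (1 / T) x n))\<^sup>2) \<partial>lborel)"
proof -
  define \<epsilon> where "\<epsilon> = 1 / T"
  have \<epsilon>: "\<epsilon> > 0" using T by (simp add: \<epsilon>_def)
  have le: "ennreal (aa V n T) \<le> ennreal (1 / (pi * T)) * (\<integral>\<^sup>+x. ennreal ((cmod (laplace_evo \<epsilon> x n))\<^sup>2) \<partial>lborel)" for n
  proof -
    have eq: "aa V n T = 1 / (pi * T) * (2 * pi * (\<integral>t. (cmod (damped \<epsilon> n t))\<^sup>2 \<partial>lborel))"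
      using T by (simp add: aa_eq \<epsilon>_def)
    have "ennreal (aa V n T) = ennreal (1 / (pi * T)) * ennreal (2 * pi * (\<integral>t. (cmod (damped \<epsilon> n t))\<^sup>2 \<partial>lborel))"
      unfolding eq by (rule ennreal_mult') (use T in simp)
    also have "\<dots> \<le> ennreal (1 / (pi * T)) * (\<integral>\<^sup>+x. ennreal ((cmod (laplace_evo \<epsilon> x n))\<^sup>2) \<partial>lborel)"
      unfolding laplace_evo_def
      by (intro mult_left_mono plancherel_le damped_integrable damped_le_1 isCont_damped \<epsilon>) auto
    finally show ?thesis .
  qed
  have "ennreal (\<Sum>n\<in>F. aa V n T) = (\<Sum>n\<in>F. ennreal (aa V n T))"
    by (rule sum_ennreal[symmetric]) (auto intro: aa_nonneg T)
  also have "\<dots> \<le> (\<Sum>n\<in>F. ennreal (1 / (pi * T)) * (\<integral>\<^sup>+x. ennreal ((cmod (laplace_evo \<epsilon> x n))\<^sup>2) \<partial>lborel))"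
    by (intro sum_mono le)
  also have "\<dots> = ennreal (1 / (pi * T)) * (\<integral>\<^sup>+x. (\<Sum>n\<in>F. ennreal ((cmod (laplace_evo \<epsilon> x n))\<^sup>2)) \<partial>lborel)"
    by (subst nn_integral_sum) (auto simp: sum_distrib_left)
  also have "(\<lambda>x. \<Sum>n\<in>F. ennreal ((cmod (laplace_evo \<epsilon> x n))\<^sup>2)) = (\<lambda>x. ennreal (\<Sum>n\<in>F. (cmod (laplace_evo \<epsilon> x n))\<^sup>2))"
    by (intro ext sum_ennreal) auto
  finally show ?thesis by (simp add: \<epsilon>_def)
qed

end

section \<open>Integrals of the reciprocal maximal transfer norm\<close>

lemma continuous_on_Max_image:
  fixes f :: "'i \<Rightarrow> 'a::topological_space \<Rightarrow> real"
  assumes "finite S" "S \<noteq> {}" "\<And>i. i \<in> S \<Longrightarrow> continuous_on A (f i)"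
  shows "continuous_on A (\<lambda>x. Max ((\<lambda>i. f i x) ` S))"
  using assms
proof (induction S rule: finite_ne_induct)
  case (insert i S)
  have "(\<lambda>x. Max ((\<lambda>i. f i x) ` insert i S)) = (\<lambda>x. max (f i x) (Max ((\<lambda>i. f i x) ` S)))"
    using insert by simp
  thus ?case using insert by (auto intro!: continuous_on_max)
qed simp

definition inv_max_transfer :: "(int \<Rightarrow> real) \<Rightarrow> int set \<Rightarrow> complex \<Rightarrow> real" where
  "inv_max_transfer V S z = inverse (Max ((\<lambda>n. (mnorm (Phi V n z))\<^sup>2) ` S))"

lemma Max_transfer_pos:
  assumes "finite S" "S \<noteq> {}"
  shows "Max ((\<lambda>n. (mnorm (Phi V n z))\<^sup>2) ` S) > 0"
proof -
  obtain n where "n \<in> S" using assms by blast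
  hence "(mnorm (Phi V n z))\<^sup>2 \<le> Max ((\<lambda>n. (mnorm (Phi V n z))\<^sup>2) ` S)" using assms by (intro Max_ge) auto
  moreover have "(mnorm (Phi V n z))\<^sup>2 > 0" using mnorm_Phi_gt_0[of V n z] by simp
  ultimately show ?thesis by linarith
qed

lemma inv_max_transfer_nonneg: "finite S \<Longrightarrow> S \<noteq> {} \<Longrightarrow> inv_max_transfer V S z \<ge> 0"
  unfolding inv_max_transfer_def using Max_transfer_pos[of S V z] by simp

text \<open>Continuity guarantees that the gauge integral over \<open>[-K, K]\<close> is a genuine
  one, rather than the default value 0 of a non-integrable function, and that it agrees with the
  Lebesgue integral.\<close>

lemma continuous_on_inv_max_transfer:
  assumes "finite S" "S \<noteq> {}" "continuous_on A f"
  shows "continuous_on A (\<lambda>x. inv_max_transfer V S (f x))"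
  unfolding inv_max_transfer_def
proof (rule continuous_on_inverse)
  have "continuous_on A (\<lambda>x. (mnorm (Phi V n (f x)))\<^sup>2)" for n
    by (intro continuous_intros continuous_on_compose2[OF continuous_on_mnorm[of UNIV] continuous_on_Phi] assms) auto
  thus "continuous_on A (\<lambda>x. Max ((\<lambda>n. (mnorm (Phi V n (f x)))\<^sup>2) ` S))"
    by (intro continuous_on_Max_image assms)
  show "\<forall>x\<in>A. Max ((\<lambda>n. (mnorm (Phi V n (f x)))\<^sup>2) ` S) \<noteq> 0"
    using Max_transfer_pos[OF assms(1,2), of V] by (metis less_irrefl)
qed

lemma nn_integral_indicator_interval:
  fixes f :: "real \<Rightarrow> real"
  assumes f: "continuous_on UNIV f" "\<And>x. f x \<ge> 0"
  shows "(\<integral>\<^sup>+x. ennreal (indicator {a..b} x * f x) \<partial>lborel) = ennreal (integral {a..b} f)"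
proof (rule nn_integral_has_integral_lborel)
  have [measurable]: "f \<in> borel_measurable borel" by (rule borel_measurable_continuous_onI[OF f(1)])
  show "(\<lambda>x. indicator {a..b} x * f x) \<in> borel_measurable borel" by measurable
  show "0 \<le> indicator {a..b} x * f x" for x using f(2) by simp
  have "(f has_integral integral {a..b} f) {a..b}"
    by (intro integrable_integral integrable_continuous_real continuous_on_subset[OF f(1)]) auto
  hence "((\<lambda>x. if x \<in> {a..b} then f x else 0) has_integral integral {a..b} f) UNIV"
    unfolding has_integral_restrict_UNIV .
  moreover have "(\<lambda>x. if x \<in> {a..b} then f x else 0) = (\<lambda>x. indicator {a..b} x * f x)" by (auto simp: indicator_def)
  ultimately show "((\<lambda>x. indicator {a..b} x * f x) has_integral integral {a..b} f) UNIV" by simp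
qed

lemma nn_integral_inverse_1_plus_square: "(\<integral>\<^sup>+x. ennreal (inverse (1 + x\<^sup>2)) \<partial>lborel) = ennreal pi"
proof -
  have e: "einterval (-\<infinity>) \<infinity> = UNIV" by (auto simp: einterval_def)
  have "integrable lborel (\<lambda>x::real. inverse (1 + x\<^sup>2))"
    using integrable_inverse_1_plus_square by (simp add: set_integrable_def e)
  moreover have "(\<integral>x. inverse (1 + x\<^sup>2) \<partial>lborel) = pi"
    using LBINT_inverse_1_plus_square by (simp add: interval_lebesgue_integral_def set_lebesgue_integral_def e)
  ultimately show ?thesis by (subst nn_integral_eq_integral) auto
qed

context bounded_potential begin

text \<open>The cut is made at the site up to \<open>R\<close> where the transfer matrix is largest.
  The set \<open>F\<close> lies beyond \<open>R\<close> and hence beyond the cut, wherever that is.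
  The bound \<open>R \<ge> 3\<close> makes the set of candidates nonempty.\<close>

lemma laplace_evo_tail_right:
  fixes x T R :: real
  assumes T: "T \<ge> 1" and x: "\<bar>x\<bar> \<le> K" and R: "R \<ge> 3" and F: "finite F" "\<And>n. n \<in> F \<Longrightarrow> real_of_int n > R"
  shows "(\<Sum>n\<in>F. (cmod (laplace_evo (1 / T) x n))\<^sup>2)
    \<le> 2 * ((K + B + 2)\<^sup>2 + 1) * T ^ 4 * inv_max_transfer V {n. 3 \<le> n \<and> real_of_int n \<le> R} (of_real x + \<i> / of_real T)"
proof -
  define z where "z = complex_of_real x + \<i> * of_real (1 / T)"
  have z_eq: "of_real x + \<i> / of_real T = z" by (simp add: z_def)
  let ?S = "{n::int. 3 \<le> n \<and> real_of_int n \<le> R}" and ?s = "\<Sum>n\<in>F. (cmod (laplace_evo (1 / T) x n))\<^sup>2"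
  have "?S \<subseteq> {3..\<lfloor>R\<rfloor>}" by (auto simp: le_floor_iff)
  hence fin: "finite ?S" by (rule finite_subset) simp
  have "(3::int) \<in> ?S" using R by simp
  hence ne: "?S \<noteq> {}" by blast
  define M where "M = Max ((\<lambda>n. (mnorm (Phi V n z))\<^sup>2) ` ?S)"
  have M: "M > 0" unfolding M_def by (rule Max_transfer_pos[OF fin ne])
  have "M \<in> (\<lambda>n. (mnorm (Phi V n z))\<^sup>2) ` ?S" unfolding M_def using fin ne by (intro Max_in) auto
  then obtain n where n: "n \<in> ?S" "M = (mnorm (Phi V n z))\<^sup>2" by blast
  define k where "k = nat n"
  have k: "k \<ge> 1" "int k = n" using n(1) by (auto simp: k_def)
  have "M = (mnorm (Phi_pos V k z))\<^sup>2" using n by (simp add: Phi_def k_def)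
  hence "M * ?s = (mnorm (Phi_pos V k z))\<^sup>2 * ?s" by simp
  also have "\<dots> \<le> 2 * ((cmod z + B + 1)\<^sup>2 + 1) / (1 / T) ^ 4"
    unfolding z_def
  proof (rule right_tail_bound[OF _ k(1) F(1)])
    show "m > int k" if "m \<in> F" for m using F(2)[OF that] n(1) k(2) by auto
  qed (use T in auto)
  also have "\<dots> \<le> 2 * ((K + B + 2)\<^sup>2 + 1) / (1 / T) ^ 4"
  proof -
    have "cmod z \<le> cmod (complex_of_real x) + cmod (\<i> * of_real (1 / T))" unfolding z_def by (rule norm_triangle_ineq)
    moreover have "cmod (\<i> * of_real (1 / T)) \<le> 1" using T by (simp add: norm_mult norm_divide)
    moreover have "cmod (complex_of_real x) \<le> K" using x by simp
    ultimately have "cmod z \<le> K + 1" by linarith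
    thus ?thesis using T B_nonneg by (intro divide_right_mono mult_left_mono add_right_mono power_mono) auto
  qed
  also have "\<dots> = 2 * ((K + B + 2)\<^sup>2 + 1) * T ^ 4" by (simp add: power_divide)
  finally have "?s \<le> 2 * ((K + B + 2)\<^sup>2 + 1) * T ^ 4 / M" using M by (simp add: pos_le_divide_eq mult.commute)
  thus ?thesis unfolding z_eq inv_max_transfer_def M_def[symmetric] by (simp add: divide_inverse)
qed

lemma laplace_evo_tail_left:
  fixes x T R :: real
  assumes T: "T \<ge> 1" and x: "\<bar>x\<bar> \<le> K" and R: "R \<ge> 3" and F: "finite F" "\<And>n. n \<in> F \<Longrightarrow> real_of_int (- n) > R"
  shows "(\<Sum>n\<in>F. (cmod (laplace_evo (1 / T) x n))\<^sup>2)
    \<le> 2 * ((K + B + 2)\<^sup>2 + 1) * T ^ 4 * inv_max_transfer V {n. 3 \<le> - n \<and> real_of_int (- n) \<le> R} (of_real x + \<i> / of_real T)"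
proof -
  define z where "z = complex_of_real x + \<i> * of_real (1 / T)"
  have z_eq: "of_real x + \<i> / of_real T = z" by (simp add: z_def)
  let ?S = "{n::int. 3 \<le> - n \<and> real_of_int (- n) \<le> R}" and ?s = "\<Sum>n\<in>F. (cmod (laplace_evo (1 / T) x n))\<^sup>2"
  have "?S \<subseteq> {- \<lfloor>R\<rfloor>..-3}" by (auto simp: le_floor_iff minus_le_iff[of "\<lfloor>R\<rfloor>"])
  hence fin: "finite ?S" by (rule finite_subset) simp
  have "(-3::int) \<in> ?S" using R by simp
  hence ne: "?S \<noteq> {}" by blast
  define M where "M = Max ((\<lambda>n. (mnorm (Phi V n z))\<^sup>2) ` ?S)"
  have M: "M > 0" unfolding M_def by (rule Max_transfer_pos[OF fin ne])
  have "M \<in> (\<lambda>n. (mnorm (Phi V n z))\<^sup>2) ` ?S" unfolding M_def using fin ne by (intro Max_in) auto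
  then obtain n where n: "n \<in> ?S" "M = (mnorm (Phi V n z))\<^sup>2" by blast
  define k where "k = nat (- n)"
  have k: "k \<ge> 1" "int k = - n" using n(1) by (auto simp: k_def)
  have "M = (mnorm (Phi_neg V k z))\<^sup>2" using n by (simp add: Phi_def k_def)
  hence "M * ?s = (mnorm (Phi_neg V k z))\<^sup>2 * ?s" by simp
  also have "\<dots> \<le> 2 * ((cmod z + B + 1)\<^sup>2 + 1) / (1 / T) ^ 4"
    unfolding z_def
  proof (rule left_tail_bound[OF _ k(1) F(1)])
    show "m \<le> - int k" if "m \<in> F" for m using F(2)[OF that] n(1) k(2) by auto
  qed (use T in auto)
  also have "\<dots> \<le> 2 * ((K + B + 2)\<^sup>2 + 1) / (1 / T) ^ 4"
  proof -
    have "cmod z \<le> cmod (complex_of_real x) + cmod (\<i> * of_real (1 / T))" unfolding z_def by (rule norm_triangle_ineq)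
    moreover have "cmod (\<i> * of_real (1 / T)) \<le> 1" using T by (simp add: norm_mult norm_divide)
    moreover have "cmod (complex_of_real x) \<le> K" using x by simp
    ultimately have "cmod z \<le> K + 1" by linarith
    thus ?thesis using T B_nonneg by (intro divide_right_mono mult_left_mono add_right_mono power_mono) auto
  qed
  also have "\<dots> = 2 * ((K + B + 2)\<^sup>2 + 1) * T ^ 4" by (simp add: power_divide)
  finally have "?s \<le> 2 * ((K + B + 2)\<^sup>2 + 1) * T ^ 4 / M" using M by (simp add: pos_le_divide_eq mult.commute)
  thus ?thesis unfolding z_eq inv_max_transfer_def M_def[symmetric] by (simp add: divide_inverse)
qed

end

section \<open>Transport exponents\<close>

lemma ereal_Limsup_le_of_reals:
  fixes f :: "'a \<Rightarrow> ereal"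
  assumes "\<And>y. y > a \<Longrightarrow> \<forall>\<^sub>F x in F. f x \<le> ereal y"
  shows "Limsup F f \<le> ereal a"
  unfolding Limsup_le_iff
proof (intro allI impI)
  fix y assume "y > ereal a"
  then obtain b where b: "ereal a < ereal b" "ereal b < y" using ereal_dense2 by blast
  from assms[of b] b show "\<forall>\<^sub>F x in F. y > f x"
    by (auto elim!: eventually_mono intro: le_less_trans)
qed

lemma powr_le_exp:
  fixes x q :: real
  assumes "x \<ge> 0" "q > 0"
  shows "x powr q \<le> q powr q * exp x"
proof -
  have "x / q \<le> exp (x / q)" using exp_ge_add_one_self[of "x / q"] by linarith
  hence "(x / q) powr q \<le> exp (x / q) powr q" using assms by (intro powr_mono2) auto
  also have "\<dots> = exp x" using assms by (simp add: exp_powr_real)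
  finally have "q powr q * (x / q) powr q \<le> q powr q * exp x" by (rule mult_left_mono) simp
  moreover have "q powr q * (x / q) powr q = x powr q"
    using assms powr_mult[of q "x / q" q] by simp
  ultimately show ?thesis by simp
qed

text \<open>For \<open>y = 1 / (4 * T) \<le> 1\<close> one has
  \<open>exp y \<le> 1 + y + y ^ 2 \<le> 1 + 2 * y\<close>. This links polynomial moments, dominated
  by an exponential, with the weights of \<open>weighted_aa_sum_le\<close>.\<close>

lemma exp_le_one_plus:
  fixes T :: real
  assumes "T \<ge> 1"
  shows "exp (real_of_int \<bar>n\<bar> / (4 * T)) \<le> (1 + 1 / (2 * T)) ^ nat \<bar>n\<bar>"
proof -
  define y where "y = 1 / (4 * T)"
  have y: "0 \<le> y" "y \<le> 1" using assms by (auto simp: y_def divide_le_eq)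
  have "exp y \<le> 1 + y + y\<^sup>2" using y by (intro exp_bound) auto
  also have "y\<^sup>2 \<le> y" using y by (simp add: power2_eq_square mult_left_le)
  finally have e: "exp y \<le> 1 + 1 / (2 * T)" using assms by (simp add: y_def field_simps)
  have "exp (real_of_int \<bar>n\<bar> / (4 * T)) = exp y ^ nat \<bar>n\<bar>"
    by (simp add: y_def exp_of_nat_mult[symmetric])
  also have "\<dots> \<le> (1 + 1 / (2 * T)) ^ nat \<bar>n\<bar>" by (rule power_mono[OF e]) simp
  finally show ?thesis .
qed

context bounded_potential begin

text \<open>The energies are split at \<open>\<bar>x\<bar> = K\<close>. Inside, \<open>T ^ 4\<close>
  from the tail bounds and \<open>1 / T\<close> from Plancherel combine to \<open>T ^ 3\<close>.
  Outside, the Combes-Thomas bound is dominated by a multiple of \<open>inverse (1 + x ^ 2)\<close>,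
  whose integral \<open>pi\<close> cancels against the prefactor.\<close>

lemma Pout_le_transfer_integrals:
  fixes K T R N :: real
  assumes nr: "\<And>f. f \<in> ell2 \<Longrightarrow> \<bar>ip f (Hop V f)\<bar> \<le> (K - 1) * ip f f"
    and K: "K \<ge> 1" and T: "T \<ge> 1" and R: "R \<ge> 3" and N: "N \<ge> R"
  shows "Pout V N T \<le> 2 * ((K + B + 2)\<^sup>2 + 1) * T ^ 3 *
       (integral {-K..K} (\<lambda>x. inv_max_transfer V {n. 3 \<le> n \<and> real_of_int n \<le> R} (of_real x + \<i> / of_real T))
      + integral {-K..K} (\<lambda>x. inv_max_transfer V {n. 3 \<le> - n \<and> real_of_int (- n) \<le> R} (of_real x + \<i> / of_real T)))
      + 18 * K\<^sup>2 * (4/9) ^ nat \<lfloor>R\<rfloor>"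
proof -
  let ?P = "{n::int. 3 \<le> n \<and> real_of_int n \<le> R}" and ?M = "{n::int. 3 \<le> - n \<and> real_of_int (- n) \<le> R}"
  define p where "p = (\<lambda>x. inv_max_transfer V ?P (of_real x + \<i> / of_real T))"
  define m where "m = (\<lambda>x. inv_max_transfer V ?M (of_real x + \<i> / of_real T))"
  have "?P \<subseteq> {3..\<lfloor>R\<rfloor>}" by (auto simp: le_floor_iff)
  hence P: "finite ?P" by (rule finite_subset) simp
  have "?M \<subseteq> {- \<lfloor>R\<rfloor>..-3}" by (auto simp: le_floor_iff minus_le_iff[of "\<lfloor>R\<rfloor>"])
  hence M: "finite ?M" by (rule finite_subset) simp
  have "(3::int) \<in> ?P" "(-3::int) \<in> ?M" using R by auto
  hence P': "?P \<noteq> {}" and M': "?M \<noteq> {}" by blast+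
  have p0: "p x \<ge> 0" and m0: "m x \<ge> 0" for x
    unfolding p_def m_def by (intro inv_max_transfer_nonneg P P' M M')+
  have pc: "continuous_on S p" and mc: "continuous_on S m" for S
    unfolding p_def m_def by (intro continuous_on_inv_max_transfer P P' M M' continuous_intros)+
  define A where "A = 2 * ((K + B + 2)\<^sup>2 + 1)"
  have A0: "A \<ge> 0" by (simp add: A_def)
  define q where "q = (4/9 :: real) ^ nat \<lfloor>R\<rfloor>"
  have q0: "q \<ge> 0" by (simp add: q_def)
  define I where "I = integral {-K..K} p + integral {-K..K} m"
  have I0: "I \<ge> 0"
    unfolding I_def by (intro add_nonneg_nonneg Henstock_Kurzweil_Integration.integral_nonneg integrable_continuous_real pc mc p0 m0)
  have "Pout V N T \<le> A * T ^ 3 * I + 18 * K\<^sup>2 * q"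
  proof (rule Pout_le_of_finite_sums[OF T])
    fix F assume F: "finite F" "F \<subseteq> {n. real_of_int \<bar>n\<bar> > N}"
    let ?s = "\<lambda>x F. \<Sum>n\<in>F. (cmod (laplace_evo (1 / T) x n))\<^sup>2"
    define g1 where "g1 = (\<lambda>x. A * T ^ 4 * (p x + m x))"
    have g1c: "continuous_on UNIV g1" unfolding g1_def by (intro continuous_intros pc mc)
    have g10: "g1 x \<ge> 0" for x unfolding g1_def using A0 T p0 m0 by simp
    have g1m[measurable]: "g1 \<in> borel_measurable borel" by (rule borel_measurable_continuous_onI[OF g1c])
    have bound: "?s x F \<le> indicator {-K..K} x * g1 x + 18 * K\<^sup>2 * q * inverse (1 + x\<^sup>2)" for x
    proof (cases "\<bar>x\<bar> \<le> K")
      case True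
      let ?F1 = "{n\<in>F. n > 0}" and ?F2 = "{n\<in>F. \<not> n > 0}"
      have "?s x F = ?s x (?F1 \<union> ?F2)" by (rule arg_cong[of _ _ "?s x"]) auto
      also have "\<dots> = ?s x ?F1 + ?s x ?F2" using F(1) by (intro sum.union_disjoint) auto
      also have "?s x ?F1 \<le> A * T ^ 4 * p x"
        unfolding A_def p_def by (rule laplace_evo_tail_right[OF T True R]) (use F N in auto)
      also have "?s x ?F2 \<le> A * T ^ 4 * m x"
        unfolding A_def m_def by (rule laplace_evo_tail_left[OF T True R]) (use F N in auto)
      also have "A * T ^ 4 * p x + A * T ^ 4 * m x = indicator {-K..K} x * g1 x"
        using True by (simp add: g1_def distrib_left abs_le_iff indicator_def minus_le_iff)
      finally have "?s x F \<le> indicator {-K..K} x * g1 x" by (simp add: add_mono)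
      moreover have "0 \<le> 18 * K\<^sup>2 * q * inverse (1 + x\<^sup>2)" using q0 by (intro mult_nonneg_nonneg) auto
      ultimately show ?thesis by linarith
    next
      case False
      hence x: "\<bar>x\<bar> \<ge> K" by simp
      have "?s x F \<le> q * (9 / 4 / (\<bar>x\<bar> - K + 1/2)\<^sup>2)"
        unfolding q_def
      proof (rule laplace_evo_tail_outside[OF nr x _ F(1)])
        show "nat \<lfloor>R\<rfloor> \<le> nat \<bar>n\<bar>" if "n \<in> F" for n
        proof -
          have "real_of_int \<bar>n\<bar> > R" using F(2) N that by auto
          thus ?thesis by linarith
        qed
      qed (use T in auto)
      also have "\<dots> \<le> q * (18 * K\<^sup>2 * inverse (1 + x\<^sup>2))"
      proof (rule mult_left_mono[OF _ q0])
        \<comment> \<open>Origin of the constant 18: this inequality bounds \<open>x ^ 2\<close> by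
          \<open>4 * K ^ 2\<close> times the squared denominator,
          \<open>1 + x ^ 2 \<le> 2 * x ^ 2\<close> doubles it, and \<open>9/4\<close> is the
          Combes-Thomas constant.\<close>
        have "(2 * K - 1) * (\<bar>x\<bar> - K) \<ge> 0" using K x by simp
        hence a: "\<bar>x\<bar> \<le> 2 * K * (\<bar>x\<bar> - K + 1/2)" by (simp add: algebra_simps)
        have "x\<^sup>2 = \<bar>x\<bar>\<^sup>2" by simp
        also have "\<dots> \<le> (2 * K * (\<bar>x\<bar> - K + 1/2))\<^sup>2" by (intro power_mono a) simp
        also have "\<dots> = 4 * (K\<^sup>2 * (\<bar>x\<bar> - K + 1/2)\<^sup>2)" by (simp add: power_mult_distrib)
        finally have b: "x\<^sup>2 \<le> 4 * (K\<^sup>2 * (\<bar>x\<bar> - K + 1/2)\<^sup>2)" .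
        have "1 \<le> x\<^sup>2" using x K one_le_power[of "\<bar>x\<bar>" 2] by simp
        hence "9 / 4 * (1 + x\<^sup>2) \<le> 18 / 4 * x\<^sup>2" by simp
        also have "\<dots> \<le> 18 / 4 * (4 * (K\<^sup>2 * (\<bar>x\<bar> - K + 1/2)\<^sup>2))" by (rule mult_left_mono[OF b]) simp
        finally have c: "9 / 4 * (1 + x\<^sup>2) \<le> 18 * K\<^sup>2 * (\<bar>x\<bar> - K + 1/2)\<^sup>2" by simp
        have "(\<bar>x\<bar> - K + 1/2)\<^sup>2 > 0" using x by simp
        moreover have "1 + x\<^sup>2 > 0" by (simp add: add_pos_nonneg)
        ultimately show "9 / 4 / (\<bar>x\<bar> - K + 1/2)\<^sup>2 \<le> 18 * K\<^sup>2 * inverse (1 + x\<^sup>2)"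
          using c unfolding divide_inverse[symmetric] by (simp only: pos_divide_le_eq pos_le_divide_eq times_divide_eq_left times_divide_eq_right)
      qed
      finally show ?thesis using g10[of x] by (simp add: mult_ac indicator_def)
    qed
    have "ennreal (\<Sum>n\<in>F. aa V n T) \<le> ennreal (1 / (pi * T)) * (\<integral>\<^sup>+x. ennreal (?s x F) \<partial>lborel)"
      using T F(1) by (intro aa_sum_le_energy) auto
    also have "(\<integral>\<^sup>+x. ennreal (?s x F) \<partial>lborel)
        \<le> (\<integral>\<^sup>+x. ennreal (indicator {-K..K} x * g1 x) + ennreal (18 * K\<^sup>2 * q) * ennreal (inverse (1 + x\<^sup>2)) \<partial>lborel)"
    proof (rule nn_integral_mono)
      fix x
      have "ennreal (?s x F) \<le> ennreal (indicator {-K..K} x * g1 x + 18 * K\<^sup>2 * q * inverse (1 + x\<^sup>2))"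
        by (rule ennreal_leI[OF bound])
      also have "\<dots> = ennreal (indicator {-K..K} x * g1 x) + ennreal (18 * K\<^sup>2 * q) * ennreal (inverse (1 + x\<^sup>2))"
        using g10[of x] q0 by (simp add: ennreal_plus ennreal_mult)
      finally show "ennreal (?s x F) \<le> ennreal (indicator {-K..K} x * g1 x) + ennreal (18 * K\<^sup>2 * q) * ennreal (inverse (1 + x\<^sup>2))" .
    qed
    also have "\<dots> = ennreal (integral {-K..K} g1) + ennreal (18 * K\<^sup>2 * q) * ennreal pi"
      by (simp add: nn_integral_add nn_integral_cmult nn_integral_inverse_1_plus_square nn_integral_indicator_interval[OF g1c g10])
    also have "integral {-K..K} g1 = A * T ^ 4 * I"
      unfolding g1_def I_def
      by (simp add: Henstock_Kurzweil_Integration.integral_add integrable_continuous_real pc mc)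
    also have "ennreal (A * T ^ 4 * I) + ennreal (18 * K\<^sup>2 * q) * ennreal pi = ennreal (A * T ^ 4 * I + 18 * K\<^sup>2 * q * pi)"
      using A0 T I0 q0 by (simp add: ennreal_plus ennreal_mult)
    also have "ennreal (1 / (pi * T)) * \<dots> = ennreal (1 / (pi * T) * (A * T ^ 4 * I + 18 * K\<^sup>2 * q * pi))"
      by (rule ennreal_mult'[symmetric]) (use T in simp)
    finally have "ennreal (\<Sum>n\<in>F. aa V n T) \<le> ennreal (1 / (pi * T) * (A * T ^ 4 * I + 18 * K\<^sup>2 * q * pi))"
      by (simp add: mult_left_mono)
    moreover have "0 \<le> 1 / (pi * T) * (A * T ^ 4 * I + 18 * K\<^sup>2 * q * pi)"
      using A0 T I0 q0 by (intro mult_nonneg_nonneg add_nonneg_nonneg) auto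
    ultimately have "(\<Sum>n\<in>F. aa V n T) \<le> 1 / (pi * T) * (A * T ^ 4 * I + 18 * K\<^sup>2 * q * pi)"
      by (simp only: ennreal_le_iff)
    also have "\<dots> = (A * T ^ 3 * I) / pi + (18 * K\<^sup>2 * q) / T"
      using T by (simp add: field_simps power4_eq_xxxx power3_eq_cube)
    also have "\<dots> \<le> (A * T ^ 3 * I) / 1 + (18 * K\<^sup>2 * q) / 1"
      using A0 T I0 q0 pi_ge_two by (intro add_mono divide_left_mono mult_nonneg_nonneg) auto
    finally show "(\<Sum>n\<in>F. aa V n T) \<le> A * T ^ 3 * I + 18 * K\<^sup>2 * q" by simp
  qed
  thus ?thesis by (simp add: A_def I_def p_def m_def q_def)
qed

end

text \<open>Here \<open>nr\<close> represents the spectral hypothesis: the spectrum enters the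
  estimates only through the numerical range.\<close>

locale transfer_decay = bounded_potential +
  fixes K C \<alpha> :: real
  assumes nr: "\<And>f. f \<in> ell2 \<Longrightarrow> \<bar>ip f (Hop V f)\<bar> \<le> (K - 1) * ip f f"
    and K: "K \<ge> 1" and C: "C > 0" and \<alpha>: "\<alpha> > 0"
    and right: "\<And>m. m \<ge> 1 \<Longrightarrow>
      (\<lambda>T. integral {-K..K} (\<lambda>x. inv_max_transfer V {n. 3 \<le> n \<and> real_of_int n \<le> C * T powr \<alpha>} (of_real x + \<i> / of_real T)))
        \<in> O[at_top](\<lambda>T. T powr (- m))"
    and left: "\<And>m. m \<ge> 1 \<Longrightarrow>
      (\<lambda>T. integral {-K..K} (\<lambda>x. inv_max_transfer V {n. 3 \<le> - n \<and> real_of_int (- n) \<le> C * T powr \<alpha>} (of_real x + \<i> / of_real T)))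
        \<in> O[at_top](\<lambda>T. T powr (- m))"
begin

lemma Pout_decay:
  assumes \<alpha>': "\<alpha>' > \<alpha>" and m: "m \<ge> 1"
  obtains c where "c > 0" "\<forall>\<^sub>F T in at_top. Pout V (T powr \<alpha>' - 2) T \<le> c * T powr (- m)"
proof -
  define Ir where "Ir = (\<lambda>T. integral {-K..K} (\<lambda>x. inv_max_transfer V {n. 3 \<le> n \<and> real_of_int n \<le> C * T powr \<alpha>} (of_real x + \<i> / of_real T)))"
  define Il where "Il = (\<lambda>T. integral {-K..K} (\<lambda>x. inv_max_transfer V {n. 3 \<le> - n \<and> real_of_int (- n) \<le> C * T powr \<alpha>} (of_real x + \<i> / of_real T)))"
  \<comment> \<open>Three additional powers pay for the factor \<open>T ^ 3\<close> in
    \<open>Pout_le_transfer_integrals\<close>.\<close>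
  have "Ir \<in> O[at_top](\<lambda>T. T powr (- (m + 3)))" unfolding Ir_def by (rule right) (use m in auto)
  then obtain c1 where c1: "c1 > 0" "\<forall>\<^sub>F T in at_top. norm (Ir T) \<le> c1 * norm (T powr (- (m + 3)))"
    by (rule landau_o.bigE)
  have "Il \<in> O[at_top](\<lambda>T. T powr (- (m + 3)))" unfolding Il_def by (rule left) (use m in auto)
  then obtain c2 where c2: "c2 > 0" "\<forall>\<^sub>F T in at_top. norm (Il T) \<le> c2 * norm (T powr (- (m + 3)))"
    by (rule landau_o.bigE)
  define A where "A = 2 * ((K + B + 2)\<^sup>2 + 1)"
  have A: "A > 0" by (simp add: A_def add_nonneg_pos)
  define c where "c = A * (c1 + c2) + 18 * K\<^sup>2"
  have c0: "c > 0" unfolding c_def using A c1(1) c2(1) by (intro add_pos_nonneg mult_pos_pos) auto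
  have e1: "\<forall>\<^sub>F T in at_top. C * T powr \<alpha> \<ge> 3" using C \<alpha> by real_asymp
  have e2: "\<forall>\<^sub>F T in at_top. T powr \<alpha>' - 2 \<ge> C * T powr \<alpha>" using C \<alpha> \<alpha>' by real_asymp
  \<comment> \<open>The Combes-Thomas term is a stretched exponential in \<open>T\<close>, smaller
    than every power. The \<open>- 1\<close> accounts for rounding down the distance
    \<open>C * T powr \<alpha>\<close>.\<close>
  have e3: "\<forall>\<^sub>F T in at_top. (4/9) powr (C * T powr \<alpha> - 1) \<le> T powr (- m)"
  proof -
    define l :: real where "l = ln (9/4)"
    have l: "l > 0" "ln (4/9 :: real) = - l" by (simp_all add: l_def ln_div)
    have "\<forall>\<^sub>F T in at_top. m * ln T \<le> l * (C * T powr \<alpha> - 1)" using C \<alpha> l(1) by real_asymp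
    thus ?thesis using eventually_gt_at_top[of 0]
    proof eventually_elim
      case (elim T)
      have "(4/9) powr (C * T powr \<alpha> - 1) = exp (- (l * (C * T powr \<alpha> - 1)))"
        by (simp add: powr_def l(2) mult.commute)
      also have "\<dots> \<le> exp (- (m * ln T))" using elim by simp
      also have "\<dots> = T powr (- m)" using elim by (simp add: powr_def)
      finally show ?case .
    qed
  qed
  have "\<forall>\<^sub>F T in at_top. Pout V (T powr \<alpha>' - 2) T \<le> c * T powr (- m)"
    using c1(2) c2(2) e1 e2 e3 eventually_ge_at_top[of 1]
  proof eventually_elim
    case (elim T)
    let ?R = "C * T powr \<alpha>"
    have "(4/9 :: real) ^ nat \<lfloor>?R\<rfloor> = (4/9) powr (real (nat \<lfloor>?R\<rfloor>))" by (simp add: powr_realpow)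
    also have "\<dots> \<le> (4/9) powr (?R - 1)"
      using elim(3) by (intro powr_mono') linarith+
    also have "\<dots> \<le> T powr (- m)" by (rule elim)
    finally have q: "(4/9 :: real) ^ nat \<lfloor>?R\<rfloor> \<le> T powr (- m)" .
    have "Pout V (T powr \<alpha>' - 2) T \<le> A * T ^ 3 * (Ir T + Il T) + 18 * K\<^sup>2 * (4/9) ^ nat \<lfloor>?R\<rfloor>"
      unfolding A_def Ir_def Il_def using elim by (intro Pout_le_transfer_integrals nr K) auto
    also have "\<dots> \<le> A * T ^ 3 * (c1 * T powr (- (m + 3)) + c2 * T powr (- (m + 3))) + 18 * K\<^sup>2 * T powr (- m)"
      using elim A q by (intro add_mono mult_left_mono) auto
    also have "A * T ^ 3 * (c1 * T powr (- (m + 3)) + c2 * T powr (- (m + 3))) = A * (c1 + c2) * (T ^ 3 * T powr (- (m + 3)))"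
      by (simp add: algebra_simps)
    also have "T ^ 3 * T powr (- (m + 3)) = T powr (- m)"
    proof -
      have "T ^ 3 = T powr 3" using elim(6) by (simp add: powr_numeral)
      hence "T ^ 3 * T powr (- (m + 3)) = T powr (3 + - (m + 3))" by (simp only: powr_add)
      thus ?thesis by simp
    qed
    finally show ?case by (simp add: c_def algebra_simps)
  qed
  thus ?thesis using c0 that by blast
qed

lemma Splus_eq_infinity:
  assumes "\<alpha>' > \<alpha>"
  shows "Splus V \<alpha>' = \<infinity>"
proof -
  let ?L = "Limsup at_top (\<lambda>T. ereal (ln (Pout V (T powr \<alpha>' - 2) T) / ln T))"
  have L: "?L \<le> ereal (- m)" if m: "m \<ge> 0" for m :: real
  proof -
    obtain c where c: "c > 0" "\<forall>\<^sub>F T in at_top. Pout V (T powr \<alpha>' - 2) T \<le> c * T powr (- (m + 1))"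
      \<comment> \<open>One power more than required, to swallow the constant \<open>c\<close> as
        soon as \<open>ln c \<le> ln T\<close>.\<close>
      using Pout_decay[OF assms, of "m + 1"] m by auto
    have e: "\<forall>\<^sub>F T in at_top. ln c \<le> ln (T::real)" by real_asymp
    show ?thesis
    proof (rule Limsup_bounded)
      show "\<forall>\<^sub>F T in at_top. ereal (ln (Pout V (T powr \<alpha>' - 2) T) / ln T) \<le> ereal (- m)"
        using c(2) e eventually_ge_at_top[of 2]
      proof eventually_elim
        case (elim T)
        have "ln (Pout V (T powr \<alpha>' - 2) T) \<le> ln (c * T powr (- (m + 1)))"
          using elim Pout_pos[of T "T powr \<alpha>' - 2"] by (intro ln_mono) auto
        also have "\<dots> = ln c - (m + 1) * ln T" using elim c(1) by (simp add: ln_mult ln_powr algebra_simps)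
        also have "\<dots> \<le> - m * ln T" using elim(2) by (simp add: algebra_simps)
        finally show ?case using elim(3) by (simp add: pos_divide_le_eq)
      qed
    qed
  qed
  have "?L = -\<infinity>"
  proof -
    have "?L \<le> ereal y" for y
    proof -
      have "?L \<le> ereal (- \<bar>y\<bar>)" using L[of "\<bar>y\<bar>"] by simp
      also have "\<dots> \<le> ereal y" by simp
      finally show ?thesis .
    qed
    thus ?thesis by (rule ereal_bot)
  qed
  thus ?thesis by (simp add: Splus_def)
qed

lemma alpha_u_plus_le: "alpha_u_plus V \<le> ereal \<alpha>"
  unfolding alpha_u_plus_def
proof (rule Sup_least)
  fix y assume "y \<in> ereal ` {\<alpha>'. \<alpha>' \<ge> 0 \<and> Splus V \<alpha>' < \<infinity>}"
  then obtain \<alpha>' where "y = ereal \<alpha>'" "Splus V \<alpha>' < \<infinity>" by auto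
  thus "y \<le> ereal \<alpha>" using Splus_eq_infinity[of \<alpha>'] by (cases "\<alpha>' > \<alpha>") auto
qed

text \<open>Up to the distance \<open>T powr \<alpha>'\<close> the total mass 3 suffices. Beyond it
  the mass is tiny but \<open>\<bar>n\<bar> powr p\<close> is unbounded, so the fast decay of
  \<open>Pout\<close> is combined with the ballistic weights, which control the very remote
  sites.\<close>

lemma moment_bound:
  assumes p: "p > 0" and \<alpha>': "\<alpha>' > \<alpha>"
  obtains D where "D > 0" "\<forall>\<^sub>F T in at_top. moment V p T \<le> ennreal (D * T powr (\<alpha>' * p))"
proof -
  define b where "b = 2 * p"
  have b: "b > 0" using p by (simp add: b_def)
  obtain c where c: "c > 0" "\<forall>\<^sub>F T in at_top. Pout V (T powr \<alpha>' - 2) T \<le> c * T powr (- (b + 1))"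
    using Pout_decay[OF \<alpha>', of "b + 1"] b by auto
  define G where "G = b powr b * 4 powr b"
  have G: "G \<ge> 0" by (simp add: G_def)
  define D where "D = 3 + 3 * G + c"
  have D: "D > 0" using G c(1) by (simp add: D_def)
  have "\<forall>\<^sub>F T in at_top. moment V p T \<le> ennreal (D * T powr (\<alpha>' * p))"
    using c(2) eventually_ge_at_top[of 1]
  proof eventually_elim
    case (elim T)
    note T = elim(2)
    let ?r = "1 + 1 / (2 * T)" and ?a = "\<lambda>n. aa V n T" and ?n = "\<lambda>n::int. real_of_int \<bar>n\<bar>"
    have a0: "?a n \<ge> 0" for n using T by (intro aa_nonneg) auto
    have big: "?n n powr b \<le> G * T powr b * ?r ^ nat \<bar>n\<bar>" for n
    proof -
      have "?n n powr b = (4 * T) powr b * (?n n / (4 * T)) powr b"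
        using T powr_mult[of "4 * T" "?n n / (4 * T)" b] by simp
      also have "\<dots> \<le> (4 * T) powr b * (b powr b * exp (?n n / (4 * T)))"
        using T b by (intro mult_left_mono powr_le_exp) auto
      also have "\<dots> \<le> (4 * T) powr b * (b powr b * ?r ^ nat \<bar>n\<bar>)"
        using T by (intro mult_left_mono exp_le_one_plus) auto
      also have "\<dots> = G * T powr b * ?r ^ nat \<bar>n\<bar>"
        using T powr_mult[of 4 T b] by (simp add: G_def mult_ac)
      finally show ?thesis .
    qed
    have Tb: "T powr b > 0" using T by simp
    \<comment> \<open>A splitting into two parts, with \<open>b = 2 * p\<close> so that the left
      side is squared. The first part is handled by the exponential weights through
      \<open>big\<close>, the second by the decay of \<open>Pout\<close> faster than
      \<open>T powr (- b)\<close>.\<close>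
    have young: "?n n powr p \<le> ?n n powr b / T powr b + T powr b" for n
    proof -
      let ?X = "?n n powr p"
      have sq: "?n n powr b = ?X\<^sup>2" by (simp add: b_def power2_eq_square powr_add[symmetric])
      show ?thesis
      proof (cases "?X \<le> T powr b")
        case True
        thus ?thesis unfolding sq using Tb by (simp add: add_increasing)
      next
        case False
        have "?X * T powr b \<le> ?X\<^sup>2" unfolding power2_eq_square using False by (intro mult_left_mono) auto
        hence "?X \<le> ?X\<^sup>2 / T powr b" using Tb by (simp add: pos_le_divide_eq)
        thus ?thesis unfolding sq using Tb by linarith
      qed
    qed
    have fin: "(\<Sum>n\<in>F. ?n n powr p * ?a n) \<le> D * T powr (\<alpha>' * p)" if F: "finite F" for F
    proof -
      let ?F1 = "{n\<in>F. ?n n \<le> T powr \<alpha>'}" and ?F2 = "{n\<in>F. \<not> ?n n \<le> T powr \<alpha>'}"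
      have "(\<Sum>n\<in>F. ?n n powr p * ?a n) = (\<Sum>n\<in>?F1 \<union> ?F2. ?n n powr p * ?a n)"
        by (rule arg_cong[of _ _ "sum _"]) auto
      also have "\<dots> = (\<Sum>n\<in>?F1. ?n n powr p * ?a n) + (\<Sum>n\<in>?F2. ?n n powr p * ?a n)"
        using F by (intro sum.union_disjoint) auto
      also have "(\<Sum>n\<in>?F1. ?n n powr p * ?a n) \<le> 3 * T powr (\<alpha>' * p)"
      proof -
        have "(\<Sum>n\<in>?F1. ?n n powr p * ?a n) \<le> (\<Sum>n\<in>?F1. T powr (\<alpha>' * p) * ?a n)"
        proof (intro sum_mono mult_right_mono a0)
          fix n assume "n \<in> ?F1"
          hence "?n n powr p \<le> (T powr \<alpha>') powr p" using p by (intro powr_mono2) auto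
          thus "?n n powr p \<le> T powr (\<alpha>' * p)" by (simp add: powr_powr)
        qed
        also have "\<dots> = T powr (\<alpha>' * p) * (\<Sum>n\<in>?F1. ?a n)" by (simp add: sum_distrib_left)
        also have "\<dots> \<le> T powr (\<alpha>' * p) * 3" using T F by (intro mult_left_mono aa_sum_le) auto
        finally show ?thesis by simp
      qed
      also have "(\<Sum>n\<in>?F2. ?n n powr p * ?a n) \<le> 3 * G + c"
      proof -
        have "(\<Sum>n\<in>?F2. ?n n powr p * ?a n) \<le> (\<Sum>n\<in>?F2. G * (?r ^ nat \<bar>n\<bar> * ?a n) + T powr b * ?a n)"
        proof (intro sum_mono)
          fix n
          have "?n n powr p * ?a n \<le> (?n n powr b / T powr b + T powr b) * ?a n"
            by (intro mult_right_mono young a0)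
          also have "\<dots> \<le> ((G * T powr b * ?r ^ nat \<bar>n\<bar>) / T powr b + T powr b) * ?a n"
            using Tb by (intro mult_right_mono add_right_mono divide_right_mono big a0) auto
          also have "\<dots> = G * (?r ^ nat \<bar>n\<bar> * ?a n) + T powr b * ?a n" using Tb by (simp add: algebra_simps)
          finally show "?n n powr p * ?a n \<le> G * (?r ^ nat \<bar>n\<bar> * ?a n) + T powr b * ?a n" .
        qed
        also have "\<dots> = G * (\<Sum>n\<in>?F2. ?r ^ nat \<bar>n\<bar> * ?a n) + T powr b * (\<Sum>n\<in>?F2. ?a n)"
          by (simp add: sum.distrib sum_distrib_left)
        also have "\<dots> \<le> G * 3 + T powr b * (c * T powr (- (b + 1)))"
        proof (intro add_mono mult_left_mono G)
          have "(\<Sum>n\<in>?F2. ?r ^ nat \<bar>n\<bar> * ?a n) \<le> 2 * ?r" using T F by (intro weighted_aa_sum_le) auto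
          also have "\<dots> \<le> 3" using T by (simp add: field_simps)
          finally show "(\<Sum>n\<in>?F2. ?r ^ nat \<bar>n\<bar> * ?a n) \<le> 3" .
          \<comment> \<open>Sites beyond \<open>T powr \<alpha>'\<close> are in particular beyond
            the smaller threshold \<open>T powr \<alpha>' - 2\<close>.\<close>
          have "(\<Sum>n\<in>?F2. ?a n) \<le> Pout V (T powr \<alpha>' - 2) T"
            unfolding Pout_def using F T a0 by (intro finite_sum_le_infsum aa_summable) auto
          thus "(\<Sum>n\<in>?F2. ?a n) \<le> c * T powr (- (b + 1))" using elim(1) by linarith
        qed simp
        also have "T powr b * (c * T powr (- (b + 1))) = c * T powr (- 1)"
          using T by (simp add: powr_add[symmetric] mult.left_commute)
        also have "T powr (- 1) \<le> 1" using T by (simp add: powr_minus inverse_le_1_iff)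
        finally show ?thesis using c(1) by (simp add: mult_left_mono mult.commute)
      qed
      also have "3 * G + c \<le> (3 * G + c) * T powr (\<alpha>' * p)"
      proof -
        have "1 \<le> T powr (\<alpha>' * p)" using T p \<alpha> \<alpha>' by (intro ge_one_powr_ge_zero) auto
        thus ?thesis using G c(1) mult_left_mono[of 1 "T powr (\<alpha>' * p)" "3 * G + c"] by simp
      qed
      finally show ?thesis by (simp add: D_def algebra_simps)
    qed
    show ?case
      unfolding moment_def
    proof (rule infsum_le_finite_sums)
      fix F :: "int set" assume F: "finite F"
      have "(\<Sum>n\<in>F. ennreal (\<bar>real_of_int n\<bar> powr p * ?a n)) = ennreal (\<Sum>n\<in>F. \<bar>real_of_int n\<bar> powr p * ?a n)"
        by (rule sum_ennreal) (simp add: a0)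
      also have "\<dots> \<le> ennreal (D * T powr (\<alpha>' * p))"
        using fin[OF F] by (intro ennreal_leI) simp
      finally show "(\<Sum>n\<in>F. ennreal (\<bar>real_of_int n\<bar> powr p * ?a n)) \<le> ennreal (D * T powr (\<alpha>' * p))" .
    qed (rule nonneg_summable_on_complete, simp)
  qed
  thus ?thesis using D that by blast
qed

lemma beta_plus_le:
  assumes p: "p > 0"
  shows "beta_plus V p \<le> ereal \<alpha>"
  unfolding beta_plus_def
proof (rule ereal_Limsup_le_of_reals)
  fix y assume y: "y > \<alpha>"
  \<comment> \<open>The room between \<open>\<alpha>'\<close> and \<open>y\<close> absorbs the
    constant \<open>D\<close>.\<close>
  define \<alpha>' where "\<alpha>' = (\<alpha> + y) / 2"
  have \<alpha>': "\<alpha>' > \<alpha>" "\<alpha>' < y" using y by (auto simp: \<alpha>'_def)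
  obtain D where D: "D > 0" "\<forall>\<^sub>F T in at_top. moment V p T \<le> ennreal (D * T powr (\<alpha>' * p))"
    using moment_bound[OF p \<alpha>'(1)] .
  have e: "\<forall>\<^sub>F T in at_top. ln D \<le> ((y - \<alpha>') * p) * ln (T::real)"
  proof -
    have "(y - \<alpha>') * p > 0" using p \<alpha>' by simp
    thus ?thesis by real_asymp
  qed
  show "\<forall>\<^sub>F T in at_top. (if moment V p T = top then \<infinity> else ereal (ln (enn2real (moment V p T)) / (p * ln T))) \<le> ereal y"
    using D(2) e eventually_ge_at_top[of 2]
  proof eventually_elim
    case (elim T)
    let ?m = "enn2real (moment V p T)"
    have fin: "moment V p T \<noteq> top" using elim(1) by (auto simp: top_unique)
    have pl: "p * ln T > 0" using p elim(3) by simp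
    have "ln ?m \<le> y * (p * ln T)"
    proof (cases "?m = 0")
      \<comment> \<open>Here \<open>ln 0 = 0\<close> applies, and the bound holds because
        \<open>y > \<alpha> > 0\<close>.\<close>
      case True
      thus ?thesis using pl y \<alpha> by simp
    next
      case False
      hence pos: "?m > 0" by (simp add: order_less_le)
      have "?m \<le> enn2real (ennreal (D * T powr (\<alpha>' * p)))" using elim(1) by (intro enn2real_mono) auto
      also have "\<dots> = D * T powr (\<alpha>' * p)" using D(1) by simp
      finally have "ln ?m \<le> ln (D * T powr (\<alpha>' * p))" using pos by (intro ln_mono) auto
      also have "\<dots> = ln D + \<alpha>' * p * ln T" using D(1) elim(3) by (simp add: ln_mult ln_powr)
      also have "\<dots> \<le> y * (p * ln T)" using elim(2) by (simp add: algebra_simps)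
      finally show ?thesis .
    qed
    hence "ln ?m / (p * ln T) \<le> y" using pl by (simp only: pos_divide_le_eq)
    thus ?case using fin by simp
  qed
qed

end

theorem theorem1:
  fixes V :: "int \<Rightarrow> real" and K C \<alpha> :: real
  assumes "bounded (range V)"
    and "K \<ge> 4"
    and "spec V \<subseteq> complex_of_real ` {-K+1..K-1}"
    and "C > 0" and "0 < \<alpha>" and "\<alpha> < 1"
    and "\<forall>m::real. m \<ge> 1 \<longrightarrow>
      (\<lambda>T. integral {-K..K} (\<lambda>E. inverse (Max ((\<lambda>n. (mnorm (Phi V n (complex_of_real E + \<i> / complex_of_real T)))\<^sup>2)
            ` {n::int. 3 \<le> n \<and> real_of_int n \<le> C * T powr \<alpha>}))))
        \<in> O[at_top](\<lambda>T. T powr (- m))"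
    and "\<forall>m::real. m \<ge> 1 \<longrightarrow>
      (\<lambda>T. integral {-K..K} (\<lambda>E. inverse (Max ((\<lambda>n. (mnorm (Phi V n (complex_of_real E + \<i> / complex_of_real T)))\<^sup>2)
            ` {n::int. 3 \<le> - n \<and> real_of_int (- n) \<le> C * T powr \<alpha>}))))
        \<in> O[at_top](\<lambda>T. T powr (- m))"
  shows "alpha_u_plus V \<le> ereal \<alpha> \<and> (\<forall>p>0. beta_plus V p \<le> ereal \<alpha>)"
proof -
  obtain B where B: "\<And>n. \<bar>V n\<bar> \<le> B" using assms(1) by (auto simp: bounded_iff)
  interpret bounded_potential V B by standard (rule B)
  have out: "complex_of_real x \<notin> spec V" if "\<bar>x\<bar> > K - 1" for x
  proof
    assume "complex_of_real x \<in> spec V"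
    then obtain y where "y \<in> {-K+1..K-1}" "complex_of_real x = complex_of_real y" using assms(3) by blast
    thus False using that by auto
  qed
  interpret transfer_decay V B K C \<alpha>
  proof
    fix f assume f: "f \<in> ell2"
    have "1 * ip f (Hop V f) \<le> (K - 1) * ip f f"
      by (rule numerical_range_bound[OF _ _ f]) (use out in auto)
    moreover have "(-1) * ip f (Hop V f) \<le> (K - 1) * ip f f"
    proof (rule numerical_range_bound[OF _ _ f])
      show "complex_of_real (- 1 * x) \<notin> spec V" if "x > K - 1" for x using out[of "- x"] that by auto
    qed auto
    ultimately show "\<bar>ip f (Hop V f)\<bar> \<le> (K - 1) * ip f f" by linarith
  qed (use assms in \<open>auto simp: inv_max_transfer_def\<close>)
  show ?thesis using alpha_u_plus_le beta_plus_le by blast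
qed

end
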